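(* Let $T$ be a bounded operator on $L^2(\mathbb{R}^{n_1+n_2})$ and $T_j=T\circ\chi_j(G_\varkappa)$ with integral kernels satisfying conditions (K3) and (K5) for some $R_0>Q$. Let $s=8C_{1,\varkappa}C_0^3\delta_0^{-1}$. Then there is $C>0$ such that for every bounded measurable $f$ with compact support, $\mathcal M^{\#}_{T,s}f(x)\le C\,\mathcal Mf(x)$ for a.e. $x\in\mathbb{R}^{n_1+n_2}$.
   Context: Fix $n_1,n_2\ge1$, $\varkappa\in\mathbb{N}_+$; $x=(x',x'')$; $G_\varkappa=-\Delta_{x'}-V_\varkappa(x')\Delta_{x''}$ with $V_\varkappa(x')$ one fixed choice of $|x'|^{2\varkappa}$ or $\sum_j(x'_j)^{2\varkappa}$; $Q=n_1+(1+\varkappa)n_2$. $\chi_j(G_\varkappa)=\mathbf 1_{I_j}(G_\varkappa)$, $I_0=[0,1)$, $I_j=[2^{j-1},2^j)$. Vector fields $X_j=\partial_{x'_j}$, $X_{\alpha,k}=(x')^\alpha\partial_{x''_k}$ ($|\alpha|=\varkappa$); $X=(X_j,X_{\alpha,k})$ with Euclidean length $|X\cdot|$. $d(x,y)=|x'-y'|+\min\{|x''-y''|(|x'|+|y'|)^{-\varkappa},|x''-y''|^{1/(1+\varkappa)}\}$; $C_0>1$ with $d(x,y)\le C_0(d(x,z)+d(z,y))$; $B(x,r)=\{y:d(x,y)<r\}$, $sB(\mathfrak z,r)=B(\mathfrak z,sr)$. $\delta_0\in(0,1)$ is the scale constant of a fixed Christ dyadic decomposition of $(\mathbb{R}^{n_1+n_2},d,|\cdot|)$.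 $C_{1,\varkappa}$ is the constant of the mean-value estimate: for any ball $B(x_0,r)$ and $x,y\in B(x_0,r)$ there is a curve $\gamma_0:[0,1]\to B(x_0,C_{1,\varkappa}r)$ from $x$ to $y$ with $|f(x)-f(y)|\le C_{2,\varkappa}d(x,y)\int_0^1|Xf(\gamma_0(t))|dt$. $\mathcal M$ is the uncentred Hardy–Littlewood maximal function over $d$-balls. $\mathcal M^{\#}_{T,s}f(x)=\sup_{B\ni x}\operatorname{ess\,sup}_{y,z\in B}|T(f\chi_{\mathbb{R}^{n_1+n_2}\setminus sB})(y)-T(f\chi_{\mathbb{R}^{n_1+n_2}\setminus sB})(z)|$. With $W_j(x,y)=|B(x,2^{-j/2})|^{1/2}|B(y,2^{-j/2})|^{1/2}d(x,y)^{\mathfrak r}$ (constants uniform in $j$, $\mathfrak r\in[0,R_0]$): (K3) $\sup_{x,y}W_j(x,y)|T_j(x,y)|\lesssim2^{-j\mathfrak r/2}$; (K5) for all $\mathcal K_0>0$: $\sup_x\sup_{d(x,y)<\mathcal K_0}W_j(x,y)|X_xT_j(x,y)|\lesssim_{\mathcal K_0}2^{-j\mathfrak r/2}2^{j/2}$. *)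

theory Defs
  imports "HOL-Analysis.Analysis"
begin

text \<open>Points of R^(n1+n2) are pairs (x', x'') :: (real^'a) \<times> (real^'b),
  with n1 = CARD('a), n2 = CARD('b).  All functions are complex valued.\<close>

type_synonym ('a, 'b) pt = "(real^'a) \<times> (real^'b)"

definition dist_k :: "nat \<Rightarrow> ('a::finite, 'b::finite) pt \<Rightarrow> ('a, 'b) pt \<Rightarrow> real" where
  "dist_k \<kappa> x y =
     (let \<rho> = norm (snd x - snd y); s = norm (fst x) + norm (fst y) in
      norm (fst x - fst y) +
      (if s = 0 then \<rho> powr (1 / (1 + real \<kappa>))
       else min (\<rho> / s ^ \<kappa>) (\<rho> powr (1 / (1 + real \<kappa>)))))"

definition dball :: "nat \<Rightarrow> ('a::finite, 'b::finite) pt \<Rightarrow> real \<Rightarrow> ('a, 'b) pt set" where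
  "dball \<kappa> z r = {y. dist_k \<kappa> z y < r}"

definition Vpot :: "bool \<Rightarrow> nat \<Rightarrow> real^'a::finite \<Rightarrow> real" where
  "Vpot hom \<kappa> x' = (if hom then norm x' ^ (2 * \<kappa>) else (\<Sum>j\<in>UNIV. (x' $ j) ^ (2 * \<kappa>)))"

definition Dd :: "('p::real_normed_vector \<Rightarrow> 'c::real_normed_vector) \<Rightarrow> 'p \<Rightarrow> 'p \<Rightarrow> 'c" where
  "Dd f v x = frechet_derivative f (at x) v"

definition e1 :: "'a::finite \<Rightarrow> ('a, 'b::finite) pt" where "e1 i = (axis i 1, 0)"
definition e2 :: "'b::finite \<Rightarrow> ('a::finite, 'b) pt" where "e2 k = (0, axis k 1)"

definition mindex :: "nat \<Rightarrow> ('a::finite \<Rightarrow> nat) set" where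
  "mindex \<kappa> = {\<alpha>. (\<Sum>i\<in>UNIV. \<alpha> i) = \<kappa>}"

definition mono_x :: "('a::finite \<Rightarrow> nat) \<Rightarrow> real^'a \<Rightarrow> real" where
  "mono_x \<alpha> x' = (\<Prod>i\<in>UNIV. (x' $ i) ^ (\<alpha> i))"

definition Xlen :: "nat \<Rightarrow> (('a::finite, 'b::finite) pt \<Rightarrow> 'c::real_normed_vector) \<Rightarrow> ('a, 'b) pt \<Rightarrow> real" where
  "Xlen \<kappa> f x = sqrt ((\<Sum>j\<in>UNIV. (norm (Dd f (e1 j) x))\<^sup>2)
      + (\<Sum>\<alpha>\<in>mindex \<kappa>. \<Sum>k\<in>UNIV. (norm (mono_x \<alpha> (fst x) *\<^sub>R Dd f (e2 k) x))\<^sup>2))"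

fun Ditr :: "'p::real_normed_vector list \<Rightarrow> ('p \<Rightarrow> 'c::real_normed_vector) \<Rightarrow> 'p \<Rightarrow> 'c" where
  "Ditr [] f = f"
| "Ditr (v # vs) f = Dd (Ditr vs f) v"

definition test_fun :: "(('a::finite, 'b::finite) pt \<Rightarrow> complex) \<Rightarrow> bool" where
  "test_fun \<phi> \<longleftrightarrow> (\<forall>vs x. Ditr vs \<phi> differentiable (at x)) \<and> compact (closure {x. \<phi> x \<noteq> 0})"

definition Grushin :: "bool \<Rightarrow> nat \<Rightarrow> (('a::finite, 'b::finite) pt \<Rightarrow> complex) \<Rightarrow> ('a, 'b) pt \<Rightarrow> complex" where
  "Grushin hom \<kappa> \<phi> x =
     - (\<Sum>j\<in>UNIV. Ditr [e1 j, e1 j] \<phi> x)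
     - complex_of_real (Vpot hom \<kappa> (fst x)) * (\<Sum>k\<in>UNIV. Ditr [e2 k, e2 k] \<phi> x)"

definition L2 :: "('p::euclidean_space \<Rightarrow> complex) set" where
  "L2 = {f. f \<in> borel_measurable lborel \<and> integrable lborel (\<lambda>x. (norm (f x))\<^sup>2)}"

definition L2norm :: "('p::euclidean_space \<Rightarrow> complex) \<Rightarrow> real" where
  "L2norm f = sqrt (\<integral>x. (norm (f x))\<^sup>2 \<partial>lborel)"

definition L2inner :: "('p::euclidean_space \<Rightarrow> complex) \<Rightarrow> ('p \<Rightarrow> complex) \<Rightarrow> complex" where
  "L2inner f g = (\<integral>x. f x * cnj (g x) \<partial>lborel)"

definition bounded_op :: "(('p::euclidean_space \<Rightarrow> complex) \<Rightarrow> ('p \<Rightarrow> complex)) \<Rightarrow> bool" where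
  "bounded_op T \<longleftrightarrow>
     (\<forall>f\<in>L2. T f \<in> L2) \<and>
     (\<forall>f\<in>L2. \<forall>g\<in>L2. AE x in lborel. T (\<lambda>y. f y + g y) x = T f x + T g x) \<and>
     (\<forall>f\<in>L2. \<forall>c. AE x in lborel. T (\<lambda>y. c * f y) x = c * T f x) \<and>
     (\<forall>f\<in>L2. \<forall>g\<in>L2. (AE x in lborel. f x = g x) \<longrightarrow> (AE x in lborel. T f x = T g x)) \<and>
     (\<exists>C. \<forall>f\<in>L2. L2norm (T f) \<le> C * L2norm f)"

definition spectral_measure :: "(real set \<Rightarrow> ('p::euclidean_space \<Rightarrow> complex) \<Rightarrow> ('p \<Rightarrow> complex)) \<Rightarrow> bool" where
  "spectral_measure E \<longleftrightarrow>
     (\<forall>A\<in>sets borel. bounded_op (E A)) \<and>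
     (\<forall>A\<in>sets borel. \<forall>f\<in>L2. \<forall>g\<in>L2. L2inner (E A f) g = L2inner f (E A g)) \<and>
     (\<forall>A\<in>sets borel. \<forall>B\<in>sets borel. \<forall>f\<in>L2. AE x in lborel. E (A \<inter> B) f x = E A (E B f) x) \<and>
     (\<forall>f\<in>L2. AE x in lborel. E UNIV f x = f x) \<and>
     (\<forall>A::nat \<Rightarrow> real set. (\<forall>n. A n \<in> sets borel) \<and> disjoint_family A \<longrightarrow>
        (\<forall>f\<in>L2. (\<lambda>N. L2norm (\<lambda>x. E (\<Union>n. A n) f x - (\<Sum>n<N. E (A n) f x))) \<longlonglongrightarrow> 0))"

definition spec_mu :: "(real set \<Rightarrow> ('p::euclidean_space \<Rightarrow> complex) \<Rightarrow> ('p \<Rightarrow> complex)) \<Rightarrow> ('p \<Rightarrow> complex) \<Rightarrow> real measure" where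
  "spec_mu E \<phi> = measure_of UNIV (sets borel) (\<lambda>A. ennreal ((L2norm (E A \<phi>))\<^sup>2))"

text \<open>E is the spectral resolution of the self-adjoint operator G_kappa (the closure of the
  Grushin operator on C_c^infty): the self-adjoint operator integral(lambda dE) extends G on
  C_c^infty.  Since G is essentially self-adjoint on C_c^infty this determines E uniquely.\<close>
definition spectral_resolution_G :: "bool \<Rightarrow> nat \<Rightarrow> (real set \<Rightarrow> (('a::finite, 'b::finite) pt \<Rightarrow> complex) \<Rightarrow> (('a, 'b) pt \<Rightarrow> complex)) \<Rightarrow> bool" where
  "spectral_resolution_G hom \<kappa> E \<longleftrightarrow> spectral_measure E \<and>
     (\<forall>\<phi>. test_fun \<phi> \<longrightarrow>
        integrable (spec_mu E \<phi>) (\<lambda>t. t\<^sup>2) \<and>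
        complex_of_real (\<integral>t. t \<partial>spec_mu E \<phi>) = L2inner (Grushin hom \<kappa> \<phi>) \<phi>)"

definition Ij :: "nat \<Rightarrow> real set" where
  "Ij j = (if j = 0 then {0..<1} else {2 ^ (j - 1)..<2 ^ j})"

definition pow0 :: "real \<Rightarrow> real \<Rightarrow> real" where
  "pow0 t r = (if r = 0 then 1 else t powr r)"   \<comment> \<open>t^r with the convention t^0 = 1\<close>

definition Wj :: "nat \<Rightarrow> nat \<Rightarrow> real \<Rightarrow> ('a::finite, 'b::finite) pt \<Rightarrow> ('a, 'b) pt \<Rightarrow> real" where
  "Wj \<kappa> j r x y =
     sqrt (measure lborel (dball \<kappa> x (2 powr (- real j / 2))))
   * sqrt (measure lborel (dball \<kappa> y (2 powr (- real j / 2))))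
   * pow0 (dist_k \<kappa> x y) r"

text \<open>K j is an integral kernel of T_j = T o chi_j(G), chi_j(G) = E(I_j).\<close>
definition is_kernel_of :: "(('p::euclidean_space \<Rightarrow> complex) \<Rightarrow> ('p \<Rightarrow> complex)) \<Rightarrow> ('p \<Rightarrow> 'p \<Rightarrow> complex) \<Rightarrow> bool" where
  "is_kernel_of S K \<longleftrightarrow> (\<forall>f\<in>L2. AE x in lborel.
      integrable lborel (\<lambda>y. K x y * f y) \<and> S f x = (\<integral>y. K x y * f y \<partial>lborel))"

definition cond_K3 :: "nat \<Rightarrow> real \<Rightarrow> (nat \<Rightarrow> ('a::finite, 'b::finite) pt \<Rightarrow> ('a, 'b) pt \<Rightarrow> complex) \<Rightarrow> bool" where
  "cond_K3 \<kappa> R0 K \<longleftrightarrow> (\<exists>C. \<forall>j r x y. 0 \<le> r \<and> r \<le> R0 \<longrightarrow>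
      Wj \<kappa> j r x y * norm (K j x y) \<le> C * 2 powr (- real j * r / 2))"

definition cond_K5 :: "nat \<Rightarrow> real \<Rightarrow> (nat \<Rightarrow> ('a::finite, 'b::finite) pt \<Rightarrow> ('a, 'b) pt \<Rightarrow> complex) \<Rightarrow> bool" where
  "cond_K5 \<kappa> R0 K \<longleftrightarrow>
     (\<forall>j x y. (\<lambda>x. K j x y) differentiable (at x)) \<and>
     (\<forall>K0>0. \<exists>C. \<forall>j r x y. 0 \<le> r \<and> r \<le> R0 \<and> dist_k \<kappa> x y < K0 \<longrightarrow>
        Wj \<kappa> j r x y * Xlen \<kappa> (\<lambda>x. K j x y) x \<le> C * 2 powr (- real j * r / 2) * 2 powr (real j / 2))"

definition HLmax :: "nat \<Rightarrow> (('a::finite, 'b::finite) pt \<Rightarrow> complex) \<Rightarrow> ('a, 'b) pt \<Rightarrow> ennreal" where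
  "HLmax \<kappa> f x = (SUP zr\<in>{(z, r). 0 < r \<and> x \<in> dball \<kappa> z r}.
      (\<integral>\<^sup>+ y\<in>dball \<kappa> (fst zr) (snd zr). ennreal (norm (f y)) \<partial>lborel)
        / emeasure lborel (dball \<kappa> (fst zr) (snd zr)))"

definition osc_esssup :: "('p::euclidean_space \<Rightarrow> complex) \<Rightarrow> 'p set \<Rightarrow> ennreal" where
  "osc_esssup g B = Inf {c. AE p in lborel. p \<in> B \<times> B \<longrightarrow> ennreal (norm (g (fst p) - g (snd p))) \<le> c}"

definition sharp_max :: "nat \<Rightarrow> ((('a::finite, 'b::finite) pt \<Rightarrow> complex) \<Rightarrow> (('a, 'b) pt \<Rightarrow> complex))
     \<Rightarrow> real \<Rightarrow> (('a, 'b) pt \<Rightarrow> complex) \<Rightarrow> ('a, 'b) pt \<Rightarrow> ennreal" where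
  "sharp_max \<kappa> T s f x = (SUP zr\<in>{(z, r). 0 < r \<and> x \<in> dball \<kappa> z r}.
      osc_esssup (T (\<lambda>y. f y * indicator (UNIV - dball \<kappa> (fst zr) (s * snd zr)) y))
                 (dball \<kappa> (fst zr) (snd zr)))"

definition quasi_tri_const :: "nat \<Rightarrow> ('a::finite, 'b::finite) pt itself \<Rightarrow> real \<Rightarrow> bool" where
  "quasi_tri_const \<kappa> _ C0 \<longleftrightarrow> C0 > 1 \<and>
     (\<forall>x y z :: ('a, 'b) pt. dist_k \<kappa> x y \<le> C0 * (dist_k \<kappa> x z + dist_k \<kappa> z y))"

definition C1_fun :: "(('a::finite, 'b::finite) pt \<Rightarrow> real) \<Rightarrow> bool" where
  "C1_fun f \<longleftrightarrow> (\<forall>x. f differentiable (at x)) \<and> (\<forall>v. continuous_on UNIV (Dd f v))"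

definition mean_value_const :: "nat \<Rightarrow> ('a::finite, 'b::finite) pt itself \<Rightarrow> real \<Rightarrow> bool" where
  "mean_value_const \<kappa> _ C1 \<longleftrightarrow> (\<exists>C2. \<forall>(x0 :: ('a, 'b) pt) r x y.
     0 < r \<and> x \<in> dball \<kappa> x0 r \<and> y \<in> dball \<kappa> x0 r \<longrightarrow>
     (\<exists>\<gamma> :: real \<Rightarrow> ('a, 'b) pt. continuous_on {0..1} \<gamma> \<and> \<gamma> ` {0..1} \<subseteq> dball \<kappa> x0 (C1 * r) \<and> \<gamma> 0 = x \<and> \<gamma> 1 = y \<and>
        (\<forall>f. C1_fun f \<longrightarrow>
           \<bar>f x - f y\<bar> \<le> C2 * dist_k \<kappa> x y * integral {0..1} (\<lambda>t. Xlen \<kappa> f (\<gamma> t)))))"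

text \<open>delta is the scale constant of a Christ dyadic decomposition of (R^(n1+n2), d, Lebesgue).\<close>
definition christ_scale :: "nat \<Rightarrow> ('a::finite, 'b::finite) pt itself \<Rightarrow> real \<Rightarrow> bool" where
  "christ_scale \<kappa> _ \<delta> \<longleftrightarrow> 0 < \<delta> \<and> \<delta> < 1 \<and>
    (\<exists>(Q :: int \<Rightarrow> nat \<Rightarrow> ('a, 'b) pt set) (I :: int \<Rightarrow> nat set) z a0 c1 c2 \<eta>.
       0 < a0 \<and> 0 < c1 \<and> 0 < c2 \<and> 0 < \<eta> \<and>
       (\<forall>k. \<forall>\<alpha>\<in>I k. open (Q k \<alpha>)) \<and>
       (\<forall>k. UNIV - (\<Union>\<alpha>\<in>I k. Q k \<alpha>) \<in> null_sets lborel) \<and>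
       (\<forall>k l \<alpha> \<beta>. k \<le> l \<and> \<alpha> \<in> I k \<and> \<beta> \<in> I l \<longrightarrow> Q l \<beta> \<subseteq> Q k \<alpha> \<or> Q l \<beta> \<inter> Q k \<alpha> = {}) \<and>
       (\<forall>k l \<alpha>. \<alpha> \<in> I k \<and> l < k \<longrightarrow> (\<exists>!\<beta>. \<beta> \<in> I l \<and> Q k \<alpha> \<subseteq> Q l \<beta>)) \<and>
       (\<forall>k. \<forall>\<alpha>\<in>I k. \<forall>x\<in>Q k \<alpha>. \<forall>y\<in>Q k \<alpha>. dist_k \<kappa> x y \<le> c1 * \<delta> powr real_of_int k) \<and>
       (\<forall>k. \<forall>\<alpha>\<in>I k. dball \<kappa> (z k \<alpha>) (a0 * \<delta> powr real_of_int k) \<subseteq> Q k \<alpha>) \<and>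
       (\<forall>k. \<forall>\<alpha>\<in>I k. \<forall>t>0.
          emeasure lborel {x\<in>Q k \<alpha>. Inf {dist_k \<kappa> x y | y. y \<notin> Q k \<alpha>} \<le> t * \<delta> powr real_of_int k}
            \<le> ennreal (c2 * t powr \<eta>) * emeasure lborel (Q k \<alpha>)))"

end

theory Submission
  imports Defs
begin

text \<open>
  The hypothesis on \<open>E\<close> only says that the self-adjoint operator \<open>A\<close> given by \<open>E\<close> extends the
  Grushin operator \<open>G\<close> on test functions, so \<open>E {..<0} = 0\<close> has to be proved first.  If \<open>u\<close> is in the range of
  \<open>E {a..<b}\<close> with \<open>b < 0\<close>, then \<open>G u\<close> is within \<open>b - a\<close> of \<open>a u\<close> weakly.  Regularise \<open>u\<close> to \<open>U\<close> and test with \<open>\<eta>\<^sup>2 U\<close> for a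
  cutoff \<open>\<eta>\<close>: integration by parts gives \<open>Re \<langle>G U, \<eta>\<^sup>2 U\<rangle> \<ge> - \<integral> |X \<eta>|\<^sup>2 |U|\<^sup>2\<close>, and in the limit
  \<open>0 \<le> b \<parallel>u\<parallel>\<^sup>2\<close>, hence \<open>u = 0\<close>.

  Consequently \<open>T f = (\<Sum>j. T (E (Ij j) f))\<close> in the mean, and along a subsequence almost everywhere.  On the annulus
  \<open>R \<le> d(z, w) < 2 R\<close> the oscillation of \<open>K j (\<cdot>) w\<close> over the ball of radius \<open>r\<close> around \<open>z\<close> is controlled by the size
  condition with exponent \<open>0\<close> or \<open>R0\<close>, interpolated for \<open>R \<le> 1\<close> with the gradient condition.  The resulting
  bounds are summable both in \<open>j\<close> and over dyadic \<open>R \<ge> s r\<close>.  The kernels are only assumed to be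
  differentiable, not continuously differentiable, so the mean value estimate is proved directly along an explicit
  path of three segments.
\<close>

section \<open>Square-integrable functions\<close>

text \<open>The sets \<open>Ij j\<close> cover only the half line [0, infinity), so the sum over j
  loses whatever \<open>E {..<0}\<close> carries; hence the sign of the spectrum matters. The
  unbounded integral of t against \<open>E\<close> is never formed: finite sums
  \<open>step_op n\<close> stand in for it and all information passes through weak limits. The
  window {a..<b} may have any length, because the approximate eigenvalue a and the error b - a add
  up to b < 0. Mollification does not commute with the coefficient V. The commutator costs the
  oscillation of V at horizontal scale 1/s times the L1 norm of the second vertical derivatives of
  the kernel, which is of order t^2 and does not see s. So t is fixed first and s is taken large
  afterwards. The kernel expansion holds only off a null set that depends on the ball. The essential
  oscillation over that ball absorbs it, so the maximal inequality comes out at every point. With u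
  = 2^(j/2) R, the oscillation on the annulus of radius R carries the factor min(u, 1/u)^\<theta>,
  which decays geometrically in j on both sides of u = 1; its other factor decays geometrically in
  R.\<close>

lemma L2_measurable [measurable_dest]: "f \<in> L2 \<Longrightarrow> f \<in> borel_measurable borel"
  by (simp add: L2_def)

lemma L2_integrable_sq: "f \<in> L2 \<Longrightarrow> integrable lborel (\<lambda>x. (norm (f x))\<^sup>2)"
  by (simp add: L2_def)

lemma L2I: "f \<in> borel_measurable borel \<Longrightarrow> integrable lborel (\<lambda>x. (norm (f x))\<^sup>2) \<Longrightarrow> f \<in> L2"
  by (simp add: L2_def)

lemma L2_bound:
  assumes "f \<in> L2" "g \<in> borel_measurable borel" "\<And>x. norm (g x) \<le> C * norm (f x)"
  shows "g \<in> L2"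
proof (rule L2I)
  note [measurable] = L2_measurable[OF assms(1)] assms(2)
  show "integrable lborel (\<lambda>x. (norm (g x))\<^sup>2)"
  proof (rule Bochner_Integration.integrable_bound[OF integrable_mult_right[OF L2_integrable_sq[OF assms(1)], of "C\<^sup>2"]])
    have "(norm (g x))\<^sup>2 \<le> C\<^sup>2 * (norm (f x))\<^sup>2" for x
      using power_mono[OF assms(3) norm_ge_zero, of x 2] by (simp add: power_mult_distrib)
    then show "AE x in lborel. norm ((norm (g x))\<^sup>2) \<le> norm (C\<^sup>2 * (norm (f x))\<^sup>2)" by auto
  qed simp
qed fact

lemma L2_zero [simp]: "(\<lambda>x. 0) \<in> L2"
  by (simp add: L2_def)

lemma L2_scale: "f \<in> L2 \<Longrightarrow> (\<lambda>x. c * f x) \<in> L2"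
  by (rule L2_bound[where C = "norm c"]) (auto simp: norm_mult dest: L2_measurable)

lemma L2_add:
  assumes "f \<in> L2" "g \<in> L2" shows "(\<lambda>x. f x + g x) \<in> L2"
proof (rule L2I)
  note [measurable] = L2_measurable[OF assms(1)] L2_measurable[OF assms(2)]
  show "(\<lambda>x. f x + g x) \<in> borel_measurable borel" by simp
  have "(norm (f x + g x))\<^sup>2 \<le> 2 * (norm (f x))\<^sup>2 + 2 * (norm (g x))\<^sup>2" for x
  proof -
    have "(norm (f x + g x))\<^sup>2 \<le> (norm (f x) + norm (g x))\<^sup>2"
      by (intro power_mono norm_triangle_ineq norm_ge_zero)
    also have "\<dots> \<le> 2 * (norm (f x))\<^sup>2 + 2 * (norm (g x))\<^sup>2"
      using sum_squares_bound[of "norm (f x)" "norm (g x)"] by (simp add: power2_sum)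
    finally show ?thesis .
  qed
  then show "integrable lborel (\<lambda>x. (norm (f x + g x))\<^sup>2)"
    by (intro Bochner_Integration.integrable_bound[OF Bochner_Integration.integrable_add[OF
        integrable_mult_right[OF L2_integrable_sq[OF assms(1)], of 2] integrable_mult_right[OF L2_integrable_sq[OF assms(2)], of 2]]])
       auto
qed

lemma L2_diff: "f \<in> L2 \<Longrightarrow> g \<in> L2 \<Longrightarrow> (\<lambda>x. f x - g x) \<in> L2"
  using L2_add[of f "\<lambda>x. (-1) * g x"] L2_scale[of g "-1"] by simp

lemma L2_sum: "(\<And>i. i \<in> I \<Longrightarrow> f i \<in> L2) \<Longrightarrow> (\<lambda>x. \<Sum>i\<in>I. f i x) \<in> L2"
  by (induction I rule: infinite_finite_induct) (auto intro: L2_add)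

lemma L2_integrable_mult:
  assumes "f \<in> L2" "g \<in> L2" shows "integrable lborel (\<lambda>x. f x * g x)"
proof -
  note [measurable] = L2_measurable[OF assms(1)] L2_measurable[OF assms(2)]
  have "norm (f x * g x) \<le> (norm (f x))\<^sup>2 + (norm (g x))\<^sup>2" for x
    using sum_squares_bound[of "norm (f x)" "norm (g x)"] mult_nonneg_nonneg[OF norm_ge_zero norm_ge_zero, of "f x" "g x"]
    unfolding norm_mult by linarith
  then show ?thesis
    by (intro Bochner_Integration.integrable_bound[OF Bochner_Integration.integrable_add[OF
        L2_integrable_sq[OF assms(1)] L2_integrable_sq[OF assms(2)]]]) auto
qed

lemma borel_measurable_cnj [measurable (raw)]:
  "f \<in> borel_measurable M \<Longrightarrow> (\<lambda>x. cnj (f x)) \<in> borel_measurable M"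
  by (intro borel_measurable_continuous_on[where f = cnj] continuous_intros)

lemma L2_cnj: "f \<in> L2 \<Longrightarrow> (\<lambda>x. cnj (f x)) \<in> L2"
  by (rule L2_bound[where C = 1]) (auto dest!: L2_measurable intro: borel_measurable_cnj)

lemma L2_integrable_inner: "f \<in> L2 \<Longrightarrow> g \<in> L2 \<Longrightarrow> integrable lborel (\<lambda>x. f x * cnj (g x))"
  by (intro L2_integrable_mult L2_cnj)

lemma L2inner_add_left:
  "f \<in> L2 \<Longrightarrow> g \<in> L2 \<Longrightarrow> h \<in> L2 \<Longrightarrow> L2inner (\<lambda>x. f x + g x) h = L2inner f h + L2inner g h"
  unfolding L2inner_def
  by (subst Bochner_Integration.integral_add[symmetric]) (auto intro: L2_integrable_inner simp: algebra_simps)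

lemma L2inner_diff_left:
  "f \<in> L2 \<Longrightarrow> g \<in> L2 \<Longrightarrow> h \<in> L2 \<Longrightarrow> L2inner (\<lambda>x. f x - g x) h = L2inner f h - L2inner g h"
  unfolding L2inner_def
  by (subst Bochner_Integration.integral_diff[symmetric]) (auto intro: L2_integrable_inner simp: algebra_simps)

lemma L2inner_scale_left: "L2inner (\<lambda>x. c * f x) g = c * L2inner f g"
  unfolding L2inner_def by (simp add: mult.assoc)

lemma L2inner_commute: "L2inner f g = cnj (L2inner g f)"
  unfolding L2inner_def
  using Bochner_Integration.integral_cnj[of lborel "\<lambda>x. g x * cnj (f x)"] by (simp add: mult.commute)

lemma L2inner_scale_right: "L2inner f (\<lambda>x. c * g x) = cnj c * L2inner f g"
  by (subst (1 2) L2inner_commute) (simp add: L2inner_scale_left)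

lemma L2inner_add_right:
  "f \<in> L2 \<Longrightarrow> g \<in> L2 \<Longrightarrow> h \<in> L2 \<Longrightarrow> L2inner h (\<lambda>x. f x + g x) = L2inner h f + L2inner h g"
  by (subst (1 2 3) L2inner_commute) (simp add: L2inner_add_left)

lemma L2inner_diff_right:
  "f \<in> L2 \<Longrightarrow> g \<in> L2 \<Longrightarrow> h \<in> L2 \<Longrightarrow> L2inner h (\<lambda>x. f x - g x) = L2inner h f - L2inner h g"
  by (subst (1 2 3) L2inner_commute) (simp add: L2inner_diff_left)

lemma L2inner_zero_left [simp]: "L2inner (\<lambda>x. 0) g = 0"
  by (simp add: L2inner_def)

lemma L2inner_sum_left:
  "(\<And>i. i \<in> I \<Longrightarrow> f i \<in> L2) \<Longrightarrow> g \<in> L2 \<Longrightarrow> L2inner (\<lambda>x. \<Sum>i\<in>I. f i x) g = (\<Sum>i\<in>I. L2inner (f i) g)"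
  by (induction I rule: infinite_finite_induct) (auto simp: L2inner_add_left L2_sum)

lemma L2inner_sum_right:
  "(\<And>i. i \<in> I \<Longrightarrow> f i \<in> L2) \<Longrightarrow> g \<in> L2 \<Longrightarrow> L2inner g (\<lambda>x. \<Sum>i\<in>I. f i x) = (\<Sum>i\<in>I. L2inner g (f i))"
  by (subst (1 2) L2inner_commute) (simp add: L2inner_sum_left)

lemma L2inner_cong_AE:
  assumes "f \<in> L2" "f' \<in> L2" "g \<in> L2" "g' \<in> L2" "AE x in lborel. f x = f' x" "AE x in lborel. g x = g' x"
  shows "L2inner f g = L2inner f' g'"
proof -
  note [measurable] = assms(1-4)[THEN L2_measurable]
  show ?thesis unfolding L2inner_def
    by (rule integral_cong_AE) (use assms(5,6) in auto)
qed

lemma L2norm_nonneg [simp]: "0 \<le> L2norm f"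
  by (simp add: L2norm_def)

lemma L2norm_sq: "(L2norm f)\<^sup>2 = (\<integral>x. (norm (f x))\<^sup>2 \<partial>lborel)"
  by (simp add: L2norm_def)

lemma L2norm_cong_AE:
  assumes "f \<in> L2" "f' \<in> L2" "AE x in lborel. f x = f' x"
  shows "L2norm f = L2norm f'"
proof -
  note [measurable] = assms(1-2)[THEN L2_measurable]
  have "(\<integral>x. (norm (f x))\<^sup>2 \<partial>lborel) = (\<integral>x. (norm (f' x))\<^sup>2 \<partial>lborel)"
    by (rule integral_cong_AE) (use assms(3) in auto)
  then show ?thesis by (simp add: L2norm_def)
qed

lemma L2inner_self: "L2inner f f = complex_of_real ((L2norm f)\<^sup>2)"
  unfolding L2inner_def L2norm_sq complex_norm_square[symmetric] by (simp flip: of_real_power)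

lemma L2norm_eq_0_AE:
  assumes "f \<in> L2" shows "L2norm f = 0 \<longleftrightarrow> (AE x in lborel. f x = 0)"
  using integral_nonneg_eq_0_iff_AE[OF L2_integrable_sq[OF assms]] by (simp add: L2norm_def)

lemma L2norm_scale: "L2norm (\<lambda>x. c * f x) = norm c * L2norm f"
  by (simp add: L2norm_def norm_mult power_mult_distrib real_sqrt_mult)

lemma L2norm_minus_commute: "L2norm (\<lambda>x. f x - g x) = L2norm (\<lambda>x. g x - f x)"
  by (simp add: L2norm_def norm_minus_commute)

lemma L2_nn_norm: "f \<in> L2 \<Longrightarrow> (\<integral>\<^sup>+x. ennreal ((norm (f x))\<^sup>2) \<partial>lborel) = ennreal ((L2norm f)\<^sup>2)"
  unfolding L2norm_sq by (rule nn_integral_eq_integral) (auto dest: L2_integrable_sq)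

text \<open>The absolute values stay inside the integral, which is stronger than the bound on
  \<open>L2inner\<close>; the commutator estimate needs this form.\<close>

lemma L2_norm_CS:
  assumes "f \<in> L2" "g \<in> L2"
  shows "(\<integral>x. norm (f x) * norm (g x) \<partial>lborel) \<le> L2norm f * L2norm g"
proof -
  note [measurable] = assms[THEN L2_measurable]
  have int: "integrable lborel (\<lambda>x. norm (f x) * norm (g x))"
    using integrable_norm[OF L2_integrable_mult[OF assms]] by (simp add: norm_mult)
  have "(\<integral>\<^sup>+x. ennreal (norm (f x)) * ennreal (norm (g x)) \<partial>lborel)\<^sup>2
      \<le> (\<integral>\<^sup>+x. (ennreal (norm (f x)))\<^sup>2 \<partial>lborel) * (\<integral>\<^sup>+x. (ennreal (norm (g x)))\<^sup>2 \<partial>lborel)"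
    by (rule Cauchy_Schwarz_nn_integral) auto
  also have "\<dots> = ennreal ((L2norm f * L2norm g)\<^sup>2)"
    using assms by (simp add: ennreal_power L2_nn_norm power_mult_distrib ennreal_mult)
  also have "(\<integral>\<^sup>+x. ennreal (norm (f x)) * ennreal (norm (g x)) \<partial>lborel) = ennreal (\<integral>x. norm (f x) * norm (g x) \<partial>lborel)"
    by (subst nn_integral_eq_integral[OF int, symmetric]) (auto simp: ennreal_mult)
  finally have "(\<integral>x. norm (f x) * norm (g x) \<partial>lborel)\<^sup>2 \<le> (L2norm f * L2norm g)\<^sup>2"
    by (simp add: ennreal_power)
  then show ?thesis
    by (rule power2_le_imp_le) simp
qed

lemma L2inner_CS:
  assumes "f \<in> L2" "g \<in> L2" shows "norm (L2inner f g) \<le> L2norm f * L2norm g"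
proof -
  have "norm (L2inner f g) \<le> (\<integral>x. norm (f x * cnj (g x)) \<partial>lborel)"
    unfolding L2inner_def by (rule integral_norm_bound)
  also have "\<dots> \<le> L2norm f * L2norm g"
    using L2_norm_CS[OF assms] by (simp add: norm_mult)
  finally show ?thesis .
qed

lemma L2norm_add_sq:
  assumes "f \<in> L2" "g \<in> L2"
  shows "(L2norm (\<lambda>x. f x + g x))\<^sup>2 = (L2norm f)\<^sup>2 + 2 * Re (L2inner f g) + (L2norm g)\<^sup>2"
proof -
  have "complex_of_real ((L2norm (\<lambda>x. f x + g x))\<^sup>2) = L2inner f f + (L2inner f g + cnj (L2inner f g)) + L2inner g g"
    unfolding L2inner_self[symmetric]
    using assms L2inner_commute[of g f] by (simp add: L2inner_add_left L2inner_add_right L2_add)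
  then have "complex_of_real ((L2norm (\<lambda>x. f x + g x))\<^sup>2) = complex_of_real ((L2norm f)\<^sup>2 + 2 * Re (L2inner f g) + (L2norm g)\<^sup>2)"
    by (simp add: L2inner_self complex_add_cnj)
  then show ?thesis using of_real_eq_iff by blast
qed

lemma L2norm_triangle:
  assumes "f \<in> L2" "g \<in> L2" shows "L2norm (\<lambda>x. f x + g x) \<le> L2norm f + L2norm g"
proof (rule power2_le_imp_le)
  have "Re (L2inner f g) \<le> L2norm f * L2norm g"
    using L2inner_CS[OF assms] complex_Re_le_cmod order_trans by blast
  then show "(L2norm (\<lambda>x. f x + g x))\<^sup>2 \<le> (L2norm f + L2norm g)\<^sup>2"
    by (simp add: L2norm_add_sq[OF assms] power2_sum)
qed simp

lemma L2norm_triangle_diff: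
  assumes "f \<in> L2" "g \<in> L2" "h \<in> L2"
  shows "L2norm (\<lambda>x. f x - h x) \<le> L2norm (\<lambda>x. f x - g x) + L2norm (\<lambda>x. g x - h x)"
  using L2norm_triangle[OF L2_diff[OF assms(1,2)] L2_diff[OF assms(2,3)]] by simp

lemma L2norm_mono:
  assumes "f \<in> L2" "g \<in> L2" "AE x in lborel. norm (f x) \<le> norm (g x)"
  shows "L2norm f \<le> L2norm g"
  unfolding L2norm_def using assms
  by (intro real_sqrt_le_mono integral_mono_AE L2_integrable_sq) (auto intro: power_mono)

lemma L2norm_dominated_convergence:
  fixes f :: "nat \<Rightarrow> 'p::euclidean_space \<Rightarrow> complex"
  assumes [measurable]: "\<And>n. f n \<in> borel_measurable borel" and w: "integrable lborel w"
    and b: "\<And>n. AE x in lborel. (norm (f n x))\<^sup>2 \<le> w x" and l: "AE x in lborel. (\<lambda>n. f n x) \<longlonglongrightarrow> 0"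
  shows "(\<lambda>n. L2norm (f n)) \<longlonglongrightarrow> 0"
proof -
  have "(\<lambda>n. \<integral>x. (norm (f n x))\<^sup>2 \<partial>lborel) \<longlonglongrightarrow> (\<integral>x. 0 \<partial>(lborel::'p measure))"
  proof (rule integral_dominated_convergence[where w = w])
    show "AE x in lborel. (\<lambda>n. (norm (f n x))\<^sup>2) \<longlonglongrightarrow> 0"
      using l by (rule AE_mp) (auto intro!: AE_I2 tendsto_eq_intros tendsto_norm_zero)
  qed (use b w in auto)
  then show ?thesis
    unfolding L2norm_def using tendsto_real_sqrt[of _ 0] by fastforce
qed

section \<open>Spectral measures\<close>

lemma L2norm_orthogonal_sum:
  assumes "finite I" "\<And>i. i \<in> I \<Longrightarrow> f i \<in> L2"
    and "\<And>i j. i \<in> I \<Longrightarrow> j \<in> I \<Longrightarrow> i \<noteq> j \<Longrightarrow> L2inner (f i) (f j) = 0"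
  shows "(L2norm (\<lambda>x. \<Sum>i\<in>I. f i x))\<^sup>2 = (\<Sum>i\<in>I. (L2norm (f i))\<^sup>2)"
  using assms
proof (induction I rule: finite_induct)
  case (insert i I)
  have "L2inner (f i) (\<lambda>x. \<Sum>j\<in>I. f j x) = 0"
    using insert by (subst L2inner_sum_right) (auto intro!: sum.neutral)
  with insert show ?case
    by (simp add: L2norm_add_sq L2_sum)
qed (simp add: L2norm_def)

lemma L2inner_expand:
  assumes "f \<in> L2" "g \<in> L2" "h \<in> L2" "k \<in> L2"
  shows "L2inner (\<lambda>x. f x + c * g x) (\<lambda>x. h x + c * k x)
    = L2inner f h + cnj c * L2inner f k + c * L2inner g h + c * cnj c * L2inner g k"
proof -
  have "L2inner (\<lambda>x. f x + c * g x) (\<lambda>x. h x + c * k x)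
    = L2inner f (\<lambda>x. h x + c * k x) + c * L2inner g (\<lambda>x. h x + c * k x)"
    using assms by (subst L2inner_add_left) (auto intro: L2_add L2_scale simp: L2inner_scale_left)
  also have "\<dots> = L2inner f h + cnj c * L2inner f k + c * (L2inner g h + cnj c * L2inner g k)"
    using assms by (simp add: L2inner_add_right L2_scale L2inner_scale_right)
  finally show ?thesis by (simp add: algebra_simps)
qed

lemma bounded_op_L2: "bounded_op T \<Longrightarrow> f \<in> L2 \<Longrightarrow> T f \<in> L2"
  by (simp add: bounded_op_def)

lemma bounded_op_add:
  "bounded_op T \<Longrightarrow> f \<in> L2 \<Longrightarrow> g \<in> L2 \<Longrightarrow> AE x in lborel. T (\<lambda>y. f y + g y) x = T f x + T g x"
  by (simp add: bounded_op_def)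

lemma bounded_op_scale:
  "bounded_op T \<Longrightarrow> f \<in> L2 \<Longrightarrow> AE x in lborel. T (\<lambda>y. c * f y) x = c * T f x"
  by (simp add: bounded_op_def)

lemma bounded_op_cong:
  "bounded_op T \<Longrightarrow> f \<in> L2 \<Longrightarrow> g \<in> L2 \<Longrightarrow> AE x in lborel. f x = g x \<Longrightarrow> AE x in lborel. T f x = T g x"
  by (simp add: bounded_op_def)

text \<open>Linearity of \<open>T\<close> is available only almost everywhere and for one pair at a
  time, so the null sets are collected by induction. The empty sum comes from homogeneity with
  factor 0.\<close>

lemma bounded_op_sum:
  assumes T: "bounded_op T" and f: "\<And>i. i \<in> I \<Longrightarrow> f i \<in> L2" and "finite I"
  shows "AE x in lborel. T (\<lambda>y. \<Sum>i\<in>I. f i y) x = (\<Sum>i\<in>I. T (f i) x)"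
  using \<open>finite I\<close> f
proof (induction I rule: finite_induct)
  case empty
  then show ?case using bounded_op_scale[OF T L2_zero, of 0] by simp
next
  case (insert i I)
  have "AE x in lborel. T (\<lambda>y. f i y + (\<Sum>i\<in>I. f i y)) x = T (f i) x + T (\<lambda>y. \<Sum>i\<in>I. f i y) x"
    by (rule bounded_op_add[OF T]) (use insert in \<open>auto intro: L2_sum\<close>)
  moreover have "AE x in lborel. T (\<lambda>y. \<Sum>i\<in>I. f i y) x = (\<Sum>i\<in>I. T (f i) x)"
    using insert by auto
  ultimately have "AE x in lborel. T (\<lambda>y. f i y + (\<Sum>i\<in>I. f i y)) x = T (f i) x + (\<Sum>i\<in>I. T (f i) x)"
    by eventually_elim simp
  with insert.hyps show ?case by simp
qed

lemma bounded_op_diff: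
  assumes "bounded_op T" "f \<in> L2" "g \<in> L2"
  shows "AE x in lborel. T (\<lambda>y. f y - g y) x = T f x - T g x"
  using bounded_op_add[OF assms(1,2) L2_scale[OF assms(3), of "-1"]] bounded_op_scale[OF assms(1,3), of "-1"]
  by eventually_elim simp

locale spectral =
  fixes E :: "real set \<Rightarrow> ('p::euclidean_space \<Rightarrow> complex) \<Rightarrow> ('p \<Rightarrow> complex)"
  assumes spectral_measure: "spectral_measure E"
begin

lemma bounded_op_E: "A \<in> sets borel \<Longrightarrow> bounded_op (E A)"
  using spectral_measure by (simp add: spectral_measure_def)

lemma E_L2 [simp]: "A \<in> sets borel \<Longrightarrow> f \<in> L2 \<Longrightarrow> E A f \<in> L2"
  using bounded_op_E bounded_op_L2 by blast

lemma E_selfadjoint: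
  "A \<in> sets borel \<Longrightarrow> f \<in> L2 \<Longrightarrow> g \<in> L2 \<Longrightarrow> L2inner (E A f) g = L2inner f (E A g)"
  using spectral_measure by (simp add: spectral_measure_def)

lemma E_Int: "A \<in> sets borel \<Longrightarrow> B \<in> sets borel \<Longrightarrow> f \<in> L2 \<Longrightarrow> AE x in lborel. E (A \<inter> B) f x = E A (E B f) x"
  using spectral_measure by (simp add: spectral_measure_def)

lemma E_UNIV: "f \<in> L2 \<Longrightarrow> AE x in lborel. E UNIV f x = f x"
  using spectral_measure by (simp add: spectral_measure_def)

lemma E_UN:
  fixes A :: "nat \<Rightarrow> real set"
  assumes "\<And>n. A n \<in> sets borel" "disjoint_family A" "f \<in> L2"
  shows "(\<lambda>N. L2norm (\<lambda>x. E (\<Union>n. A n) f x - (\<Sum>n<N. E (A n) f x))) \<longlonglongrightarrow> 0"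
  using spectral_measure assms by (simp add: spectral_measure_def)

lemma E_inner:
  assumes "A \<in> sets borel" "B \<in> sets borel" "f \<in> L2" "g \<in> L2"
  shows "L2inner (E A f) (E B g) = L2inner f (E (A \<inter> B) g)"
proof -
  have "L2inner f (E A (E B g)) = L2inner f (E (A \<inter> B) g)"
    using E_Int[OF assms(1,2,4)] assms by (intro L2inner_cong_AE) (auto elim: AE_mp)
  then show ?thesis using assms by (simp add: E_selfadjoint)
qed

lemma E_norm_sq:
  assumes "A \<in> sets borel" "f \<in> L2"
  shows "L2inner (E A f) f = complex_of_real ((L2norm (E A f))\<^sup>2)"
  using E_inner[of A A f f] assms by (simp add: L2inner_self E_selfadjoint)

text \<open>Countable additivity applied to the constant family of empty sets says that (1 - N) E {}
  f tends to 0, which is possible only if E {} f vanishes.\<close>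

lemma E_empty: assumes f: "f \<in> L2" shows "L2norm (E {} f) = 0"
proof -
  have eq: "L2norm (\<lambda>x. E (\<Union>n::nat. {}) f x - (\<Sum>n<N. E {} f x)) = \<bar>1 - real N\<bar> * L2norm (E {} f)" for N
  proof -
    have "(\<lambda>x. E (\<Union>n::nat. {}) f x - (\<Sum>n<N. E {} f x)) = (\<lambda>x. complex_of_real (1 - real N) * E {} f x)"
      by (auto simp: algebra_simps)
    then show ?thesis by (simp only: L2norm_scale norm_of_real)
  qed
  have "(\<lambda>N. \<bar>1 - real N\<bar> * L2norm (E {} f)) \<longlonglongrightarrow> 0"
    using E_UN[of "\<lambda>_. {}" f] f unfolding eq by (simp add: disjoint_family_on_def)
  \<comment> \<open>Shifting the index by two makes the factor |1 - N| at least 1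
    throughout.\<close>
  then have "(\<lambda>N. \<bar>1 - real (Suc (Suc N))\<bar> * L2norm (E {} f)) \<longlonglongrightarrow> 0"
    by (intro LIMSEQ_Suc)
  then have "L2norm (E {} f) \<le> 0"
  proof (rule LIMSEQ_le_const)
    have "1 * L2norm (E {} f) \<le> \<bar>1 - real (Suc (Suc n))\<bar> * L2norm (E {} f)" for n
      by (rule mult_right_mono) auto
    then show "\<exists>N. \<forall>n\<ge>N. L2norm (E {} f) \<le> \<bar>1 - real (Suc (Suc n))\<bar> * L2norm (E {} f)"
      by auto
  qed
  then show ?thesis using L2norm_nonneg[of "E {} f"] by linarith
qed

lemma E_inner_disjoint:
  assumes "A \<in> sets borel" "B \<in> sets borel" "f \<in> L2" "g \<in> L2" "A \<inter> B = {}"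
  shows "L2inner (E A f) (E B g) = 0"
  using E_inner[OF assms(1-4)] L2inner_CS[of f "E {} g"] E_empty[of g] assms by simp

text \<open>Additivity of \<open>E\<close> holds in the L2 norm. Pairing with f turns it into scalar
  additivity, because the pairing of E A f with f is the squared norm of E A f.\<close>

lemma E_sums:
  fixes A :: "nat \<Rightarrow> real set"
  assumes A: "\<And>n. A n \<in> sets borel" "disjoint_family A" and f: "f \<in> L2"
  shows "(\<lambda>n. (L2norm (E (A n) f))\<^sup>2) sums (L2norm (E (\<Union>n. A n) f))\<^sup>2"
proof -
  have U: "(\<Union>n. A n) \<in> sets borel" using A by auto
  define h where "h = (\<lambda>N x. E (\<Union>n. A n) f x - (\<Sum>n<N. E (A n) f x))"
  have hL: "h N \<in> L2" for N unfolding h_def using A U f by (intro L2_diff L2_sum) auto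
  have h: "L2inner (h N) f = complex_of_real ((L2norm (E (\<Union>n. A n) f))\<^sup>2 - (\<Sum>n<N. (L2norm (E (A n) f))\<^sup>2))" for N
    unfolding h_def using A U f by (subst L2inner_diff_left) (auto intro: L2_sum simp: L2inner_sum_left E_norm_sq)
  have "(\<lambda>N. L2norm (h N) * L2norm f) \<longlonglongrightarrow> 0"
    using E_UN[OF A f] unfolding h_def by (intro tendsto_mult_left_zero) simp
  then have "(\<lambda>N. (L2norm (E (\<Union>n. A n) f))\<^sup>2 - (\<Sum>n<N. (L2norm (E (A n) f))\<^sup>2)) \<longlonglongrightarrow> 0"
  proof (rule Lim_null_comparison[rotated])
    show "\<forall>\<^sub>F N in sequentially. norm ((L2norm (E (\<Union>n. A n) f))\<^sup>2 - (\<Sum>n<N. (L2norm (E (A n) f))\<^sup>2)) \<le> L2norm (h N) * L2norm f"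
      using L2inner_CS[OF hL f] unfolding h norm_of_real by simp
  qed
  from tendsto_diff[OF tendsto_const[of "(L2norm (E (\<Union>n. A n) f))\<^sup>2"] this]
  show ?thesis unfolding sums_def by simp
qed

lemma sets_spec_mu [simp]: "sets (spec_mu E f) = sets borel"
  unfolding spec_mu_def by (simp add: sets.space_closed[of borel, simplified] sets.sigma_sets_eq[of borel, simplified])

lemma space_spec_mu [simp]: "space (spec_mu E f) = UNIV"
  unfolding spec_mu_def by (simp add: space_measure_of_conv)

text \<open>\<open>spec_mu\<close> is built by \<open>measure_of\<close>, which gives the zero
  measure unless the set function is really a measure; positivity and countable additivity are
  discharged here.\<close>

lemma emeasure_spec_mu:
  assumes f: "f \<in> L2" and A: "A \<in> sets borel"
  shows "emeasure (spec_mu E f) A = ennreal ((L2norm (E A f))\<^sup>2)"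
proof (rule emeasure_measure_of[OF spec_mu_def])
  show "positive (sets (spec_mu E f)) (\<lambda>A. ennreal ((L2norm (E A f))\<^sup>2))"
    using E_empty[OF f] by (simp add: positive_def)
  show "countably_additive (sets (spec_mu E f)) (\<lambda>A. ennreal ((L2norm (E A f))\<^sup>2))"
  proof (rule countably_additiveI)
    fix A :: "nat \<Rightarrow> real set"
    assume "range A \<subseteq> sets (spec_mu E f)" "disjoint_family A"
    then have "(\<lambda>n. (L2norm (E (A n) f))\<^sup>2) sums (L2norm (E (\<Union>n. A n) f))\<^sup>2"
      by (intro E_sums f) auto
    then show "(\<Sum>n. ennreal ((L2norm (E (A n) f))\<^sup>2)) = ennreal ((L2norm (E (\<Union>n. A n) f))\<^sup>2)"
      by (simp add: suminf_ennreal2 sums_iff)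
  qed
qed (use A in \<open>auto simp: sets.space_closed\<close>)

lemma measure_spec_mu:
  "f \<in> L2 \<Longrightarrow> A \<in> sets borel \<Longrightarrow> measure (spec_mu E f) A = (L2norm (E A f))\<^sup>2"
  by (simp add: measure_def emeasure_spec_mu)

lemma finite_spec_mu: "f \<in> L2 \<Longrightarrow> finite_measure (spec_mu E f)"
  by (intro finite_measureI) (simp add: emeasure_spec_mu)

lemma measurable_spec_mu [simp]: "borel_measurable (spec_mu E f) = borel_measurable borel"
  by (rule measurable_cong_sets) auto

lemma integrable_indicator_spec_mu:
  "f \<in> L2 \<Longrightarrow> A \<in> sets borel \<Longrightarrow> integrable (spec_mu E f) (\<lambda>t. c * indicator A t :: real)"
  by (intro integrable_mult_right integrable_real_indicator) (auto simp: emeasure_spec_mu)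

section \<open>Discretised spectral integral\<close>

definition cell :: "nat \<Rightarrow> int \<Rightarrow> real set" where
  "cell n k = {of_int k / real n ..< (of_int k + 1) / real n}"

text \<open>With mesh 1/n, the indices from -n^2 to n^2 - 1 make the cells tile [-n, n).\<close>

definition cells :: "nat \<Rightarrow> int set" where "cells n = {- (int n)\<^sup>2 ..< (int n)\<^sup>2}"

definition node :: "nat \<Rightarrow> int \<Rightarrow> real" where "node n k = of_int k / real n"

definition step :: "nat \<Rightarrow> real \<Rightarrow> real" where
  "step n t = (\<Sum>k\<in>cells n. node n k * indicator (cell n k) t)"

text \<open>A bounded substitute for the unbounded operator with spectral measure E: the function
  \<open>step n\<close> applied to it.\<close>

definition step_op :: "nat \<Rightarrow> ('p \<Rightarrow> complex) \<Rightarrow> 'p \<Rightarrow> complex" where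
  "step_op n f x = (\<Sum>k\<in>cells n. complex_of_real (node n k) * E (cell n k) f x)"

lemma finite_cells [simp]: "finite (cells n)" by (simp add: cells_def)

lemma cell_borel [simp]: "cell n k \<in> sets borel" by (simp add: cell_def)

lemma in_cell_iff: "n > 0 \<Longrightarrow> t \<in> cell n k \<longleftrightarrow> k = \<lfloor>real n * t\<rfloor>"
  by (auto simp: cell_def field_simps floor_eq_iff eq_commute[of k])

lemma cell_disjoint: "n > 0 \<Longrightarrow> k \<noteq> l \<Longrightarrow> cell n k \<inter> cell n l = {}"
  using in_cell_iff by auto

lemma step_eq:
  assumes "n > 0"
  shows "step n t = (if \<lfloor>real n * t\<rfloor> \<in> cells n then of_int \<lfloor>real n * t\<rfloor> / real n else 0)"
proof -
  have "step n t = (\<Sum>k\<in>cells n. if k = \<lfloor>real n * t\<rfloor> then of_int k / real n else 0)"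
    unfolding step_def by (rule sum.cong) (auto simp: in_cell_iff[OF assms] indicator_def node_def)
  then show ?thesis by (simp add: sum.delta)
qed

lemma floor_div_bounds:
  assumes "n > 0"
  shows "of_int \<lfloor>real n * t\<rfloor> / real n \<le> t" "t - 1 / real n < of_int \<lfloor>real n * t\<rfloor> / real n"
proof -
  show "of_int \<lfloor>real n * t\<rfloor> / real n \<le> t"
    using assms of_int_floor_le[of "real n * t"] by (simp add: divide_le_eq mult.commute)
  have "real n * t - 1 < of_int \<lfloor>real n * t\<rfloor>" by linarith
  then show "t - 1 / real n < of_int \<lfloor>real n * t\<rfloor> / real n"
    using assms by (simp add: less_divide_eq algebra_simps)
qed

lemma floor_in_cells: "n > 0 \<Longrightarrow> \<bar>t\<bar> < real n \<Longrightarrow> \<lfloor>real n * t\<rfloor> \<in> cells n"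
proof -
  assume n: "n > 0" and t: "\<bar>t\<bar> < real n"
  have "real n * \<bar>t\<bar> < real n * real n" using n t by (intro mult_strict_left_mono) auto
  then have "\<bar>real n * t\<bar> < real n * real n" by (simp add: abs_mult)
  then have "- (real n * real n) < real n * t" "real n * t < real n * real n"
    by linarith+
  then show ?thesis
    unfolding cells_def power2_eq_square by (auto simp: floor_less_iff le_floor_iff)
qed

text \<open>Rounding down to the grid costs at most 1/n, hence at most 1. The bound does not depend
  on n and so serves as dominating function.\<close>

lemma step_bound: assumes "n > 0" shows "\<bar>step n t\<bar> \<le> \<bar>t\<bar> + 1"
proof -
  have "1 / real n \<le> 1" using assms by simp
  then show ?thesis using floor_div_bounds[OF assms, of t] by (auto simp: step_eq[OF assms])
qed

lemma step_close: "n > 0 \<Longrightarrow> \<bar>t\<bar> < real n \<Longrightarrow> \<bar>step n t - t\<bar> \<le> 1 / real n"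
  using floor_div_bounds[of n t] floor_in_cells[of n t] by (auto simp: step_eq)

lemma step_tendsto: "(\<lambda>n. step (Suc n) t) \<longlonglongrightarrow> t"
proof -
  have "(\<lambda>n. step (Suc n) t - t) \<longlonglongrightarrow> 0"
  proof (rule Lim_null_comparison[OF _ LIMSEQ_inverse_real_of_nat])
    obtain N where N: "\<bar>t\<bar> < real N" using reals_Archimedean2 by blast
    show "\<forall>\<^sub>F n in sequentially. norm (step (Suc n) t - t) \<le> inverse (real (Suc n))"
      using eventually_ge_at_top[of N]
    proof eventually_elim
      case (elim n)
      then show ?case using step_close[of "Suc n" t] N by (simp add: inverse_eq_divide)
    qed
  qed
  then show ?thesis by (simp add: LIM_zero_iff)
qed

lemma step_measurable [measurable]: "step n \<in> borel_measurable borel"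
  unfolding step_def[abs_def] by (intro borel_measurable_sum borel_measurable_times borel_measurable_indicator) auto

lemma step_op_L2 [simp]: "f \<in> L2 \<Longrightarrow> step_op n f \<in> L2"
  unfolding step_op_def[abs_def] by (intro L2_sum L2_scale E_L2) auto

lemma step_op_adjoint: "f \<in> L2 \<Longrightarrow> g \<in> L2 \<Longrightarrow> L2inner (step_op n f) g = L2inner f (step_op n g)"
  unfolding step_op_def[abs_def]
  by (simp add: L2inner_sum_left L2inner_sum_right L2_scale L2inner_scale_left L2inner_scale_right E_selfadjoint)

lemma step_op_inner_self:
  assumes f: "f \<in> L2"
  shows "L2inner (step_op n f) f = complex_of_real (\<integral>t. step n t \<partial>spec_mu E f)"
proof -
  interpret finite_measure "spec_mu E f" by (rule finite_spec_mu[OF f])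
  have "(\<integral>t. step n t \<partial>spec_mu E f) = (\<Sum>k\<in>cells n. node n k * (L2norm (E (cell n k) f))\<^sup>2)"
    unfolding step_def using f by (subst Bochner_Integration.integral_sum[OF integrable_indicator_spec_mu]) (auto simp: measure_spec_mu)
  then show ?thesis
    unfolding step_op_def[abs_def] using f
    by (subst L2inner_sum_left) (auto intro!: L2_scale sum.cong simp: L2inner_scale_left E_norm_sq)
qed

lemma step_sq:
  assumes "n > 0"
  shows "(step n t)\<^sup>2 = (\<Sum>k\<in>cells n. (node n k)\<^sup>2 * indicator (cell n k) t)"
proof -
  have "(\<Sum>k\<in>cells n. (node n k)\<^sup>2 * indicator (cell n k) t)
      = (\<Sum>k\<in>cells n. if k = \<lfloor>real n * t\<rfloor> then (node n k)\<^sup>2 else 0)"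
    by (rule sum.cong) (auto simp: in_cell_iff[OF assms] indicator_def)
  then show ?thesis by (simp add: step_eq[OF assms] node_def)
qed

text \<open>Disjoint cells have orthogonal spectral ranges, so this is Pythagoras' theorem followed
  by the simple-function integral of the squared step function.\<close>

lemma step_op_norm_sq:
  assumes f: "f \<in> L2" and n: "n > 0"
  shows "(L2norm (step_op n f))\<^sup>2 = (\<integral>t. (step n t)\<^sup>2 \<partial>spec_mu E f)"
proof -
  interpret finite_measure "spec_mu E f" by (rule finite_spec_mu[OF f])
  have "(\<integral>t. (step n t)\<^sup>2 \<partial>spec_mu E f) = (\<Sum>k\<in>cells n. (node n k)\<^sup>2 * (L2norm (E (cell n k) f))\<^sup>2)"
    unfolding step_sq[OF n] using f by (subst Bochner_Integration.integral_sum[OF integrable_indicator_spec_mu]) (auto simp: measure_spec_mu)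
  moreover have "(L2norm (step_op n f))\<^sup>2 = (\<Sum>k\<in>cells n. (L2norm (\<lambda>x. complex_of_real (node n k) * E (cell n k) f x))\<^sup>2)"
    unfolding step_op_def[abs_def] using f n
    by (intro L2norm_orthogonal_sum L2_scale)
       (auto simp: L2inner_scale_left L2inner_scale_right E_inner_disjoint cell_disjoint)
  ultimately show ?thesis
    by (simp only: L2norm_scale power_mult_distrib norm_of_real power2_abs)
qed

lemma step_op_add_scale:
  assumes "f \<in> L2" "g \<in> L2"
  shows "AE x in lborel. step_op n (\<lambda>y. f y + c * g y) x = step_op n f x + c * step_op n g x"
proof -
  have "AE x in lborel. \<forall>k\<in>cells n. E (cell n k) (\<lambda>y. f y + c * g y) x = E (cell n k) f x + c * E (cell n k) g x"
  proof (rule AE_finite_allI[OF finite_cells])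
    fix k
    show "AE x in lborel. E (cell n k) (\<lambda>y. f y + c * g y) x = E (cell n k) f x + c * E (cell n k) g x"
      using bounded_op_add[OF bounded_op_E[OF cell_borel] assms(1) L2_scale[OF assms(2)], of n k c]
        bounded_op_scale[OF bounded_op_E[OF cell_borel] assms(2), of n k c]
      by eventually_elim simp
  qed
  then show ?thesis
    by eventually_elim (simp add: step_op_def sum_distrib_left sum.distrib algebra_simps)
qed

lemma step_integral_tendsto:
  assumes f: "f \<in> L2" and i: "integrable (spec_mu E f) (\<lambda>t. t\<^sup>2)"
  shows "(\<lambda>n. \<integral>t. step (Suc n) t \<partial>spec_mu E f) \<longlonglongrightarrow> (\<integral>t. t \<partial>spec_mu E f)"
proof -
  interpret finite_measure "spec_mu E f" by (rule finite_spec_mu[OF f])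
  have i1: "integrable (spec_mu E f) (\<lambda>t. \<bar>t\<bar> + 1)"
  proof (rule Bochner_Integration.integrable_bound)
    show "integrable (spec_mu E f) (\<lambda>t. t\<^sup>2 + 2)" using i by simp
    have "\<bar>t\<bar> + 1 \<le> t\<^sup>2 + 2" for t :: real
      using sum_squares_bound[of "\<bar>t\<bar>" 1] by (simp add: power2_eq_square)
    then show "AE t in spec_mu E f. norm (\<bar>t\<bar> + 1) \<le> norm (t\<^sup>2 + 2)"
      by (auto intro!: AE_I2)
  qed simp
  show ?thesis
    by (rule integral_dominated_convergence[OF _ _ i1]) (auto intro!: AE_I2 step_tendsto step_bound)
qed

text \<open>Second moments control (|t| + 1)^2 uniformly in n. The bound is what allows weak
  convergence to pass from test functions to arbitrary elements of \<open>L2\<close>.\<close>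

lemma step_op_norm_bounded:
  assumes f: "f \<in> L2" and i: "integrable (spec_mu E f) (\<lambda>t. t\<^sup>2)"
  shows "\<exists>B. \<forall>n. L2norm (step_op (Suc n) f) \<le> B"
proof -
  interpret finite_measure "spec_mu E f" by (rule finite_spec_mu[OF f])
  have i1: "integrable (spec_mu E f) (\<lambda>t. 2 * t\<^sup>2 + 2)" using i by simp
  have b: "(step (Suc n) t)\<^sup>2 \<le> 2 * t\<^sup>2 + 2" for n t
  proof -
    have "(step (Suc n) t)\<^sup>2 \<le> (\<bar>t\<bar> + 1)\<^sup>2"
      using power_mono[OF step_bound[of "Suc n" t], of 2] by simp
    also have "\<dots> \<le> 2 * t\<^sup>2 + 2"
      using sum_squares_bound[of "\<bar>t\<bar>" 1] by (simp add: power2_sum)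
    finally show ?thesis .
  qed
  have "(L2norm (step_op (Suc n) f))\<^sup>2 \<le> (\<integral>t. 2 * t\<^sup>2 + 2 \<partial>spec_mu E f)" for n
    unfolding step_op_norm_sq[OF f zero_less_Suc]
    by (rule integral_mono[OF Bochner_Integration.integrable_bound[OF i1] i1]) (auto intro!: AE_I2 b order_trans[OF b])
  then have "L2norm (step_op (Suc n) f) \<le> sqrt (\<integral>t. 2 * t\<^sup>2 + 2 \<partial>spec_mu E f)" for n
    by (rule real_le_rsqrt)
  then show ?thesis by blast
qed

text \<open>The measure of a vector in the range of E {a..<b} lives on that window, where the step
  function differs from a by at most b - a plus the mesh. The squared norm is the integral of (step
  n t - a)^2.\<close>

lemma step_op_approx_on_interval:
  assumes u: "u \<in> L2" and Eu: "AE x in lborel. E {a..<b} u x = u x" and n: "n > 0" "\<bar>a\<bar> < real n" "\<bar>b\<bar> < real n" and "a < b"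
  shows "L2norm (\<lambda>x. step_op n u x - complex_of_real a * u x) \<le> (b - a + 1 / real n) * L2norm u"
proof -
  interpret finite_measure "spec_mu E u" by (rule finite_spec_mu[OF u])
  have mU: "measure (spec_mu E u) UNIV = (L2norm u)\<^sup>2"
    using u by (simp add: measure_spec_mu L2norm_cong_AE[OF E_L2[OF _ u] u E_UNIV[OF u]])
  \<comment> \<open>Replacing u by E {a..<b} u and merging the projections leaves E {} u, so the
    complement of the window is a null set of the spectral measure of u.\<close>
  have "L2norm (E (- {a..<b}) u) = L2norm (E (- {a..<b}) (E {a..<b} u))"
    using bounded_op_cong[OF bounded_op_E[of "- {a..<b}"] E_L2[OF _ u] u Eu] u
    by (intro L2norm_cong_AE) (auto elim: AE_mp)
  also have "\<dots> = L2norm (E {} u)"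
    using E_Int[of "- {a..<b}" "{a..<b}" u] u by (intro L2norm_cong_AE) (auto elim: AE_mp simp: Int_commute)
  finally have "emeasure (spec_mu E u) (- {a..<b}) = 0"
    using u by (simp add: emeasure_spec_mu E_empty)
  then have AE: "AE t in spec_mu E u. t \<in> {a..<b}"
    by (intro AE_I[where N = "- {a..<b}"]) auto
  have i1: "integrable (spec_mu E u) (step n)" unfolding step_def[abs_def]
    by (intro Bochner_Integration.integrable_sum integrable_indicator_spec_mu u cell_borel)
  have i2: "integrable (spec_mu E u) (\<lambda>t. (step n t)\<^sup>2)" unfolding step_sq[OF n(1)]
    by (intro Bochner_Integration.integrable_sum integrable_indicator_spec_mu u cell_borel)
  have "(L2norm (\<lambda>x. step_op n u x - complex_of_real a * u x))\<^sup>2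
      = (L2norm (step_op n u))\<^sup>2 - 2 * a * Re (L2inner (step_op n u) u) + a\<^sup>2 * (L2norm u)\<^sup>2"
    using L2norm_add_sq[OF step_op_L2[OF u] L2_scale[OF u], of n "complex_of_real (- a)"]
    unfolding L2norm_scale L2inner_scale_right by (simp add: power_mult_distrib)
  also have "\<dots> = (\<integral>t. (step n t)\<^sup>2 - 2 * a * step n t + a\<^sup>2 \<partial>spec_mu E u)"
    using i1 i2 by (simp add: step_op_norm_sq[OF u n(1)] step_op_inner_self[OF u] mU)
  also have "\<dots> = (\<integral>t. (step n t - a)\<^sup>2 \<partial>spec_mu E u)"
    by (rule Bochner_Integration.integral_cong) (auto simp: power2_diff)
  also have "\<dots> \<le> (\<integral>t. (b - a + 1 / real n)\<^sup>2 \<partial>spec_mu E u)"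
  proof (rule integral_mono_AE)
    show "integrable (spec_mu E u) (\<lambda>t. (step n t - a)\<^sup>2)"
      using i1 i2 by (simp add: power2_diff)
    show "AE t in spec_mu E u. (step n t - a)\<^sup>2 \<le> (b - a + 1 / real n)\<^sup>2"
      using AE
    proof eventually_elim
      case (elim t)
      then have "\<bar>t\<bar> < real n" using n by auto
      then have "\<bar>step n t - t\<bar> \<le> 1 / real n" using step_close n by blast
      then have "\<bar>step n t - a\<bar> \<le> b - a + 1 / real n" using elim by auto
      then show ?case using abs_le_square_iff by (metis abs_ge_self abs_of_nonneg order_trans abs_ge_zero)
    qed
  qed simp
  also have "\<dots> = ((b - a + 1 / real n) * L2norm u)\<^sup>2"
    by (simp add: mU power_mult_distrib)
  finally show ?thesis
    by (rule power2_le_imp_le) (use \<open>a < b\<close> in auto)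
qed

text \<open>The uniform norm bound absorbs the error made by replacing u with a nearby element of
  the dense set D.\<close>

lemma tendsto_inner_dense:
  assumes g: "\<And>n. g n \<in> L2" and B: "\<And>n. L2norm (g n) \<le> B"
    and dense: "\<And>u e. u \<in> L2 \<Longrightarrow> e > 0 \<Longrightarrow> \<exists>\<psi>\<in>D. L2norm (\<lambda>x. \<psi> x - u x) < e"
    and D: "D \<subseteq> L2" and lim: "\<And>\<psi>. \<psi> \<in> D \<Longrightarrow> (\<lambda>n. L2inner (g n) \<psi>) \<longlonglongrightarrow> 0"
    and u: "u \<in> L2"
  shows "(\<lambda>n. L2inner (g n) u) \<longlonglongrightarrow> 0"
proof (rule LIMSEQ_I)
  fix r :: real assume r: "r > 0"
  have B0: "B \<ge> 0" using order_trans[OF L2norm_nonneg B] .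
  obtain \<psi> where \<psi>: "\<psi> \<in> D" "L2norm (\<lambda>x. \<psi> x - u x) < r / (2 * (B + 1))"
    using dense[OF u, of "r / (2 * (B + 1))"] r B0 by auto
  then have \<psi>L: "\<psi> \<in> L2" using D by blast
  obtain N where N: "\<And>n. n \<ge> N \<Longrightarrow> norm (L2inner (g n) \<psi>) < r / 2"
    using LIMSEQ_D[OF lim[OF \<psi>(1)], of "r / 2"] r by auto
  have "norm (L2inner (g n) u) < r" if "n \<ge> N" for n
  proof -
    have "L2inner (g n) u = L2inner (g n) \<psi> - L2inner (g n) (\<lambda>x. \<psi> x - u x)"
      using g \<psi>L u by (simp add: L2inner_diff_right)
    then have "norm (L2inner (g n) u) \<le> norm (L2inner (g n) \<psi>) + norm (L2inner (g n) (\<lambda>x. \<psi> x - u x))"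
      by (metis norm_triangle_ineq4)
    also have "norm (L2inner (g n) (\<lambda>x. \<psi> x - u x)) \<le> L2norm (g n) * L2norm (\<lambda>x. \<psi> x - u x)"
      by (intro L2inner_CS g L2_diff \<psi>L u)
    also have "\<dots> \<le> B * (r / (2 * (B + 1)))"
      using \<psi>(2) B[of n] B0 by (intro mult_mono) auto
    also have "\<dots> \<le> r / 2" using r B0 by (simp add: field_simps)
    finally show ?thesis using N[OF that] by simp
  qed
  then show "\<exists>no. \<forall>n\<ge>no. norm (L2inner (g n) u - 0) < r" by auto
qed

end

text \<open>Polarisation turns the information on the diagonal quadratic form into information on the
  sesquilinear form; on the range of \<open>E {a..<b}\<close> the operator is within \<open>b - a\<close> of \<open>a\<close>.\<close>
lemma (in spectral) form_on_interval:
  fixes D :: "('p \<Rightarrow> complex) set" and G :: "('p \<Rightarrow> complex) \<Rightarrow> 'p \<Rightarrow> complex"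
  assumes D: "D \<subseteq> L2" and G: "\<And>\<phi>. \<phi> \<in> D \<Longrightarrow> G \<phi> \<in> L2"
    and D_lin: "\<And>\<phi> \<psi> c. \<phi> \<in> D \<Longrightarrow> \<psi> \<in> D \<Longrightarrow> (\<lambda>x. \<phi> x + c * \<psi> x) \<in> D"
    and G_lin: "\<And>\<phi> \<psi> c. \<phi> \<in> D \<Longrightarrow> \<psi> \<in> D \<Longrightarrow> G (\<lambda>x. \<phi> x + c * \<psi> x) = (\<lambda>x. G \<phi> x + c * G \<psi> x)"
    and dense: "\<And>u e. u \<in> L2 \<Longrightarrow> e > 0 \<Longrightarrow> \<exists>\<psi>\<in>D. L2norm (\<lambda>x. \<psi> x - u x) < e"
    and int: "\<And>\<phi>. \<phi> \<in> D \<Longrightarrow> integrable (spec_mu E \<phi>) (\<lambda>t. t\<^sup>2)"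
    and form: "\<And>\<phi>. \<phi> \<in> D \<Longrightarrow> complex_of_real (\<integral>t. t \<partial>spec_mu E \<phi>) = L2inner (G \<phi>) \<phi>"
    and u: "u \<in> L2" and Eu: "AE x in lborel. E {a..<b} u x = u x" and ab: "a < b" and \<phi>: "\<phi> \<in> D"
  shows "norm (L2inner (G \<phi>) u - complex_of_real a * L2inner \<phi> u) \<le> (b - a) * L2norm u * L2norm \<phi>"
proof -
  \<comment> \<open>The sesquilinear defect between the discretised operator and G. The hypothesis
    on the quadratic form speaks only about its diagonal.\<close>
  define \<beta> where "\<beta> = (\<lambda>n \<phi> \<psi>. L2inner (\<lambda>x. step_op (Suc n) \<phi> x - G \<phi> x) \<psi>)"
  have L: "\<phi> \<in> L2" "(\<lambda>x. step_op (Suc n) \<phi> x - G \<phi> x) \<in> L2" if "\<phi> \<in> D" for \<phi> n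
    using that D G by (auto intro!: L2_diff step_op_L2)
  have diag: "(\<lambda>n. \<beta> n \<phi> \<phi>) \<longlonglongrightarrow> 0" if "\<phi> \<in> D" for \<phi>
  proof -
    have "\<beta> n \<phi> \<phi> = complex_of_real (\<integral>t. step (Suc n) t \<partial>spec_mu E \<phi>) - complex_of_real (\<integral>t. t \<partial>spec_mu E \<phi>)" for n
      unfolding \<beta>_def form[OF that] using L[OF that] G[OF that] by (simp add: L2inner_diff_left step_op_inner_self)
    then show ?thesis
      using LIM_zero[OF tendsto_of_real[OF step_integral_tendsto[OF L(1)[OF that] int[OF that]]]] by simp
  qed
  have expand: "\<beta> n (\<lambda>x. \<phi> x + c * \<psi> x) (\<lambda>x. \<phi> x + c * \<psi> x)
     = \<beta> n \<phi> \<phi> + cnj c * \<beta> n \<phi> \<psi> + c * \<beta> n \<psi> \<phi> + c * cnj c * \<beta> n \<psi> \<psi>"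
    if "\<phi> \<in> D" "\<psi> \<in> D" for n \<phi> \<psi> c
  proof -
    have "\<beta> n (\<lambda>x. \<phi> x + c * \<psi> x) (\<lambda>x. \<phi> x + c * \<psi> x)
       = L2inner (\<lambda>x. (step_op (Suc n) \<phi> x - G \<phi> x) + c * (step_op (Suc n) \<psi> x - G \<psi> x)) (\<lambda>x. \<phi> x + c * \<psi> x)"
      unfolding \<beta>_def
    proof (rule L2inner_cong_AE)
      show "AE x in lborel. step_op (Suc n) (\<lambda>x. \<phi> x + c * \<psi> x) x - G (\<lambda>x. \<phi> x + c * \<psi> x) x
          = (step_op (Suc n) \<phi> x - G \<phi> x) + c * (step_op (Suc n) \<psi> x - G \<psi> x)"
        using step_op_add_scale[OF L(1)[OF that(1)] L(1)[OF that(2)], of "Suc n" c]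
        by eventually_elim (simp add: G_lin that algebra_simps)
    qed (rule L(2)[OF D_lin[OF that]] L2_add[OF L(2)[OF that(1)] L2_scale[OF L(2)[OF that(2)]]] L(1)[OF D_lin[OF that]] AE_I2 refl)+
    also have "\<dots> = \<beta> n \<phi> \<phi> + cnj c * \<beta> n \<phi> \<psi> + c * \<beta> n \<psi> \<phi> + c * cnj c * \<beta> n \<psi> \<psi>"
      unfolding \<beta>_def by (rule L2inner_expand[OF L(2)[OF that(1)] L(2)[OF that(2)] L(1)[OF that(1)] L(1)[OF that(2)]])
    finally show ?thesis .
  qed
  have offdiag: "(\<lambda>n. \<beta> n \<phi> \<psi>) \<longlonglongrightarrow> 0" if "\<phi> \<in> D" "\<psi> \<in> D" for \<phi> \<psi>
  proof -
    define p where "p c = (\<lambda>n. \<beta> n (\<lambda>x. \<phi> x + c * \<psi> x) (\<lambda>x. \<phi> x + c * \<psi> x))" for c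
    have p: "p c \<longlonglongrightarrow> 0" for c unfolding p_def by (rule diag[OF D_lin[OF that]])
    \<comment> \<open>The values c = 1 and c = \<i> suffice: adding the first to \<i> times the
      second cancels the transposed term and doubles the wanted one.\<close>
    have "2 * \<beta> n \<phi> \<psi> = p 1 n + \<i> * p \<i> n - (1 + \<i>) * (\<beta> n \<phi> \<phi> + \<beta> n \<psi> \<psi>)" for n
      unfolding p_def expand[OF that] by (simp add: algebra_simps)
    then have "\<beta> n \<phi> \<psi> = (p 1 n + \<i> * p \<i> n - (1 + \<i>) * (\<beta> n \<phi> \<phi> + \<beta> n \<psi> \<psi>)) / 2" for n
      by (metis nonzero_mult_div_cancel_left zero_neq_numeral)
    moreover have "(\<lambda>n. (p 1 n + \<i> * p \<i> n - (1 + \<i>) * (\<beta> n \<phi> \<phi> + \<beta> n \<psi> \<psi>)) / 2) \<longlonglongrightarrow> (0 + \<i> * 0 - (1 + \<i>) * (0 + 0)) / 2"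
      by (intro tendsto_intros p diag that) simp
    ultimately have "(\<lambda>n. \<beta> n \<phi> \<psi>) \<longlonglongrightarrow> (0 + \<i> * 0 - (1 + \<i>) * (0 + 0)) / 2"
      by (simp only:)
    then show ?thesis by simp
  qed
  obtain B where B: "\<And>n. L2norm (step_op (Suc n) \<phi>) \<le> B"
    using step_op_norm_bounded[OF L(1)[OF \<phi>] int[OF \<phi>]] by blast
  \<comment> \<open>The vector u need not lie in D; density together with the bound on the norms of
    \<open>step_op\<close> extends the convergence to it.\<close>
  have "(\<lambda>n. \<beta> n \<phi> u) \<longlonglongrightarrow> 0"
    unfolding \<beta>_def
  proof (rule tendsto_inner_dense[OF L(2)[OF \<phi>] _ dense D _ u, where B = "B + L2norm (G \<phi>)"])
    fix n
    have "L2norm (\<lambda>x. step_op (Suc n) \<phi> x + (-1) * G \<phi> x) \<le> L2norm (step_op (Suc n) \<phi>) + L2norm (\<lambda>x. (-1) * G \<phi> x)"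
      by (rule L2norm_triangle[OF step_op_L2[OF L(1)[OF \<phi>]] L2_scale[OF G[OF \<phi>]]])
    then show "L2norm (\<lambda>x. step_op (Suc n) \<phi> x - G \<phi> x) \<le> B + L2norm (G \<phi>)"
      unfolding L2norm_scale using B[of n] by simp
  next
    fix \<psi> assume "\<psi> \<in> D"
    then show "(\<lambda>n. L2inner (\<lambda>x. step_op (Suc n) \<phi> x - G \<phi> x) \<psi>) \<longlonglongrightarrow> 0"
      using offdiag[OF \<phi>, of \<psi>] by (simp only: \<beta>_def)
  qed
  \<comment> \<open>Symmetry moves the discretised operator onto u, where it is close to
    multiplication by a.\<close>
  moreover have "L2inner \<phi> (step_op (Suc n) u) = \<beta> n \<phi> u + L2inner (G \<phi>) u" for n
    unfolding \<beta>_def using L[OF \<phi>] u G[OF \<phi>] by (simp add: L2inner_diff_left step_op_adjoint)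
  ultimately have lim: "(\<lambda>n. L2inner \<phi> (step_op (Suc n) u) - complex_of_real a * L2inner \<phi> u)
      \<longlonglongrightarrow> (0 + L2inner (G \<phi>) u) - complex_of_real a * L2inner \<phi> u"
    using tendsto_diff[OF tendsto_add[OF _ tendsto_const] tendsto_const] by (simp only:)
  obtain N where N: "max \<bar>a\<bar> \<bar>b\<bar> < real N" using reals_Archimedean2 by blast
  have bd: "norm (L2inner \<phi> (step_op (Suc n) u) - complex_of_real a * L2inner \<phi> u)
       \<le> L2norm \<phi> * ((b - a + inverse (real (Suc n))) * L2norm u)" if "n \<ge> N" for n
  proof -
    have "L2inner \<phi> (step_op (Suc n) u) - complex_of_real a * L2inner \<phi> u
        = L2inner \<phi> (\<lambda>x. step_op (Suc n) u x - complex_of_real a * u x)"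
      using L[OF \<phi>] u by (simp add: L2inner_diff_right L2inner_scale_right L2_scale)
    also have "norm \<dots> \<le> L2norm \<phi> * L2norm (\<lambda>x. step_op (Suc n) u x - complex_of_real a * u x)"
      by (rule L2inner_CS[OF L(1)[OF \<phi>] L2_diff[OF step_op_L2[OF u] L2_scale[OF u]]])
    also have "\<dots> \<le> L2norm \<phi> * ((b - a + inverse (real (Suc n))) * L2norm u)"
      using step_op_approx_on_interval[OF u Eu, of "Suc n"] N that ab
      by (intro mult_left_mono) (auto simp: inverse_eq_divide)
    finally show ?thesis .
  qed
  have lim2: "(\<lambda>n. L2norm \<phi> * ((b - a + inverse (real (Suc n))) * L2norm u)) \<longlonglongrightarrow> L2norm \<phi> * ((b - a + 0) * L2norm u)"
    by (intro tendsto_intros LIMSEQ_inverse_real_of_nat)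
  have "norm ((0 + L2inner (G \<phi>) u) - complex_of_real a * L2inner \<phi> u) \<le> L2norm \<phi> * ((b - a + 0) * L2norm u)"
    by (rule LIMSEQ_le[OF tendsto_norm[OF lim] lim2]) (intro exI[of _ N] allI impI bd)
  then show ?thesis by (simp add: mult_ac)
qed

section \<open>Smooth functions and convolution\<close>

definition smooth :: "('p::real_normed_vector \<Rightarrow> 'c::real_normed_vector) \<Rightarrow> bool" where
  "smooth f \<longleftrightarrow> (\<forall>vs x. Ditr vs f differentiable (at x))"

lemma Ditr_append: "Ditr (vs @ ws) f = Ditr vs (Ditr ws f)"
  by (induction vs) auto

lemma smooth_Ditr: "smooth f \<Longrightarrow> smooth (Ditr vs f)"
  by (simp add: smooth_def flip: Ditr_append)

lemma smooth_Dd: "smooth f \<Longrightarrow> smooth (Dd f v)"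
  using smooth_Ditr[of f "[v]"] by simp

lemma smooth_differentiable: "smooth f \<Longrightarrow> f differentiable (at x)"
  unfolding smooth_def by (metis Ditr.simps(1))

lemma smooth_continuous: "smooth f \<Longrightarrow> continuous_on S f"
  by (meson continuous_at_imp_continuous_on differentiable_imp_continuous_within smooth_differentiable)

text \<open>Iterated derivatives stay in P by induction on the list of directions, so a
  differentiable class closed under \<open>Dd\<close> consists of smooth functions.\<close>

lemma smooth_coinduct:
  assumes "P f" and "\<And>f x. P f \<Longrightarrow> f differentiable (at x)" and "\<And>f v. P f \<Longrightarrow> P (Dd f v)"
  shows "smooth f"
proof -
  have "P (Ditr vs f)" for vs by (induction vs) (auto simp: assms)
  then show ?thesis using assms(2) by (auto simp: smooth_def)
qed

lemma Dd_eqI: "(f has_derivative f') (at x) \<Longrightarrow> Dd f v x = f' v"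
  by (metis Dd_def frechet_derivative_at)

lemma has_derivative_Dd: "f differentiable (at x) \<Longrightarrow> (f has_derivative (\<lambda>v. Dd f v x)) (at x)"
  unfolding Dd_def by (simp add: frechet_derivative_works)

lemma Dd_scale: "f differentiable (at x) \<Longrightarrow> Dd f (c *\<^sub>R v) x = c *\<^sub>R Dd f v x"
  using has_derivative_Dd[of f x] by (metis has_derivative_linear linear_cmul)

lemma Dd_sum_Basis:
  fixes f :: "'p::euclidean_space \<Rightarrow> 'c::real_normed_vector"
  assumes "f differentiable (at x)"
  shows "Dd f v x = (\<Sum>b\<in>Basis. (v \<bullet> b) *\<^sub>R Dd f b x)"
proof -
  have lin: "linear (\<lambda>v. Dd f v x)"
    using has_derivative_Dd[OF assms] has_derivative_linear by blast
  have "Dd f (\<Sum>b\<in>Basis. (v \<bullet> b) *\<^sub>R b) x = (\<Sum>b\<in>Basis. (v \<bullet> b) *\<^sub>R Dd f b x)"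
    by (simp only: linear_sum[OF lin] linear_cmul[OF lin])
  then show ?thesis unfolding euclidean_representation .
qed

lemma Dd_compose_linear:
  assumes "bounded_linear L" "f differentiable (at (L x))"
  shows "Dd (\<lambda>x. f (L x)) v x = Dd f (L v) (L x)"
  by (rule Dd_eqI[OF has_derivative_compose[OF bounded_linear_imp_has_derivative[OF assms(1)] has_derivative_Dd[OF assms(2)]]])

lemma Dd_zero_outside:
  assumes "\<And>x. M < norm x \<Longrightarrow> f x = 0" "M < norm x"
  shows "Dd f v x = 0"
proof (rule Dd_eqI[of f "\<lambda>_. 0"])
  show "(f has_derivative (\<lambda>_. 0)) (at x)"
  proof (rule has_derivative_transform_within_open)
    show "open {x. M < norm x}" by (intro open_Collect_less continuous_intros)
  qed (use assms in auto)
qed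

section \<open>A flat function at the origin and smooth bumps\<close>

definition flat :: "real poly \<Rightarrow> real \<Rightarrow> real" where
  "flat p t = (if t \<le> 0 then 0 else poly p (1 / t) * exp (- (1 / t)))"

lemma tendsto_poly_exp: "((\<lambda>y::real. poly p y * exp (- y)) \<longlongrightarrow> 0) at_top"
proof -
  have "((\<lambda>y::real. \<Sum>i\<le>degree p. coeff p i * (y ^ i / exp y)) \<longlongrightarrow> (\<Sum>i\<le>degree p. coeff p i * 0)) at_top"
    by (intro tendsto_intros tendsto_power_div_exp_0)
  then show ?thesis
    by (simp add: poly_altdef sum_distrib_right sum_divide_distrib exp_minus field_simps)
qed

lemma flat_has_derivative_0: "(flat p has_real_derivative 0) (at 0)"
proof -
  \<comment> \<open>\<open>pCons 0 p\<close> is X times p; its extra factor 1/h is the denominator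
    of the difference quotient.\<close>
  have R: "((\<lambda>h. poly (pCons 0 p) (inverse h) * exp (- inverse h)) \<longlongrightarrow> 0) (at_right 0)"
    by (rule filterlim_compose[OF tendsto_poly_exp filterlim_inverse_at_top_right])
  have "((\<lambda>h. flat p h / h) \<longlongrightarrow> 0) (at_right 0)"
    by (rule Lim_transform_eventually[OF R])
       (auto simp: eventually_at_filter flat_def field_simps intro!: always_eventually)
  moreover have "((\<lambda>h. flat p h / h) \<longlongrightarrow> 0) (at_left 0)"
    by (rule Lim_transform_eventually[OF tendsto_const])
       (auto simp: eventually_at_filter flat_def intro!: always_eventually)
  ultimately show ?thesis
    by (simp add: has_field_derivative_iff filterlim_at_split flat_def[of p 0])
qed

text \<open>Differentiating p(1/t) exp(-1/t) gives (1/t^2)(p - p')(1/t) exp(-1/t), and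
  \<open>[:0, 0, 1:]\<close> is X^2. A polynomial parameter is carried along because it makes the
  family closed under differentiation.\<close>

lemma flat_has_derivative:
  "(flat p has_real_derivative flat ([:0, 0, 1:] * (p - pderiv p)) t) (at t)"
proof (cases t "0::real" rule: linorder_cases)
  case less
  have "((\<lambda>_. 0) has_real_derivative 0) (at t)" by simp
  then have "(flat p has_real_derivative 0) (at t)"
    by (rule has_field_derivative_transform_within_open[where S = "{..<0}"]) (use less in \<open>auto simp: flat_def\<close>)
  then show ?thesis using less by (simp add: flat_def)
next
  case equal
  then show ?thesis using flat_has_derivative_0 by (simp add: flat_def[of _ 0])
next
  case greater
  have "((\<lambda>t. poly p (1 / t) * exp (- (1 / t))) has_real_derivative
      poly (pderiv p) (1 / t) * (- (1 / t\<^sup>2)) * exp (- (1 / t)) + exp (- (1 / t)) * (1 / t\<^sup>2) * poly p (1 / t)) (at t)"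
    using greater by (auto intro!: derivative_eq_intros simp: power2_eq_square)
  then have "(flat p has_real_derivative
      poly (pderiv p) (1 / t) * (- (1 / t\<^sup>2)) * exp (- (1 / t)) + exp (- (1 / t)) * (1 / t\<^sup>2) * poly p (1 / t)) (at t)"
    by (rule has_field_derivative_transform_within_open[where S = "{0<..}"]) (use greater in \<open>auto simp: flat_def\<close>)
  moreover have "poly (pderiv p) (1 / t) * (- (1 / t\<^sup>2)) * exp (- (1 / t)) + exp (- (1 / t)) * (1 / t\<^sup>2) * poly p (1 / t)
     = flat ([:0, 0, 1:] * (p - pderiv p)) t"
    using greater by (simp add: flat_def power2_eq_square field_simps)
  ultimately show ?thesis by simp
qed

text \<open>A class of functions that is visibly closed under directional derivatives.\<close>
inductive elem_smooth :: "('p::euclidean_space \<Rightarrow> real) \<Rightarrow> bool" where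
  const: "elem_smooth (\<lambda>x. c)"
| inner: "elem_smooth (\<lambda>x. x \<bullet> b)"
| add: "elem_smooth f \<Longrightarrow> elem_smooth g \<Longrightarrow> elem_smooth (\<lambda>x. f x + g x)"
| mult: "elem_smooth f \<Longrightarrow> elem_smooth g \<Longrightarrow> elem_smooth (\<lambda>x. f x * g x)"
| flat: "elem_smooth f \<Longrightarrow> elem_smooth (\<lambda>x. flat p (f x))"

lemma elem_smooth_deriv:
  fixes f :: "'p::euclidean_space \<Rightarrow> real"
  shows "elem_smooth f \<Longrightarrow> (\<forall>x. f differentiable (at x)) \<and> (\<forall>v. elem_smooth (Dd f v))"
proof (induction rule: elem_smooth.induct)
  case (const c)
  have "Dd (\<lambda>x::'p. c) v = (\<lambda>x. 0)" for v
    by (rule ext, rule Dd_eqI[of _ "\<lambda>_. 0"]) simp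
  then show ?case using elem_smooth.const[of 0] by simp
next
  case (inner b)
  have d: "((\<lambda>x::'p. x \<bullet> b) has_derivative (\<lambda>v. v \<bullet> b)) (at x)" for x
    by (auto intro!: derivative_eq_intros)
  have "Dd (\<lambda>x::'p. x \<bullet> b) v = (\<lambda>x. v \<bullet> b)" for v
    by (rule ext, rule Dd_eqI[OF d])
  then show ?case using elem_smooth.const d by (auto simp: differentiable_def)
next
  case (add f g)
  have d: "((\<lambda>x. f x + g x) has_derivative (\<lambda>v. Dd f v x + Dd g v x)) (at x)" for x
    using add by (auto intro!: has_derivative_add has_derivative_Dd)
  have "Dd (\<lambda>x. f x + g x) v = (\<lambda>x. Dd f v x + Dd g v x)" for v
    by (rule ext, rule Dd_eqI[OF d])
  then show ?case using add d by (auto simp: differentiable_def intro: elem_smooth.add)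
next
  case (mult f g)
  have d: "((\<lambda>x. f x * g x) has_derivative (\<lambda>v. f x * Dd g v x + Dd f v x * g x)) (at x)" for x
    using mult by (auto intro!: has_derivative_mult has_derivative_Dd)
  have "Dd (\<lambda>x. f x * g x) v = (\<lambda>x. f x * Dd g v x + Dd f v x * g x)" for v
    by (rule ext, rule Dd_eqI[OF d])
  then show ?case using mult d by (auto simp: differentiable_def intro!: elem_smooth.add elem_smooth.mult)
next
  case (flat f p)
  have d: "((\<lambda>x. flat p (f x)) has_derivative (\<lambda>v. flat ([:0, 0, 1:] * (p - pderiv p)) (f x) * Dd f v x)) (at x)" for x
    using has_derivative_compose[OF has_derivative_Dd flat_has_derivative[unfolded has_field_derivative_def], of f x p] flat by simp
  have "Dd (\<lambda>x. flat p (f x)) v = (\<lambda>x. flat ([:0, 0, 1:] * (p - pderiv p)) (f x) * Dd f v x)" for v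
    by (rule ext, rule Dd_eqI[OF d])
  then show ?case using flat d by (auto simp: differentiable_def intro!: elem_smooth.mult elem_smooth.flat)
qed

lemma elem_smooth_imp_smooth:
  fixes f :: "'p::euclidean_space \<Rightarrow> real"
  shows "elem_smooth f \<Longrightarrow> smooth f"
  by (rule smooth_coinduct[where P = elem_smooth]) (use elem_smooth_deriv in auto)

lemma elem_smooth_sum: "finite I \<Longrightarrow> (\<And>i. i \<in> I \<Longrightarrow> elem_smooth (f i)) \<Longrightarrow> elem_smooth (\<lambda>x. \<Sum>i\<in>I. f i x)"
  by (induction I rule: finite_induct) (auto intro: elem_smooth.intros)

lemma elem_smooth_norm_fst: "elem_smooth (\<lambda>z::'a::euclidean_space \<times> 'b::euclidean_space. (norm (fst z))\<^sup>2)"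
proof -
  have "(norm (fst z))\<^sup>2 = (\<Sum>b\<in>Basis. (z \<bullet> (b, 0)) * (z \<bullet> (b, 0)))" for z :: "'a \<times> 'b"
    unfolding power2_norm_eq_inner by (subst euclidean_inner) (simp add: inner_prod_def)
  then show ?thesis by (simp only:) (intro elem_smooth_sum elem_smooth.intros finite_Basis)
qed

lemma elem_smooth_norm_snd: "elem_smooth (\<lambda>z::'a::euclidean_space \<times> 'b::euclidean_space. (norm (snd z))\<^sup>2)"
proof -
  have "(norm (snd z))\<^sup>2 = (\<Sum>b\<in>Basis. (z \<bullet> (0, b)) * (z \<bullet> (0, b)))" for z :: "'a \<times> 'b"
    unfolding power2_norm_eq_inner by (subst euclidean_inner) (simp add: inner_prod_def)
  then show ?thesis by (simp only:) (intro elem_smooth_sum elem_smooth.intros finite_Basis)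
qed

text \<open>Separate parameters for the two variables: the bump vanishes unless the first component
  is shorter than 1/s and the second shorter than 1/t. The different scales serve both the cutoffs,
  adapted to the Grushin dilations, and the mollifiers.\<close>

definition bump :: "real \<Rightarrow> real \<Rightarrow> 'a::euclidean_space \<times> 'b::euclidean_space \<Rightarrow> real" where
  "bump s t z = flat 1 (1 - s\<^sup>2 * (norm (fst z))\<^sup>2) * flat 1 (1 - t\<^sup>2 * (norm (snd z))\<^sup>2)"

lemma smooth_bump: "smooth (bump s t)"
proof -
  have "elem_smooth (\<lambda>z::'a \<times> 'b. flat 1 (1 + (- s\<^sup>2) * (norm (fst z))\<^sup>2) * flat 1 (1 + (- t\<^sup>2) * (norm (snd z))\<^sup>2))"
    by (intro elem_smooth.intros elem_smooth_norm_fst elem_smooth_norm_snd)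
  then have "elem_smooth (bump s t :: 'a \<times> 'b \<Rightarrow> real)" by (simp add: bump_def[abs_def])
  then show ?thesis by (rule elem_smooth_imp_smooth)
qed

lemma flat1_bounds: "0 \<le> flat 1 t" "t \<le> 1 \<Longrightarrow> flat 1 t \<le> exp (-1)"
  by (auto simp: flat_def field_simps)

lemma bump_nonneg: "0 \<le> bump s t z"
  by (simp add: bump_def flat1_bounds)

text \<open>Each factor peaks at exp(-1). This is why the cutoffs used later carry the normalising
  factor exp 2.\<close>

lemma bump_le: "bump s t z \<le> exp (-2)"
proof -
  have "bump s t z \<le> exp (-1) * exp (-1)"
    unfolding bump_def by (intro mult_mono flat1_bounds) auto
  then show ?thesis by (simp flip: exp_add)
qed

lemma bump_eq_0:
  assumes "s > 0" "t > 0" "1 / s \<le> norm (fst z) \<or> 1 / t \<le> norm (snd z)"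
  shows "bump s t z = 0"
proof -
  have "1 \<le> r\<^sup>2 * x\<^sup>2" if "1 / r \<le> x" "r > 0" for r x :: real
    using power_mono[of 1 "r * x" 2] that by (simp add: field_simps power_mult_distrib)
  then show ?thesis using assms by (auto simp: bump_def flat_def)
qed

lemma bump_scale:
  "bump s t z = bump 1 1 (s *\<^sub>R fst z, t *\<^sub>R snd z)"
  by (simp add: bump_def power_mult_distrib)

lemma norm_prod_le: "norm z \<le> norm (fst z) + norm (snd z)"
  using norm_Pair_le[of "fst z" "snd z"] by simp

lemma bump_support: "s > 0 \<Longrightarrow> t > 0 \<Longrightarrow> 1 / s + 1 / t < norm z \<Longrightarrow> bump s t z = 0"
  using norm_prod_le[of z] by (intro bump_eq_0) auto

lemma continuous_compact_support_bounded:
  fixes f :: "'p::euclidean_space \<Rightarrow> 'c::real_normed_vector"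
  assumes "continuous_on UNIV f" "\<And>x. M < norm x \<Longrightarrow> f x = 0"
  obtains B where "B > 0" "\<And>x. norm (f x) \<le> B"
proof -
  have "compact (f ` cball 0 M)"
    by (intro compact_continuous_image continuous_on_subset[OF assms(1)]) auto
  then obtain B where B: "B > 0" "\<forall>y\<in>f ` cball 0 M. norm y \<le> B"
    using compact_imp_bounded bounded_pos by blast
  have "norm (f x) \<le> B" for x
    using B assms(2)[of x] by (cases "norm x \<le> M") auto
  then show ?thesis using that B by blast
qed

lemma Dd_bounded:
  fixes k :: "'p::euclidean_space \<Rightarrow> real"
  assumes k: "smooth k" and supp: "\<And>x. M < norm x \<Longrightarrow> k x = 0"
  obtains B where "B > 0" "\<And>x v. \<bar>Dd k v x\<bar> \<le> B * norm v"
proof -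
  have "\<exists>B>0. \<forall>x. norm (Dd k b x) \<le> B" for b
  proof -
    have "\<And>x. M < norm x \<Longrightarrow> Dd k b x = 0" by (rule Dd_zero_outside[OF supp])
    from continuous_compact_support_bounded[OF smooth_continuous[OF smooth_Dd[OF k]] this]
    show ?thesis by blast
  qed
  then obtain B where B: "\<And>b. B b > 0" "\<And>b x. norm (Dd k b x) \<le> B b" by metis
  have "\<bar>Dd k v x\<bar> \<le> ((\<Sum>b\<in>Basis. B b) + 1) * norm v" for x v
  proof -
    have "\<bar>Dd k v x\<bar> \<le> (\<Sum>b\<in>Basis. \<bar>(v \<bullet> b) * Dd k b x\<bar>)"
      unfolding Dd_sum_Basis[OF smooth_differentiable[OF k], of v x] by (simp add: sum_abs)
    also have "\<dots> \<le> (\<Sum>b\<in>Basis. norm v * B b)"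
      using B by (intro sum_mono) (auto simp: abs_mult intro!: mult_mono Basis_le_norm)
    also have "\<dots> \<le> ((\<Sum>b\<in>Basis. B b) + 1) * norm v"
      unfolding sum_distrib_left[symmetric] mult.commute[of _ "norm v"] by (intro mult_left_mono) auto
    finally show ?thesis .
  qed
  moreover have "(\<Sum>b\<in>Basis. B b) + 1 > 0"
    using B by (intro add_nonneg_pos sum_nonneg) (auto simp: less_imp_le)
  ultimately show ?thesis using that by blast
qed

section \<open>Convolution with smooth compactly supported kernels\<close>

definition conv :: "('p::euclidean_space \<Rightarrow> real) \<Rightarrow> ('p \<Rightarrow> complex) \<Rightarrow> 'p \<Rightarrow> complex" where
  "conv k \<psi> x = (\<integral>y. complex_of_real (k (x - y)) * \<psi> y \<partial>lborel)"

definition locint :: "('p::euclidean_space \<Rightarrow> complex) \<Rightarrow> bool" where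
  "locint \<psi> \<longleftrightarrow> \<psi> \<in> borel_measurable borel \<and> (\<forall>R. integrable lborel (\<lambda>y. indicator (cball 0 R) y * \<psi> y))"

lemma locint_measurable: "locint \<psi> \<Longrightarrow> \<psi> \<in> borel_measurable borel"
  by (simp add: locint_def)

lemma L2_indicator: "(\<lambda>x. indicator (cball 0 R) x) \<in> (L2 :: ('p::euclidean_space \<Rightarrow> complex) set)"
proof (rule L2I)
  have "(\<lambda>x::'p. (norm (indicator (cball 0 R) x :: complex))\<^sup>2) = indicator (cball 0 R)"
    by (auto simp: indicator_def)
  moreover have "emeasure lborel (cball (0::'p) R) < \<infinity>" by (rule emeasure_lborel_cball_finite)
  ultimately show "integrable lborel (\<lambda>x::'p. (norm (indicator (cball 0 R) x :: complex))\<^sup>2)" by simp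
qed (rule borel_measurable_indicator, simp)

lemma L2_locint: "f \<in> L2 \<Longrightarrow> locint f"
  unfolding locint_def using L2_integrable_mult[OF L2_indicator] L2_measurable by blast

lemma conv_integrable:
  assumes \<psi>: "locint \<psi>" and k: "continuous_on UNIV k" and supp: "\<And>x. M < norm x \<Longrightarrow> k x = 0"
  shows "integrable lborel (\<lambda>y. complex_of_real (k (x - y)) * \<psi> y)"
proof -
  obtain B where B: "B > 0" "\<And>x. norm (k x) \<le> B"
    using continuous_compact_support_bounded[OF k supp] by metis
  note [measurable] = locint_measurable[OF \<psi>] borel_measurable_continuous_onI[OF k]
  have bd: "norm (complex_of_real (k (x - y)) * \<psi> y) \<le> norm (complex_of_real B * (indicator (cball 0 (norm x + M)) y * \<psi> y))" for y
  proof (cases "norm y \<le> norm x + M")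
    case True
    then show ?thesis using B(2)[of "x - y"] B(1) by (auto simp: norm_mult intro!: mult_right_mono)
  next
    case False
    then have "M < norm (x - y)" using norm_triangle_ineq2[of y x] by (simp add: norm_minus_commute)
    then show ?thesis using supp by simp
  qed
  have "integrable lborel (\<lambda>y. complex_of_real B * (indicator (cball 0 (norm x + M)) y * \<psi> y))"
    using \<psi> by (intro integrable_mult_right) (simp add: locint_def)
  then show ?thesis
    by (rule Bochner_Integration.integrable_bound[OF _ _ AE_I2[OF bd]]) measurable
qed

text \<open>Differentiation under the integral sign. The Frechet quotient is tested along sequences
  so that dominated convergence applies; the Lipschitz bound on k provides the majorant.\<close>

lemma conv_has_derivative:
  fixes k :: "'p::euclidean_space \<Rightarrow> real"
  assumes \<psi>: "locint \<psi>" and k: "smooth k" and supp: "\<And>x. M < norm x \<Longrightarrow> k x = 0"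
  shows "(conv k \<psi> has_derivative (\<lambda>v. conv (Dd k v) \<psi> x)) (at x)"
proof -
  obtain B where B: "B > 0" "\<And>x v. \<bar>Dd k v x\<bar> \<le> B * norm v"
    using Dd_bounded[OF k supp] by metis
  have lip: "\<bar>k z - k w\<bar> \<le> B * norm (z - w)" for z w
  proof -
    have "onorm (\<lambda>v. Dd k v x) \<le> B" for x by (rule onorm_le) (use B in auto)
    then show ?thesis
      using differentiable_bound[of UNIV k "\<lambda>x v. Dd k v x" B z w] has_derivative_Dd[OF smooth_differentiable[OF k]]
      by auto
  qed
  note meas [measurable] = locint_measurable[OF \<psi>] borel_measurable_continuous_onI[OF smooth_continuous[OF k]]
     borel_measurable_continuous_onI[OF smooth_continuous[OF smooth_Dd[OF k]]]
  have int: "integrable lborel (\<lambda>y. complex_of_real (k (x - y)) * \<psi> y)" for x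
    by (rule conv_integrable[OF \<psi> smooth_continuous[OF k] supp])
  have suppD: "M < norm x \<Longrightarrow> Dd k v x = 0" for x v by (rule Dd_zero_outside[OF supp])
  have intD: "integrable lborel (\<lambda>y. complex_of_real (Dd k v (x - y)) * \<psi> y)" for v x
    by (rule conv_integrable[OF \<psi> smooth_continuous[OF smooth_Dd[OF k]] suppD])
  have lin: "linear (\<lambda>v. conv (Dd k v) \<psi> x)"
  proof (rule linearI)
    have l: "linear (\<lambda>v. Dd k v z)" for z
      using has_derivative_Dd[OF smooth_differentiable[OF k]] has_derivative_linear by blast
    show "conv (Dd k (v + w)) \<psi> x = conv (Dd k v) \<psi> x + conv (Dd k w) \<psi> x" for v w
      unfolding conv_def linear_add[OF l] using intD by (simp add: distrib_right)
    show "conv (Dd k (c *\<^sub>R v)) \<psi> x = c *\<^sub>R conv (Dd k v) \<psi> x" for c v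
      unfolding conv_def linear_cmul[OF l] by (simp add: mult.assoc scaleR_conv_of_real)
  qed
  have "((\<lambda>h. norm (conv k \<psi> (x + h) - conv k \<psi> x - conv (Dd k h) \<psi> x) / norm h) \<longlongrightarrow> 0) (at 0)"
    unfolding tendsto_at_iff_sequentially
  proof (intro allI impI)
    fix X :: "nat \<Rightarrow> 'p"
    assume X0: "\<forall>i. X i \<in> UNIV - {0}" and X: "X \<longlonglongrightarrow> 0"
    define q where "q = (\<lambda>i y. (k (x + X i - y) - k (x - y) - Dd k (X i) (x - y)) / norm (X i))"
    obtain R where R: "\<And>i. norm (X i) \<le> R" "R > 0"
      using BseqE[OF convergent_imp_Bseq[OF convergentI[OF X]]] by metis
    \<comment> \<open>One B comes from the Lipschitz estimate and one from the linear term. The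
      radius contains the supports of all shifted kernels at once, because the increments are
      bounded by R.\<close>
    define w where "w = (\<lambda>y. 2 * B * norm (indicator (cball 0 (norm x + R + M)) y * \<psi> y))"
    have "(\<lambda>i. \<integral>y. complex_of_real (q i y) * \<psi> y \<partial>lborel) \<longlonglongrightarrow> (\<integral>y. 0 \<partial>(lborel :: 'p measure))"
    proof (rule integral_dominated_convergence[where w = w])
      show "integrable lborel w" unfolding w_def
        using \<psi> by (intro integrable_mult_right integrable_norm) (auto simp: locint_def)
      show "AE y in lborel. (\<lambda>i. complex_of_real (q i y) * \<psi> y) \<longlonglongrightarrow> 0"
      proof (rule AE_I2)
        fix y :: 'p
        have "((\<lambda>h. norm (k ((x - y) + h) - k (x - y) - Dd k h (x - y)) / norm h) \<longlongrightarrow> 0) (at 0)"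
          using has_derivative_Dd[OF smooth_differentiable[OF k], of "x - y"] by (simp add: has_derivative_at)
        then have "(\<lambda>i. norm (q i y)) \<longlonglongrightarrow> 0"
          using X0 X unfolding tendsto_at_iff_sequentially q_def by (auto simp: comp_def algebra_simps)
        then have "(\<lambda>i. complex_of_real (q i y)) \<longlonglongrightarrow> 0"
          using tendsto_of_real[OF tendsto_norm_zero_cancel, of "\<lambda>i. q i y" sequentially] by simp
        then show "(\<lambda>i. complex_of_real (q i y) * \<psi> y) \<longlonglongrightarrow> 0" by (rule tendsto_mult_left_zero)
      qed
      show "AE y in lborel. norm (complex_of_real (q i y) * \<psi> y) \<le> w y" for i
      proof (rule AE_I2)
        fix y :: 'p
        show "norm (complex_of_real (q i y) * \<psi> y) \<le> w y"
        proof (cases "norm y \<le> norm x + R + M")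
          case True
          have "\<bar>k (x + X i - y) - k (x - y) - Dd k (X i) (x - y)\<bar> \<le> 2 * B * norm (X i)"
            using lip[of "x + X i - y" "x - y"] B(2)[of "X i" "x - y"] by (simp add: algebra_simps)
          then have "\<bar>q i y\<bar> \<le> 2 * B"
            using X0 by (auto simp: q_def divide_le_eq)
          then show ?thesis using True by (auto simp: w_def norm_mult intro!: mult_right_mono)
        next
          case False
          then have "M < norm (x - y)" "M < norm (x + X i - y)"
            using norm_triangle_ineq2[of y x] norm_triangle_ineq2[of y "x + X i"] norm_triangle_ineq[of x "X i"] R(1)[of i] R(2)
            by (auto simp: norm_minus_commute)
          then show ?thesis using supp suppD by (simp add: q_def w_def B(1) less_imp_le)
        qed
      qed
    qed (auto simp: q_def)
    moreover have "(\<integral>y. complex_of_real (q i y) * \<psi> y \<partial>lborel)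
        = (conv k \<psi> (x + X i) - conv k \<psi> x - conv (Dd k (X i)) \<psi> x) / norm (X i)" for i
    proof -
      have "(\<lambda>y. complex_of_real (q i y) * \<psi> y) = (\<lambda>y. (complex_of_real (k (x + X i - y)) * \<psi> y
        - complex_of_real (k (x - y)) * \<psi> y - complex_of_real (Dd k (X i) (x - y)) * \<psi> y) / norm (X i))"
        by (auto simp: q_def diff_divide_distrib algebra_simps)
      then show ?thesis
        unfolding conv_def using int intD by simp
    qed
    ultimately have "(\<lambda>i. norm ((conv k \<psi> (x + X i) - conv k \<psi> x - conv (Dd k (X i)) \<psi> x) / norm (X i))) \<longlonglongrightarrow> 0"
      using tendsto_norm_zero by fastforce
    then show "((\<lambda>h. norm (conv k \<psi> (x + h) - conv k \<psi> x - conv (Dd k h) \<psi> x) / norm h) \<circ> X) \<longlonglongrightarrow> 0"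
      by (simp add: comp_def norm_divide)
  qed
  then show ?thesis using lin by (simp add: has_derivative_at linear_conv_bounded_linear)
qed

lemma Ditr_zero_outside:
  assumes "\<And>x. M < norm x \<Longrightarrow> f x = 0" "M < norm x"
  shows "Ditr vs f x = 0"
  using assms(2) by (induction vs arbitrary: x) (auto intro: assms(1) Dd_zero_outside)

lemma Ditr_conv:
  assumes \<psi>: "locint \<psi>" and k: "smooth k" and supp: "\<And>x. M < norm x \<Longrightarrow> k x = 0"
  shows "Ditr vs (conv k \<psi>) = conv (Ditr vs k) \<psi>"
proof (induction vs)
  case (Cons v vs)
  have "Dd (conv (Ditr vs k) \<psi>) v x = conv (Dd (Ditr vs k) v) \<psi> x" for x
    by (rule Dd_eqI[OF conv_has_derivative[OF \<psi> smooth_Ditr[OF k], where M = M]]) (rule Ditr_zero_outside[OF supp])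
  then show ?case by (intro ext) (simp only: Ditr.simps Cons.IH)
qed simp

lemma smooth_conv:
  assumes \<psi>: "locint \<psi>" and k: "smooth k" and supp: "\<And>x. M < norm x \<Longrightarrow> k x = 0"
  shows "smooth (conv k \<psi>)"
  unfolding smooth_def
proof (intro allI)
  fix vs x
  have "(conv (Ditr vs k) \<psi> has_derivative (\<lambda>v. conv (Dd (Ditr vs k) v) \<psi> x)) (at x)"
    by (rule conv_has_derivative[OF \<psi> smooth_Ditr[OF k], where M = M]) (rule Ditr_zero_outside[OF supp])
  then show "Ditr vs (conv k \<psi>) differentiable (at x)"
    using Ditr_conv[OF \<psi> k, of M vs] supp by (simp add: differentiableI)
qed

lemma conv_zero_outside:
  assumes "\<And>x. M < norm x \<Longrightarrow> k x = 0" "\<And>x. M' < norm x \<Longrightarrow> \<psi> x = 0" "M + M' < norm x"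
  shows "conv k \<psi> x = 0"
proof -
  have "complex_of_real (k (x - y)) * \<psi> y = 0" for y
    using assms norm_triangle_ineq[of "x - y" y] by (cases "M < norm (x - y)") auto
  then have "(\<lambda>y. complex_of_real (k (x - y)) * \<psi> y) = (\<lambda>y. 0)" by (intro ext)
  then show ?thesis unfolding conv_def by (simp only: Bochner_Integration.integral_zero)
qed

lemma bounded_support_compact_closure:
  fixes f :: "'p::euclidean_space \<Rightarrow> 'c::zero"
  assumes "\<And>x. M < norm x \<Longrightarrow> f x = 0"
  shows "compact (closure {x. f x \<noteq> 0})"
proof -
  have "{x. f x \<noteq> 0} \<subseteq> cball 0 M" using assms by force
  then show ?thesis using bounded_subset bounded_cball compact_closure by blast
qed

lemma test_fun_conv:
  assumes \<psi>: "locint \<psi>" "\<And>x. M' < norm x \<Longrightarrow> \<psi> x = 0" and k: "smooth k" "\<And>x. M < norm x \<Longrightarrow> k x = 0"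
  shows "test_fun (conv k \<psi>)"
  unfolding test_fun_def
proof
  show "\<forall>vs x. Ditr vs (conv k \<psi>) differentiable (at x)"
    using smooth_conv[OF \<psi>(1) k(1), of M] k(2) by (simp add: smooth_def)
  show "compact (closure {x. conv k \<psi> x \<noteq> 0})"
    by (rule bounded_support_compact_closure[of "M + M'"], rule conv_zero_outside[of M _ M']) (auto intro: k(2) \<psi>(2))
qed

section \<open>Mollification in the mean\<close>

lemma nn_integral_lborel_affine:
  fixes F :: "'p::euclidean_space \<Rightarrow> ennreal"
  assumes [measurable]: "F \<in> borel_measurable borel" and c: "\<bar>c\<bar> = 1"
  shows "(\<integral>\<^sup>+x. F (t + c *\<^sub>R x) \<partial>lborel) = (\<integral>\<^sup>+x. F x \<partial>lborel)"
proof -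
  have "c \<noteq> 0" using c by auto
  then have "(\<integral>\<^sup>+x. F x \<partial>lborel) = (\<integral>\<^sup>+x. F x \<partial>density (distr lborel borel (\<lambda>x. t + c *\<^sub>R x)) (\<lambda>_. ennreal (\<bar>c\<bar> ^ DIM('p))))"
    using lborel_affine[of c t] by simp
  also have "\<dots> = (\<integral>\<^sup>+x. F (t + c *\<^sub>R x) \<partial>lborel)"
    using c by (simp add: nn_integral_density nn_integral_distr)
  finally show ?thesis by simp
qed

lemma nn_integral_lborel_shift:
  "F \<in> borel_measurable borel \<Longrightarrow> (\<integral>\<^sup>+x. F (x - y) \<partial>lborel) = (\<integral>\<^sup>+x. F x \<partial>lborel)" for F :: "'p::euclidean_space \<Rightarrow> ennreal"
  using nn_integral_lborel_affine[of F 1 "- y"] by simp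

lemma nn_integral_lborel_reflect:
  "F \<in> borel_measurable borel \<Longrightarrow> (\<integral>\<^sup>+x. F (y - x) \<partial>lborel) = (\<integral>\<^sup>+x. F x \<partial>lborel)" for F :: "'p::euclidean_space \<Rightarrow> ennreal"
  using nn_integral_lborel_affine[of F "-1" y] by simp

lemma nn_integral_conv_right:
  fixes k F :: "'p::euclidean_space \<Rightarrow> ennreal"
  assumes [measurable]: "k \<in> borel_measurable borel" "F \<in> borel_measurable borel"
  shows "(\<integral>\<^sup>+x. \<integral>\<^sup>+y. k (x - y) * F y \<partial>lborel \<partial>lborel) = (\<integral>\<^sup>+x. k x \<partial>lborel) * (\<integral>\<^sup>+x. F x \<partial>lborel)"
proof -
  have "(\<integral>\<^sup>+x. \<integral>\<^sup>+y. k (x - y) * F y \<partial>lborel \<partial>lborel) = (\<integral>\<^sup>+y. \<integral>\<^sup>+x. k (x - y) * F y \<partial>lborel \<partial>lborel)"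
    by (rule lborel_pair.Fubini'[symmetric, of "\<lambda>x y. k (x - y) * F y"]) measurable
  also have "\<dots> = (\<integral>\<^sup>+y. (\<integral>\<^sup>+x. k x \<partial>lborel) * F y \<partial>lborel)"
    by (simp add: nn_integral_multc nn_integral_lborel_shift)
  finally show ?thesis by (simp add: nn_integral_cmult)
qed

lemma nn_integral_conv_left:
  fixes k F :: "'p::euclidean_space \<Rightarrow> ennreal"
  assumes [measurable]: "k \<in> borel_measurable borel" "F \<in> borel_measurable borel"
  shows "(\<integral>\<^sup>+x. \<integral>\<^sup>+y. k (x - y) * F x \<partial>lborel \<partial>lborel) = (\<integral>\<^sup>+x. k x \<partial>lborel) * (\<integral>\<^sup>+x. F x \<partial>lborel)"
  by (simp add: nn_integral_multc nn_integral_lborel_reflect nn_integral_cmult)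

lemma nn_norm_sq: "ennreal ((norm z)\<^sup>2) = (ennreal (norm z))\<^sup>2"
  by (simp add: ennreal_power)

lemma conv_measurable:
  assumes [measurable]: "\<psi> \<in> borel_measurable borel" "k \<in> borel_measurable borel"
  shows "conv k \<psi> \<in> borel_measurable borel"
  unfolding conv_def[abs_def] by measurable

text \<open>Young's inequality for L1 and L2: write |k| as the product of two square roots, apply
  Cauchy-Schwarz at each x, then integrate in x by Tonelli.\<close>

lemma conv_L2:
  fixes k :: "'p::euclidean_space \<Rightarrow> real"
  assumes \<psi>: "\<psi> \<in> L2" and k: "integrable lborel k" and I: "(\<integral>x. \<bar>k x\<bar> \<partial>lborel) \<le> I"
  shows "conv k \<psi> \<in> L2" "L2norm (conv k \<psi>) \<le> I * L2norm \<psi>"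
proof -
  have [measurable]: "k \<in> borel_measurable borel" "\<psi> \<in> borel_measurable borel"
    using k \<psi> by (auto simp: L2_def)
  have I0: "0 \<le> I" by (rule order_trans[OF _ I]) simp
  have kI: "(\<integral>\<^sup>+x. ennreal \<bar>k x\<bar> \<partial>lborel) \<le> ennreal I"
    using k I by (subst nn_integral_eq_integral) (auto intro: ennreal_leI)
  have pt: "ennreal ((norm (conv k \<psi> x))\<^sup>2) \<le> ennreal I * (\<integral>\<^sup>+y. ennreal \<bar>k (x - y)\<bar> * ennreal ((norm (\<psi> y))\<^sup>2) \<partial>lborel)" for x
  proof -
    \<comment> \<open>Where the integrand is not integrable, \<open>conv\<close> takes the default
      value 0 and the bound is trivial.\<close>
    have "ennreal (norm (conv k \<psi> x)) \<le> (\<integral>\<^sup>+y. ennreal (norm (complex_of_real (k (x - y)) * \<psi> y)) \<partial>lborel)"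
      unfolding conv_def by (cases "integrable lborel (\<lambda>y. complex_of_real (k (x - y)) * \<psi> y)") (auto simp: not_integrable_integral_eq intro: integral_norm_bound_ennreal)
    also have "\<dots> = (\<integral>\<^sup>+y. ennreal (sqrt \<bar>k (x - y)\<bar>) * ennreal (sqrt \<bar>k (x - y)\<bar> * norm (\<psi> y)) \<partial>lborel)"
      by (rule nn_integral_cong) (simp add: norm_mult mult.assoc[symmetric] flip: ennreal_mult)
    finally have "(ennreal (norm (conv k \<psi> x)))\<^sup>2 \<le>
        (\<integral>\<^sup>+y. ennreal (sqrt \<bar>k (x - y)\<bar>) * ennreal (sqrt \<bar>k (x - y)\<bar> * norm (\<psi> y)) \<partial>lborel)\<^sup>2"
      by (intro power_mono) auto
    also have "\<dots> \<le> (\<integral>\<^sup>+y. (ennreal (sqrt \<bar>k (x - y)\<bar>))\<^sup>2 \<partial>lborel) * (\<integral>\<^sup>+y. (ennreal (sqrt \<bar>k (x - y)\<bar> * norm (\<psi> y)))\<^sup>2 \<partial>lborel)"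
      by (rule Cauchy_Schwarz_nn_integral) auto
    also have "\<dots> = (\<integral>\<^sup>+y. ennreal \<bar>k (x - y)\<bar> \<partial>lborel) * (\<integral>\<^sup>+y. ennreal \<bar>k (x - y)\<bar> * ennreal ((norm (\<psi> y))\<^sup>2) \<partial>lborel)"
      by (simp add: ennreal_power power_mult_distrib ennreal_mult)
    also have "(\<integral>\<^sup>+y. ennreal \<bar>k (x - y)\<bar> \<partial>lborel) = (\<integral>\<^sup>+y. ennreal \<bar>k y\<bar> \<partial>lborel)"
      by (rule nn_integral_lborel_reflect) simp
    finally show ?thesis
      unfolding nn_norm_sq by (rule order_trans) (intro mult_right_mono kI, simp)
  qed
  have "(\<integral>\<^sup>+x. ennreal ((norm (conv k \<psi> x))\<^sup>2) \<partial>lborel)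
      \<le> (\<integral>\<^sup>+x. ennreal I * (\<integral>\<^sup>+y. ennreal \<bar>k (x - y)\<bar> * ennreal ((norm (\<psi> y))\<^sup>2) \<partial>lborel) \<partial>lborel)"
    by (rule nn_integral_mono) (use pt in auto)
  also have "\<dots> = ennreal I * ((\<integral>\<^sup>+x. ennreal \<bar>k x\<bar> \<partial>lborel) * (\<integral>\<^sup>+x. ennreal ((norm (\<psi> x))\<^sup>2) \<partial>lborel))"
    by (subst nn_integral_cmult) (simp_all add: nn_integral_conv_right[of "\<lambda>x. ennreal \<bar>k x\<bar>" "\<lambda>x. ennreal ((norm (\<psi> x))\<^sup>2)"])
  also have "\<dots> \<le> ennreal I * (ennreal I * ennreal ((L2norm \<psi>)\<^sup>2))"
    by (intro mult_left_mono mult_mono kI) (simp_all add: L2_nn_norm[OF \<psi>])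
  also have "\<dots> = ennreal ((I * L2norm \<psi>)\<^sup>2)"
    using I0 by (simp add: power2_eq_square ac_simps flip: ennreal_mult)
  finally have fin: "(\<integral>\<^sup>+x. ennreal ((norm (conv k \<psi> x))\<^sup>2) \<partial>lborel) \<le> ennreal ((I * L2norm \<psi>)\<^sup>2)" .
  have [measurable]: "conv k \<psi> \<in> borel_measurable borel" by (rule conv_measurable) auto
  show L: "conv k \<psi> \<in> L2"
    by (rule L2I) (auto intro!: integrableI_bounded le_less_trans[OF fin])
  have "ennreal ((L2norm (conv k \<psi>))\<^sup>2) \<le> ennreal ((I * L2norm \<psi>)\<^sup>2)"
    using fin unfolding L2_nn_norm[OF L] .
  then have "(L2norm (conv k \<psi>))\<^sup>2 \<le> (I * L2norm \<psi>)\<^sup>2" by (simp add: ennreal_le_iff)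
  then show "L2norm (conv k \<psi>) \<le> I * L2norm \<psi>"
    by (rule power2_le_imp_le) (simp add: I0)
qed

text \<open>Fubini. Absolute integrability follows from bounding the product of |\<psi> y| and |u x|
  by the sum of their squares, since each square then integrates against |k| separately.\<close>

lemma conv_adjoint:
  fixes k :: "'p::euclidean_space \<Rightarrow> real"
  assumes \<psi>: "\<psi> \<in> L2" and u: "u \<in> L2" and k: "integrable lborel k"
  shows "L2inner (conv k \<psi>) u = L2inner \<psi> (conv (\<lambda>z. k (- z)) u)"
proof -
  have [measurable]: "k \<in> borel_measurable borel" "\<psi> \<in> borel_measurable borel" "u \<in> borel_measurable borel"
    using k \<psi> u by (auto simp: L2_def)
  define f where "f = (\<lambda>(x, y). complex_of_real (k (x - y)) * \<psi> y * cnj (u x))"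
  have fin: "(\<integral>\<^sup>+x. ennreal \<bar>k x\<bar> \<partial>lborel) < \<infinity>" "(\<integral>\<^sup>+x. ennreal ((norm (\<psi> x))\<^sup>2) \<partial>lborel) < \<infinity>" "(\<integral>\<^sup>+x. ennreal ((norm (u x))\<^sup>2) \<partial>lborel) < \<infinity>"
    using k by (auto simp: L2_nn_norm \<psi> u nn_integral_eq_integral)
  have meas [measurable]: "f \<in> borel_measurable (lborel \<Otimes>\<^sub>M lborel)" unfolding f_def by measurable
  have int: "integrable (lborel \<Otimes>\<^sub>M lborel) f"
  proof (rule integrableI_bounded)
    have "(\<integral>\<^sup>+z. ennreal (norm (f z)) \<partial>(lborel \<Otimes>\<^sub>M lborel)) = (\<integral>\<^sup>+x. \<integral>\<^sup>+y. ennreal (norm (f (x, y))) \<partial>lborel \<partial>lborel)"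
      by (rule lborel.nn_integral_fst[symmetric]) measurable
    also have "\<dots> \<le> (\<integral>\<^sup>+x. \<integral>\<^sup>+y. ennreal \<bar>k (x - y)\<bar> * ennreal ((norm (\<psi> y))\<^sup>2) + ennreal \<bar>k (x - y)\<bar> * ennreal ((norm (u x))\<^sup>2) \<partial>lborel \<partial>lborel)"
    proof (intro nn_integral_mono)
      fix x y
      have "norm (\<psi> y) * norm (u x) \<le> (norm (\<psi> y))\<^sup>2 + (norm (u x))\<^sup>2"
        using sum_squares_bound[of "norm (\<psi> y)" "norm (u x)"] mult_nonneg_nonneg[OF norm_ge_zero norm_ge_zero, of "\<psi> y" "u x"]
        by linarith
      then have "norm (f (x, y)) \<le> \<bar>k (x - y)\<bar> * ((norm (\<psi> y))\<^sup>2 + (norm (u x))\<^sup>2)"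
        unfolding f_def by (simp add: norm_mult mult.assoc mult_left_mono)
      then show "ennreal (norm (f (x, y))) \<le> ennreal \<bar>k (x - y)\<bar> * ennreal ((norm (\<psi> y))\<^sup>2) + ennreal \<bar>k (x - y)\<bar> * ennreal ((norm (u x))\<^sup>2)"
        by (simp add: distrib_left flip: ennreal_mult ennreal_plus)
    qed
    also have "\<dots> = (\<integral>\<^sup>+x. (\<integral>\<^sup>+y. ennreal \<bar>k (x - y)\<bar> * ennreal ((norm (\<psi> y))\<^sup>2) \<partial>lborel) + (\<integral>\<^sup>+y. ennreal \<bar>k (x - y)\<bar> * ennreal ((norm (u x))\<^sup>2) \<partial>lborel) \<partial>lborel)"
      by (intro nn_integral_cong nn_integral_add) measurable
    also have "\<dots> = (\<integral>\<^sup>+x. \<integral>\<^sup>+y. ennreal \<bar>k (x - y)\<bar> * ennreal ((norm (\<psi> y))\<^sup>2) \<partial>lborel \<partial>lborel) + (\<integral>\<^sup>+x. \<integral>\<^sup>+y. ennreal \<bar>k (x - y)\<bar> * ennreal ((norm (u x))\<^sup>2) \<partial>lborel \<partial>lborel)"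
      by (rule nn_integral_add) measurable
    also have "\<dots> < \<infinity>"
      using fin nn_integral_conv_right[of "\<lambda>x. ennreal \<bar>k x\<bar>" "\<lambda>x. ennreal ((norm (\<psi> x))\<^sup>2)"]
        nn_integral_conv_left[of "\<lambda>x. ennreal \<bar>k x\<bar>" "\<lambda>x. ennreal ((norm (u x))\<^sup>2)"]
      by (simp add: ennreal_mult_less_top)
    finally show "(\<integral>\<^sup>+z. ennreal (norm (f z)) \<partial>(lborel \<Otimes>\<^sub>M lborel)) < \<infinity>" .
  qed measurable
  have "L2inner (conv k \<psi>) u = (\<integral>x. \<integral>y. f (x, y) \<partial>lborel \<partial>lborel)"
    unfolding L2inner_def conv_def f_def by simp
  also have "\<dots> = (\<integral>y. \<integral>x. f (x, y) \<partial>lborel \<partial>lborel)"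
    using lborel_pair.Fubini_integral[of "\<lambda>x y. f (x, y)"] int by simp
  also have "\<dots> = L2inner \<psi> (conv (\<lambda>z. k (- z)) u)"
    unfolding L2inner_def conv_def f_def integral_cnj[symmetric]
    by (simp flip: Bochner_Integration.integral_cnj integral_mult_right_zero add: mult_ac)
  finally show ?thesis .
qed

text \<open>Only the radius of the support is recorded, not the shape. One \<delta> therefore covers
  all anisotropic bump kernels with both scales small.\<close>

definition mollifier :: "real \<Rightarrow> ('p::euclidean_space \<Rightarrow> real) \<Rightarrow> bool" where
  "mollifier \<delta> k \<longleftrightarrow> smooth k \<and> (\<forall>x. 0 \<le> k x) \<and> integrable lborel k \<and> (\<integral>x. k x \<partial>lborel) = 1 \<and> (\<forall>x. \<delta> < norm x \<longrightarrow> k x = 0)"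

lemma uniformly_continuous_compact_support:
  fixes g :: "'p::euclidean_space \<Rightarrow> complex"
  assumes g: "continuous_on UNIV g" and supp: "\<And>x. M < norm x \<Longrightarrow> g x = 0" and e: "e > 0"
  obtains \<delta> where "\<delta> > 0" "\<And>x y. norm (x - y) \<le> \<delta> \<Longrightarrow> norm (g x - g y) < e"
proof -
  have "uniformly_continuous_on (cball 0 (M + 1)) g"
    by (intro compact_uniformly_continuous continuous_on_subset[OF g]) auto
  then obtain d where d: "d > 0" "\<And>x y. x \<in> cball 0 (M + 1) \<Longrightarrow> y \<in> cball 0 (M + 1) \<Longrightarrow> dist y x < d \<Longrightarrow> dist (g y) (g x) < e"
    unfolding uniformly_continuous_on_def using e by metis
  have "norm (g x - g y) < e" if xy: "norm (x - y) \<le> min (d / 2) 1" for x y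
  proof (cases "norm x \<le> M + 1 \<and> norm y \<le> M + 1")
    case True
    then show ?thesis using d(2)[of y x] xy d(1) by (auto simp: dist_norm)
  next
    case False
    then have "M < norm x" "M < norm y"
      using norm_triangle_ineq2[of x y] norm_triangle_ineq2[of y x] xy by (auto simp: norm_minus_commute)
    then show ?thesis using supp e by simp
  qed
  then show ?thesis using that[of "min (d / 2) 1"] d(1) by auto
qed

lemma continuous_compact_support_L2:
  fixes g :: "'p::euclidean_space \<Rightarrow> complex"
  assumes g: "continuous_on UNIV g" and supp: "\<And>x. M < norm x \<Longrightarrow> g x = 0"
  shows "g \<in> L2"
proof -
  obtain B where B: "B > 0" "\<And>x. norm (g x) \<le> B"
    using continuous_compact_support_bounded[OF g supp] by metis
  show ?thesis
  proof (rule L2_bound[OF L2_indicator[of M]])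
    show "norm (g x) \<le> B * norm (indicator (cball 0 M) x :: complex)" for x
      using B supp[of x] by (cases "norm x \<le> M") (auto simp: indicator_def)
  qed (rule borel_measurable_continuous_onI[OF g])
qed

text \<open>The threshold depends on g and e but not on the kernel, so the kernel may still be
  chosen afterwards.\<close>

lemma mollify_continuous:
  fixes g :: "'p::euclidean_space \<Rightarrow> complex"
  assumes g: "continuous_on UNIV g" and supp: "\<And>x. M < norm x \<Longrightarrow> g x = 0" and e: "e > 0"
  obtains \<delta> where "\<delta> > 0" "\<And>k. mollifier \<delta> k \<Longrightarrow> L2norm (\<lambda>x. conv k g x - g x) < e"
proof -
  define N where "N = L2norm (\<lambda>x::'p. indicator (cball 0 (M + 1)) x)"
  have N0: "N \<ge> 0" by (simp add: N_def)
  \<comment> \<open>A uniform error w on the ball of radius M + 1 has L2 norm w N, which is below e;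
    the summand 1 avoids division by zero.\<close>
  define w where "w = e / (2 * (N + 1))"
  have w0: "w > 0" using e N0 by (simp add: w_def)
  obtain d where d: "d > 0" "\<And>x y. norm (x - y) \<le> d \<Longrightarrow> norm (g x - g y) < w"
    using uniformly_continuous_compact_support[OF g supp w0] by metis
  have gL: "g \<in> L2" by (rule continuous_compact_support_L2[OF g]) (rule supp)
  have "L2norm (\<lambda>x. conv k g x - g x) < e" if k: "mollifier (min d 1) k" for k
  proof -
    have ks: "smooth k" and k0: "\<And>x. 0 \<le> k x" and kint: "integrable lborel k" and k1: "(\<integral>x. k x \<partial>lborel) = 1"
      and ksupp: "\<And>x. min d 1 < norm x \<Longrightarrow> k x = 0"
      using k by (auto simp: mollifier_def)
    have [measurable]: "k \<in> borel_measurable borel" "g \<in> borel_measurable borel"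
      using kint L2_measurable[OF gL] by auto
    have shift_int: "integrable lborel (\<lambda>y. complex_of_real (k (x - y)))" "(\<integral>y. complex_of_real (k (x - y)) \<partial>lborel) = 1"
      "integrable lborel (\<lambda>y. k (x - y))" "(\<integral>y. k (x - y) \<partial>lborel) = 1" for x
    proof -
      have nn: "(\<integral>\<^sup>+y. ennreal (k (x - y)) \<partial>lborel) = 1"
        using nn_integral_lborel_reflect[of "\<lambda>y. ennreal (k y)" x] nn_integral_eq_integral[OF kint] k0 k1 by simp
      show i: "integrable lborel (\<lambda>y. k (x - y))"
        by (rule integrableI_bounded) (use nn k0 in auto)
      then show "integrable lborel (\<lambda>y. complex_of_real (k (x - y)))" by simp
      show v: "(\<integral>y. k (x - y) \<partial>lborel) = 1"
        using nn nn_integral_eq_integral[OF i] k0 by simp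
      then show "(\<integral>y. complex_of_real (k (x - y)) \<partial>lborel) = 1" by simp
    qed
    have cint: "integrable lborel (\<lambda>y. complex_of_real (k (x - y)) * g y)" for x
      by (rule conv_integrable[OF L2_locint[OF gL] smooth_continuous[OF ks]]) (rule ksupp)
    have "norm (conv k g x - g x) \<le> norm (complex_of_real w * indicator (cball 0 (M + 1)) x)" for x
    proof (cases "norm x \<le> M + 1")
      case True
      have "conv k g x - g x = (\<integral>y. complex_of_real (k (x - y)) * g y - complex_of_real (k (x - y)) * g x \<partial>lborel)"
        unfolding conv_def using cint shift_int by simp
      also have "\<dots> = (\<integral>y. complex_of_real (k (x - y)) * (g y - g x) \<partial>lborel)"
        by (simp add: algebra_simps)
      also have "norm \<dots> \<le> (\<integral>y. w * k (x - y) \<partial>lborel)"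
      proof (rule Bochner_Integration.integral_norm_bound_integral)
        show "integrable lborel (\<lambda>y. complex_of_real (k (x - y)) * (g y - g x))"
          using Bochner_Integration.integrable_diff[OF cint integrable_mult_left[OF shift_int(1)], of x x "g x"]
          by (simp add: algebra_simps)
        show "integrable lborel (\<lambda>y. w * k (x - y))" using shift_int by simp
        fix y
        show "norm (complex_of_real (k (x - y)) * (g y - g x)) \<le> w * k (x - y)"
        proof (cases "norm (x - y) \<le> d")
          case True
          then have "norm (g y - g x) \<le> w" using d(2)[of x y] by (simp add: norm_minus_commute)
          then show ?thesis using k0[of "x - y"] mult_right_mono[of "norm (g y - g x)" w "k (x - y)"]
            by (simp add: norm_mult mult.commute)
        qed (use ksupp[of "x - y"] in simp)
      qed
      also have "\<dots> = w" using shift_int by simp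
      finally show ?thesis using True w0 by simp
    next
      case False
      then have "conv k g x = 0" by (intro conv_zero_outside[of "min d 1" k M g x]) (auto intro: ksupp supp)
      moreover have "g x = 0" using False by (intro supp) simp
      ultimately show ?thesis by simp
    qed
    then have "L2norm (\<lambda>x. conv k g x - g x) \<le> L2norm (\<lambda>x::'p. complex_of_real w * indicator (cball 0 (M + 1)) x)"
      using conv_L2[OF gL kint order_refl] gL by (intro L2norm_mono L2_scale L2_indicator L2_diff) auto
    also have "\<dots> = w * N" unfolding L2norm_scale N_def using w0 by simp
    also have "\<dots> < e" using e N0 by (simp add: w_def divide_less_eq add_nonneg_pos algebra_simps)
    finally show ?thesis .
  qed
  then show ?thesis using that[of "min d 1"] d(1) by auto
qed

section \<open>Density of continuous functions in L2\<close>

lemma L2_truncate: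
  assumes f: "f \<in> L2" and e: "e > 0"
  obtains m :: nat where "m > 0" "L2norm (\<lambda>x. (if norm x \<le> real m \<and> norm (f x) \<le> real m then f x else 0) - f x) < e"
proof -
  note [measurable] = L2_measurable[OF f]
  have "(\<lambda>m. L2norm (\<lambda>x. (if norm x \<le> real m \<and> norm (f x) \<le> real m then f x else 0) - f x)) \<longlonglongrightarrow> 0"
  proof (rule L2norm_dominated_convergence[OF _ L2_integrable_sq[OF f]])
    show "AE x in lborel. (norm ((if norm x \<le> real m \<and> norm (f x) \<le> real m then f x else 0) - f x))\<^sup>2 \<le> (norm (f x))\<^sup>2" for m
      by auto
    show "AE x in lborel. (\<lambda>m. (if norm x \<le> real m \<and> norm (f x) \<le> real m then f x else 0) - f x) \<longlonglongrightarrow> 0"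
    proof (rule AE_I2)
      fix x
      obtain N :: nat where N: "max (norm x) (norm (f x)) \<le> real N" using real_arch_simple by blast
      show "(\<lambda>m. (if norm x \<le> real m \<and> norm (f x) \<le> real m then f x else 0) - f x) \<longlonglongrightarrow> 0"
        by (rule tendsto_eventually, rule eventually_mono[OF eventually_ge_at_top[of N]]) (use N in auto)
    qed
  qed measurable
  then have "\<forall>\<^sub>F m in sequentially. L2norm (\<lambda>x. (if norm x \<le> real m \<and> norm (f x) \<le> real m then f x else 0) - f x) < e"
    using e by (rule order_tendstoD)
  then obtain m where "m > 0" "L2norm (\<lambda>x. (if norm x \<le> real m \<and> norm (f x) \<le> real m then f x else 0) - f x) < e"
    using eventually_happens'[OF sequentially_bot eventually_conj[OF eventually_gt_at_top[of 0]]] by blast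
  then show ?thesis using that by blast
qed

text \<open>\<open>measurable_on\<close> supplies continuous functions converging almost everywhere.
  Clipping their values to norm m and cutting them off outside radius m + 1 leaves the limit f
  unchanged and gives a common majorant for dominated convergence.\<close>

lemma L2_dense_bounded:
  fixes f :: "'p::euclidean_space \<Rightarrow> complex"
  assumes f [measurable]: "f \<in> borel_measurable borel" and fb: "\<And>x. norm (f x) \<le> m" and supp: "\<And>x. m < norm x \<Longrightarrow> f x = 0"
    and m: "m > 0" and e: "e > 0"
  obtains g where "continuous_on UNIV g" "\<And>x. m + 1 < norm x \<Longrightarrow> g x = 0" "L2norm (\<lambda>x. g x - f x) < e"
proof -
  have "f measurable_on UNIV"
    by (rule lebesgue_measurable_imp_measurable_on) (use f in \<open>auto intro: measurable_completion\<close>)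
  then obtain N g where N: "negligible N" and g: "\<And>n. continuous_on UNIV (g n)" and lim: "\<And>x. x \<notin> N \<Longrightarrow> (\<lambda>n. g n x) \<longlonglongrightarrow> f x"
    unfolding measurable_on_def by auto
  define clip where "clip = (\<lambda>z::complex. (m / max m (norm z)) *\<^sub>R z)"
  define cut where "cut = (\<lambda>x::'p. max 0 (min 1 (m + 1 - norm x)))"
  define h where "h = (\<lambda>n x. cut x *\<^sub>R clip (g n x))"
  have clip_cont: "continuous_on UNIV clip"
    unfolding clip_def using m by (intro continuous_intros) auto
  have clip_le: "norm (clip z) \<le> m" for z
    using m by (auto simp: clip_def max_def field_simps)
  have clip_id: "norm z \<le> m \<Longrightarrow> clip z = z" for z
    using m by (simp add: clip_def max_def)
  have cut_cont: "continuous_on UNIV cut" unfolding cut_def by (intro continuous_intros)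
  have cut_bounds: "0 \<le> cut x" "cut x \<le> 1" for x by (auto simp: cut_def)
  have h_cont: "continuous_on UNIV (h n)" for n
    unfolding h_def by (intro continuous_intros cut_cont continuous_on_compose2[OF clip_cont g]) auto
  have h0: "m + 1 < norm x \<Longrightarrow> h n x = 0" for n x by (simp add: h_def cut_def)
  have hb: "norm (h n x) \<le> m" for n x
    using cut_bounds[of x] mult_mono[of "cut x" 1 "norm (clip (g n x))" m] clip_le[of "g n x"] by (simp add: h_def)
  note [measurable] = borel_measurable_continuous_onI[OF h_cont]
  have "(\<lambda>n. L2norm (\<lambda>x. h n x - f x)) \<longlonglongrightarrow> 0"
  proof (rule L2norm_dominated_convergence)
    show "integrable lborel (\<lambda>x. (2 * m)\<^sup>2 * (norm (indicator (cball 0 (m + 1)) x :: complex))\<^sup>2 :: real)"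
      by (intro integrable_mult_right L2_integrable_sq L2_indicator)
    have "(norm (h n x - f x))\<^sup>2 \<le> (2 * m)\<^sup>2 * (norm (indicator (cball 0 (m + 1)) x :: complex))\<^sup>2" for n x
    proof (cases "norm x \<le> m + 1")
      case True
      have "norm (h n x - f x) \<le> 2 * m" using norm_triangle_ineq4[of "h n x" "f x"] hb[of n x] fb[of x] by simp
      then show ?thesis using True power_mono[of "norm (h n x - f x)" "2 * m" 2] by simp
    next
      case False
      then show ?thesis using h0[of x n] supp[of x] by simp
    qed
    then show "AE x in lborel. (norm (h n x - f x))\<^sup>2 \<le> (2 * m)\<^sup>2 * (norm (indicator (cball 0 (m + 1)) x :: complex))\<^sup>2" for n
      by simp
    have "AE x in lebesgue. x \<notin> N"
      using N by (intro AE_not_in) (simp add: negligible_iff_null_sets)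
    then have "AE x in lborel. x \<notin> N" by (simp add: AE_completion_iff)
    then show "AE x in lborel. (\<lambda>n. h n x - f x) \<longlonglongrightarrow> 0"
    proof eventually_elim
      case (elim x)
      have "isCont clip (f x)" using clip_cont by (simp add: continuous_on_eq_continuous_at)
      from isCont_tendsto_compose[OF this lim[OF elim]]
      have "(\<lambda>n. clip (g n x)) \<longlonglongrightarrow> f x" using clip_id[OF fb[of x]] by simp
      then have "(\<lambda>n. h n x) \<longlonglongrightarrow> cut x *\<^sub>R f x" unfolding h_def by (intro tendsto_intros)
      moreover have "cut x *\<^sub>R f x = f x" using supp[of x] by (cases "norm x \<le> m") (auto simp: cut_def)
      ultimately show ?case by (simp add: LIM_zero)
    qed
  qed measurable
  then have "\<forall>\<^sub>F n in sequentially. L2norm (\<lambda>x. h n x - f x) < e"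
    using e by (rule order_tendstoD)
  then obtain n where "L2norm (\<lambda>x. h n x - f x) < e"
    using eventually_happens'[OF sequentially_bot] by blast
  then show ?thesis using that[OF h_cont h0] by blast
qed

lemma L2_dense_continuous:
  fixes f :: "'p::euclidean_space \<Rightarrow> complex"
  assumes f: "f \<in> L2" and e: "e > 0"
  obtains g M where "continuous_on UNIV g" "\<And>x. M < norm x \<Longrightarrow> g x = 0" "L2norm (\<lambda>x. g x - f x) < e"
proof -
  note [measurable] = L2_measurable[OF f]
  obtain m :: nat where m: "m > 0" "L2norm (\<lambda>x. (if norm x \<le> real m \<and> norm (f x) \<le> real m then f x else 0) - f x) < e / 2"
    using L2_truncate[OF f, of "e / 2"] e by auto
  define f' where "f' = (\<lambda>x. if norm x \<le> real m \<and> norm (f x) \<le> real m then f x else 0)"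
  have [measurable]: "f' \<in> borel_measurable borel" unfolding f'_def by measurable
  have f'L: "f' \<in> L2" by (rule L2_bound[OF f, where C = 1]) (auto simp: f'_def)
  obtain g where g: "continuous_on UNIV g" "\<And>x. real m + 1 < norm x \<Longrightarrow> g x = 0" "L2norm (\<lambda>x. g x - f' x) < e / 2"
    by (rule L2_dense_bounded[of f' "real m" "e / 2"]) (use m(1) e in \<open>auto simp: f'_def\<close>)
  have "g \<in> L2" by (rule continuous_compact_support_L2[OF g(1)]) (rule g(2))
  then have "L2norm (\<lambda>x. g x - f x) < e"
    using L2norm_triangle_diff[OF _ f'L f, of g] g(3) m(2) by (simp add: f'_def)
  then show ?thesis using that[OF g(1) g(2)] by blast
qed

text \<open>Three-term estimate: mollification is a contraction on L2, so a continuous approximant g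
  may replace f on both sides. The threshold \<delta> is again independent of the kernel.\<close>

lemma mollify_L2:
  fixes f :: "'p::euclidean_space \<Rightarrow> complex"
  assumes f: "f \<in> L2" and e: "e > 0"
  obtains \<delta> where "\<delta> > 0" "\<And>k. mollifier \<delta> k \<Longrightarrow> L2norm (\<lambda>x. conv k f x - f x) < e"
proof -
  obtain g M where g: "continuous_on UNIV g" "\<And>x. M < norm x \<Longrightarrow> g x = 0" "L2norm (\<lambda>x. g x - f x) < e / 3"
    using L2_dense_continuous[OF f, of "e / 3"] e by auto
  have gL: "g \<in> L2" by (rule continuous_compact_support_L2[OF g(1)]) (rule g(2))
  obtain \<delta> where \<delta>: "\<delta> > 0" "\<And>k. mollifier \<delta> k \<Longrightarrow> L2norm (\<lambda>x. conv k g x - g x) < e / 3"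
    by (rule mollify_continuous[of g M "e / 3"]) (use g e in auto)
  have "L2norm (\<lambda>x. conv k f x - f x) < e" if k: "mollifier \<delta> k" for k
  proof -
    have kint: "integrable lborel k" and ks: "continuous_on UNIV k" and ksupp: "\<And>x. \<delta> < norm x \<Longrightarrow> k x = 0"
      and k1: "(\<integral>x. \<bar>k x\<bar> \<partial>lborel) \<le> 1"
      using k by (auto simp: mollifier_def smooth_continuous)
    have ci: "integrable lborel (\<lambda>y. complex_of_real (k (x - y)) * h y)" if "h \<in> L2" for h x
      by (rule conv_integrable[OF L2_locint[OF that] ks]) (rule ksupp)
    have "conv k (\<lambda>x. f x - g x) = (\<lambda>x. conv k f x - conv k g x)"
      unfolding conv_def using ci[OF f] ci[OF gL] by (simp add: right_diff_distrib)
    then have "L2norm (\<lambda>x. conv k f x - conv k g x) \<le> 1 * L2norm (\<lambda>x. f x - g x)"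
      using conv_L2(2)[OF L2_diff[OF f gL] kint k1] by simp
    then have 1: "L2norm (\<lambda>x. conv k f x - conv k g x) < e / 3"
      using g(3) L2norm_minus_commute[of f g] by simp
    note L = conv_L2(1)[OF f kint k1] conv_L2(1)[OF gL kint k1]
    have "L2norm (\<lambda>x. conv k f x - f x) \<le> L2norm (\<lambda>x. conv k f x - conv k g x) + L2norm (\<lambda>x. conv k g x - f x)"
      by (rule L2norm_triangle_diff[OF L f])
    also have "L2norm (\<lambda>x. conv k g x - f x) \<le> L2norm (\<lambda>x. conv k g x - g x) + L2norm (\<lambda>x. g x - f x)"
      by (rule L2norm_triangle_diff[OF L(2) gL f])
    finally show ?thesis using 1 \<delta>(2)[OF k] g(3) by simp
  qed
  then show ?thesis using that \<delta>(1) by blast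
qed

section \<open>Bump functions and an energy identity\<close>

lemma emeasure_ball_times:
  fixes x :: "'x::euclidean_space" and y :: "'y::euclidean_space"
  assumes "0 \<le> a" "0 \<le> b"
  shows "emeasure lborel (ball x a \<times> ball y b)
    = ennreal (unit_ball_vol DIM('x) * unit_ball_vol DIM('y) * a ^ DIM('x) * b ^ DIM('y))"
proof -
  have "emeasure lborel (ball x a \<times> ball y b) = emeasure lborel (ball x a) * emeasure lborel (ball y b)"
    unfolding lborel_prod[symmetric] by (rule lborel.emeasure_pair_measure_Times) auto
  then show ?thesis
    using assms by (simp add: emeasure_ball ac_simps flip: ennreal_mult)
qed

lemma Dd_zero_open:
  assumes "open U" "\<And>x. x \<in> U \<Longrightarrow> f x = 0" "x \<in> U"
  shows "Dd f v x = 0"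
proof (rule Dd_eqI[of f "\<lambda>_. 0"])
  show "(f has_derivative (\<lambda>_. 0)) (at x)"
  proof (rule has_derivative_transform_within_open)
    show "open U" by fact
  qed (use assms in auto)
qed

lemma Ditr_zero_open:
  assumes "open U" "\<And>x. x \<in> U \<Longrightarrow> f x = 0" "x \<in> U"
  shows "Ditr vs f x = 0"
  using assms(3) by (induction vs arbitrary: x) (auto intro: assms(2) Dd_zero_open[OF assms(1)])

lemma Dd_cmult:
  fixes f :: "'p::real_normed_vector \<Rightarrow> real"
  assumes "f differentiable (at x)"
  shows "Dd (\<lambda>z. c * f z) v x = c * Dd f v x"
  by (rule Dd_eqI) (auto intro!: derivative_eq_intros has_derivative_Dd[OF assms])

lemma smooth_cmult:
  fixes f :: "'p::real_normed_vector \<Rightarrow> real"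
  assumes "smooth f" shows "smooth (\<lambda>z. c * f z)"
proof (rule smooth_coinduct[where P = "\<lambda>g. \<exists>f. smooth f \<and> g = (\<lambda>z. c * f z)"])
  show "\<exists>f'. smooth f' \<and> Dd g v = (\<lambda>z. c * f' z)" if "\<exists>f. smooth f \<and> g = (\<lambda>z. c * f z)" for g v
    using that Dd_cmult smooth_differentiable smooth_Dd by (metis (no_types, lifting) ext)
  show "g differentiable (at x)" if "\<exists>f. smooth f \<and> g = (\<lambda>z. c * f z)" for g x
    using that smooth_differentiable by (auto intro!: derivative_intros)
qed (use assms in auto)

lemma Ditr_cmult:
  fixes f :: "'p::real_normed_vector \<Rightarrow> real"
  assumes "smooth f"
  shows "Ditr vs (\<lambda>z. c * f z) = (\<lambda>z. c * Ditr vs f z)"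
proof (induction vs)
  case (Cons v vs)
  have "Dd (\<lambda>z. c * Ditr vs f z) v = (\<lambda>z. c * Dd (Ditr vs f) v z)"
    by (rule ext, rule Dd_cmult[OF smooth_differentiable[OF smooth_Ditr[OF assms]]])
  then show ?case using Cons by simp
qed simp

text \<open>A reflection changes the sign of each first derivative, and two sign changes cancel.
  Evenness makes convolution with second derivatives of the mollifier symmetric on L2.\<close>

lemma Ditr2_even:
  fixes f :: "'p::real_normed_vector \<Rightarrow> real"
  assumes f: "smooth f" and even: "\<And>z. f (- z) = f z"
  shows "Ditr [v, v] f (- z) = Ditr [v, v] f z"
proof -
  have bl: "bounded_linear (uminus :: 'p \<Rightarrow> 'p)" by (rule bounded_linear_minus[OF bounded_linear_ident])
  have neg: "Dd g (- v) x = - Dd g v x" if "smooth g" for g :: "'p \<Rightarrow> real" and x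
    using Dd_scale[OF smooth_differentiable[OF that, of x], of "-1" v] by simp
  have "Dd (\<lambda>z. f (- z)) v z = Dd f (- v) (- z)" for z
    by (rule Dd_compose_linear[OF bl smooth_differentiable[OF f]])
  then have odd: "Dd f v (- z) = - Dd f v z" for z
    unfolding even neg[OF f] by (metis minus_minus)
  have "- Dd (Dd f v) v (- z) = Dd (\<lambda>z. Dd f v (- z)) v z"
    unfolding Dd_compose_linear[OF bl smooth_differentiable[OF smooth_Dd[OF f]]] by (rule neg[OF smooth_Dd[OF f], symmetric])
  also have "\<dots> = Dd (\<lambda>z. - 1 * Dd f v z) v z" by (simp only: odd mult_minus_left mult_1)
  also have "\<dots> = - 1 * Dd (Dd f v) v z"
    by (rule Dd_cmult[OF smooth_differentiable[OF smooth_Dd[OF f]]])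
  finally show ?thesis by simp
qed

lemma Ditr_bump_scale:
  fixes v z :: "'x::euclidean_space \<times> 'y::euclidean_space"
  shows "Ditr vs (bump s t) z = Ditr (map (\<lambda>v. (s *\<^sub>R fst v, t *\<^sub>R snd v)) vs) (bump 1 1) (s *\<^sub>R fst z, t *\<^sub>R snd z)"
proof (induction vs arbitrary: z)
  case Nil
  then show ?case by (simp add: bump_scale[of s t])
next
  case (Cons v vs)
  have bl: "bounded_linear (\<lambda>z::'x \<times> 'y. (s *\<^sub>R fst z, t *\<^sub>R snd z))"
    by (intro bounded_linear_Pair bounded_linear_scaleR_right bounded_linear_compose[OF bounded_linear_scaleR_right]
        bounded_linear_fst bounded_linear_snd)
  have "Ditr vs (bump s t) = (\<lambda>z. Ditr (map (\<lambda>v. (s *\<^sub>R fst v, t *\<^sub>R snd v)) vs) (bump 1 1) (s *\<^sub>R fst z, t *\<^sub>R snd z))"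
    using Cons.IH by blast
  then show ?case
    using Dd_compose_linear[OF bl smooth_differentiable[OF smooth_Ditr[OF smooth_bump]], of "map (\<lambda>v. (s *\<^sub>R fst v, t *\<^sub>R snd v)) vs" 1 1 v z]
    by simp
qed

lemma integrable_continuous_compact_support:
  fixes f :: "'p::euclidean_space \<Rightarrow> 'c::euclidean_space"
  assumes f: "continuous_on UNIV f" and supp: "\<And>x. M < norm x \<Longrightarrow> f x = 0"
  shows "integrable lborel f"
proof -
  obtain B where B: "B > 0" "\<And>x. norm (f x) \<le> B"
    using continuous_compact_support_bounded[OF f supp] by metis
  have "integrable lborel (\<lambda>x::'p. indicator (cball 0 M) x *\<^sub>R B)"
    using emeasure_lborel_cball_finite[of "0::'p" M] by (intro integrable_scaleR_left) simp
  then show ?thesis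
  proof (rule Bochner_Integration.integrable_bound)
    show "AE x in lborel. norm (f x) \<le> norm (indicator (cball 0 M) x *\<^sub>R B)"
    proof (rule AE_I2)
      show "norm (f x) \<le> norm (indicator (cball 0 M) x *\<^sub>R B)" for x
        using B supp[of x] by (cases "norm x \<le> M") auto
    qed
  qed (use borel_measurable_continuous_onI[OF f] in simp)
qed

definition bump_mass :: "('x::euclidean_space \<times> 'y::euclidean_space) itself \<Rightarrow> real \<Rightarrow> real \<Rightarrow> real" where
  "bump_mass _ s t = (\<integral>z. bump s t (z::'x \<times> 'y) \<partial>lborel)"

definition bump_kernel :: "real \<Rightarrow> real \<Rightarrow> 'x::euclidean_space \<times> 'y::euclidean_space \<Rightarrow> real" where
  "bump_kernel s t z = inverse (bump_mass TYPE('x \<times> 'y) s t) * bump s t z"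

lemma bump_integrable:
  "s > 0 \<Longrightarrow> t > 0 \<Longrightarrow> integrable lborel (bump s t :: 'x::euclidean_space \<times> 'y::euclidean_space \<Rightarrow> real)"
  by (rule integrable_continuous_compact_support[OF smooth_continuous[OF smooth_bump]]) (rule bump_support)

text \<open>On the box of half size each argument of \<open>flat\<close> is at least 3/4, so each
  factor is at least exp(-4/3).\<close>

lemma bump_ge:
  assumes "s > 0" "t > 0" "norm (fst z) < 1 / (2 * s)" "norm (snd z) < 1 / (2 * t)"
  shows "exp (- 8 / 3) \<le> bump s t z"
proof -
  have "exp (- 4 / 3) \<le> flat 1 (1 - r\<^sup>2 * x\<^sup>2)" if "r > 0" "0 \<le> x" "x < 1 / (2 * r)" for r x :: real
  proof -
    have "r * x \<le> 1 / 2" using that by (simp add: field_simps)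
    then have "(r * x)\<^sup>2 \<le> (1 / 2)\<^sup>2" using that by (intro power_mono) auto
    then have "r\<^sup>2 * x\<^sup>2 \<le> 1 / 4" by (simp add: power_mult_distrib power_divide)
    then have *: "3 / 4 \<le> 1 - r\<^sup>2 * x\<^sup>2" by simp
    then have "1 / (1 - r\<^sup>2 * x\<^sup>2) \<le> 4 / 3" by (simp add: field_simps)
    then show ?thesis using * by (simp add: flat_def)
  qed
  then have "exp (- 4 / 3) * exp (- 4 / 3) \<le> bump s t z"
    unfolding bump_def using assms by (intro mult_mono) (auto simp: flat1_bounds)
  then show ?thesis by (simp flip: exp_add)
qed

text \<open>The mass is at least a constant times the volume of the half-size box, hence scales in s
  and t like the volume of the support.\<close>

lemma bump_mass_ge:
  assumes "s > 0" "t > 0"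
  shows "exp (- 8 / 3) * (unit_ball_vol DIM('x) * unit_ball_vol DIM('y) * (1 / (2 * s)) ^ DIM('x) * (1 / (2 * t)) ^ DIM('y))
    \<le> bump_mass TYPE('x::euclidean_space \<times> 'y::euclidean_space) s t" (is "_ * ?v \<le> _")
proof -
  let ?B = "ball 0 (1 / (2 * s)) \<times> ball 0 (1 / (2 * t)) :: ('x \<times> 'y) set"
  have v: "emeasure lborel ?B = ennreal ?v"
    using assms by (intro emeasure_ball_times) auto
  have [measurable]: "?B \<in> sets borel" by (intro borel_open open_Times) auto
  have "exp (- 8 / 3) * ?v = (\<integral>z. indicator ?B z * exp (- 8 / 3) \<partial>lborel)"
    using v assms by (simp add: measure_def)
  also have "\<dots> \<le> (\<integral>z. bump s t (z :: 'x \<times> 'y) \<partial>lborel)"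
  proof (rule Bochner_Integration.integral_mono)
    show "integrable lborel (\<lambda>z::'x \<times> 'y. indicator ?B z * exp (- 8 / 3) :: real)"
      by (intro integrable_mult_left integrable_real_indicator) (auto simp: v)
    show "indicator ?B z * exp (- 8 / 3) \<le> bump s t z" for z :: "'x \<times> 'y"
      using bump_ge[OF assms, of z] bump_nonneg[of s t z] by (auto simp: indicator_def mem_Times_iff)
  qed (rule bump_integrable[OF assms])
  finally show ?thesis by (simp add: bump_mass_def)
qed

lemma bump_mass_pos: "s > 0 \<Longrightarrow> t > 0 \<Longrightarrow> 0 < bump_mass TYPE('x::euclidean_space \<times> 'y::euclidean_space) s t"
  by (rule less_le_trans[OF _ bump_mass_ge]) auto

lemma smooth_bump_kernel: "smooth (bump_kernel s t)"
  unfolding bump_kernel_def[abs_def] by (rule smooth_cmult[OF smooth_bump])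

lemma bump_kernel_even: "bump_kernel s t (- z) = bump_kernel s t z"
  by (simp add: bump_kernel_def bump_def)

lemma mollifier_bump_kernel:
  assumes "s > 0" "t > 0" "1 / s + 1 / t \<le> \<delta>"
  shows "mollifier \<delta> (bump_kernel s t :: 'x::euclidean_space \<times> 'y::euclidean_space \<Rightarrow> real)"
  unfolding mollifier_def
proof (intro conjI allI impI)
  show "integrable lborel (bump_kernel s t :: 'x \<times> 'y \<Rightarrow> real)"
    unfolding bump_kernel_def[abs_def] by (intro integrable_mult_right bump_integrable[OF assms(1,2)])
  show "(\<integral>x. bump_kernel s t (x :: 'x \<times> 'y) \<partial>lborel) = 1"
    unfolding bump_kernel_def[abs_def] using bump_mass_pos[OF assms(1,2), where 'x = 'x and 'y = 'y] by (simp add: bump_mass_def)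
  show "0 \<le> bump_kernel s t (x :: 'x \<times> 'y)" for x
    using bump_mass_pos[OF assms(1,2), where 'x = 'x and 'y = 'y] bump_nonneg[of s t x] by (simp add: bump_kernel_def less_imp_le)
  show "bump_kernel s t x = 0" if "\<delta> < norm x" for x :: "'x \<times> 'y"
    using bump_support[OF assms(1,2), of x] that assms(3) by (simp add: bump_kernel_def)
qed (rule smooth_bump_kernel)

lemma Ditr_bump_kernel_zero:
  fixes z :: "'x::euclidean_space \<times> 'y::euclidean_space"
  assumes "s > 0" "t > 0" "1 / s < norm (fst z) \<or> 1 / t < norm (snd z)"
  shows "Ditr vs (bump_kernel s t) z = 0"
proof (rule Ditr_zero_open)
  show "open {z :: 'x \<times> 'y. 1 / s < norm (fst z) \<or> 1 / t < norm (snd z)}"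
    by (intro open_Collect_disj open_Collect_less continuous_intros)
  show "bump_kernel s t x = 0" if "x \<in> {z. 1 / s < norm (fst z) \<or> 1 / t < norm (snd z)}" for x :: "'x \<times> 'y"
    using that bump_eq_0[OF assms(1,2), of x] by (auto simp: bump_kernel_def)
qed (use assms in simp)

text \<open>Rescaling gives a factor t for each vertical derivative, while support volume and mass
  cancel up to a constant. The essential point is that the bound is independent of s.\<close>

lemma bump_kernel_second_derivative_L1:
  fixes w :: "'y::euclidean_space"
  obtains A where "A > 0" "\<And>s t. s > 0 \<Longrightarrow> t > 0 \<Longrightarrow>
    (\<integral>z. \<bar>Ditr [(0, w), (0, w)] (bump_kernel s t) (z :: 'x::euclidean_space \<times> 'y)\<bar> \<partial>lborel) \<le> A * t\<^sup>2"
proof -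
  let ?n = "DIM('x) + DIM('y)"
  define D where "D = Ditr [(0, w), (0, w)] (bump 1 1 :: 'x \<times> 'y \<Rightarrow> real)"
  have "\<And>x. 2 < norm x \<Longrightarrow> D x = 0"
    unfolding D_def by (rule Ditr_zero_outside[of 2]) (auto intro: bump_support)
  then obtain B where B: "B > 0" "\<And>x. norm (D x) \<le> B"
    using continuous_compact_support_bounded[of D 2] smooth_continuous[OF smooth_Ditr[OF smooth_bump]] D_def by metis
  define A where "A = B * 4 ^ ?n * exp (8 / 3)"
  have "(\<integral>z. \<bar>Ditr [(0, w), (0, w)] (bump_kernel s t) (z :: 'x \<times> 'y)\<bar> \<partial>lborel) \<le> A * t\<^sup>2" if st: "s > 0" "t > 0" for s t
  proof -
    define m where "m = bump_mass TYPE('x \<times> 'y) s t"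
    have m: "m > 0" unfolding m_def by (rule bump_mass_pos[OF st])
    \<comment> \<open>These radii are four times those in the lower bound for the mass, which is
      where \<open>4 ^ ?n\<close> comes from; the enlargement also puts the closed support inside an
      open box.\<close>
    let ?B = "ball 0 (2 / s) \<times> ball 0 (2 / t) :: ('x \<times> 'y) set"
    define v where "v = unit_ball_vol DIM('x) * unit_ball_vol DIM('y) * (2 / s) ^ DIM('x) * (2 / t) ^ DIM('y)"
    have v: "emeasure lborel ?B = ennreal v" and v0: "v \<ge> 0"
      unfolding v_def using st by (auto intro!: emeasure_ball_times)
    have [measurable]: "?B \<in> sets borel" by (intro borel_open open_Times) auto
    define c where "c = unit_ball_vol DIM('x) * unit_ball_vol DIM('y) * (1 / (2 * s)) ^ DIM('x) * (1 / (2 * t)) ^ DIM('y)"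
    have "v = 4 ^ ?n * c"
    proof -
      have "2 / s = 4 * (1 / (2 * s))" "2 / t = 4 * (1 / (2 * t))" by auto
      then show ?thesis unfolding v_def c_def by (simp only: power_mult_distrib power_add ac_simps)
    qed
    then have "exp (- 8 / 3) * v \<le> 4 ^ ?n * m"
      using mult_left_mono[OF bump_mass_ge[OF st, where 'x = 'x and 'y = 'y], of "4 ^ ?n"]
      unfolding m_def c_def[symmetric] by (simp only: mult.left_commute) simp
    then have vm: "v \<le> 4 ^ ?n * m * exp (8 / 3)"
      by (simp add: exp_minus field_simps)
    have bound: "\<bar>Ditr [(0, w), (0, w)] (bump_kernel s t) z\<bar> \<le> indicator ?B z * (t\<^sup>2 * B / m)" for z :: "'x \<times> 'y"
    proof (cases "z \<in> ?B")
      case True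
      have "Ditr [(0, w), (0, w)] (bump_kernel s t) z = inverse m * Ditr [(0, w), (0, w)] (bump s t) z"
        unfolding bump_kernel_def[abs_def] m_def by (simp add: Ditr_cmult[OF smooth_bump] del: Ditr.simps)
      also have "Ditr [(0, w), (0, w)] (bump s t) z = Ditr [t *\<^sub>R (0, w), t *\<^sub>R (0, w)] (bump 1 1) (s *\<^sub>R fst z, t *\<^sub>R snd z)"
        unfolding Ditr_bump_scale[of "[(0, w), (0, w)]" s t z] by simp
      also have "\<dots> = t * (t * D (s *\<^sub>R fst z, t *\<^sub>R snd z))"
      proof -
        have "Dd (bump 1 1 :: 'x \<times> 'y \<Rightarrow> real) (t *\<^sub>R (0, w)) = (\<lambda>z. t * Dd (bump 1 1) (0, w) z)"
          by (rule ext) (rule Dd_scale[OF smooth_differentiable[OF smooth_bump], unfolded real_scaleR_def])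
        then show ?thesis
          unfolding D_def
          by (simp only: Ditr.simps Dd_cmult[OF smooth_differentiable[OF smooth_Dd[OF smooth_bump]]]
              Dd_scale[OF smooth_differentiable[OF smooth_Dd[OF smooth_bump]], unfolded real_scaleR_def])
      qed
      finally have e: "Ditr [(0, w), (0, w)] (bump_kernel s t) z = inverse m * (t * (t * D (s *\<^sub>R fst z, t *\<^sub>R snd z)))" .
      have "\<bar>Ditr [(0, w), (0, w)] (bump_kernel s t) z\<bar> = t\<^sup>2 * \<bar>D (s *\<^sub>R fst z, t *\<^sub>R snd z)\<bar> / m"
        unfolding e using m st by (simp add: abs_mult power2_eq_square divide_inverse)
      also have "\<dots> \<le> t\<^sup>2 * B / m" using B(2) m by (intro divide_right_mono mult_left_mono) auto
      finally show ?thesis using True by simp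
    next
      case False
      have "1 / s < 2 / s" "1 / t < 2 / t" using st by (auto simp: field_simps)
      then have "1 / s < norm (fst z) \<or> 1 / t < norm (snd z)"
        using False st by (auto simp: mem_Times_iff)
      then show ?thesis using Ditr_bump_kernel_zero[OF st, of z] False by (simp del: Ditr.simps)
    qed
    have "(\<integral>z. \<bar>Ditr [(0, w), (0, w)] (bump_kernel s t) (z :: 'x \<times> 'y)\<bar> \<partial>lborel) \<le> (\<integral>z. indicator ?B z * (t\<^sup>2 * B / m) \<partial>lborel)"
    proof (rule integral_mono_AE')
      show "integrable lborel (\<lambda>z::'x \<times> 'y. indicator ?B z * (t\<^sup>2 * B / m))"
        by (intro integrable_mult_left integrable_real_indicator) (auto simp: v)
      show "AE z in lborel. 0 \<le> indicator ?B z * (t\<^sup>2 * B / m)"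
        using B m by (intro AE_I2 mult_nonneg_nonneg) auto
    qed (use bound in blast)
    also have "\<dots> = v * (t\<^sup>2 * B / m)" using v v0 by (simp add: measure_def)
    also have "\<dots> \<le> (4 ^ ?n * m * exp (8 / 3)) * (t\<^sup>2 * B / m)"
      using vm B m by (intro mult_right_mono) auto
    also have "\<dots> = A * t\<^sup>2" using m by (simp add: A_def)
    finally show ?thesis .
  qed
  moreover have "A > 0" using B by (simp add: A_def)
  ultimately show ?thesis using that by blast
qed

section \<open>Integration by parts along one direction\<close>

lemma integral_lborel_shift:
  fixes F :: "'p::euclidean_space \<Rightarrow> real"
  assumes [measurable]: "F \<in> borel_measurable borel"
  shows "(\<integral>x. F (x + v) \<partial>lborel) = (\<integral>x. F x \<partial>lborel)"
proof -
  have "(\<integral>x. F x \<partial>lborel) = (\<integral>x. F x \<partial>distr lborel borel ((+) v))"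
    by (simp add: lborel_distr_plus)
  also have "\<dots> = (\<integral>x. F (v + x) \<partial>lborel)" by (rule integral_distr) auto
  finally show ?thesis by (simp add: add.commute)
qed

text \<open>By translation invariance every difference quotient of F in direction v has integral 0;
  dominated convergence passes to the derivative. Steps at most 1 keep all quotients supported in
  the ball of radius M + |v|.\<close>

lemma integral_directional_derivative_zero:
  fixes F F' :: "'p::euclidean_space \<Rightarrow> real"
  assumes F: "continuous_on UNIV F" "\<And>x. M < norm x \<Longrightarrow> F x = 0"
    and F': "continuous_on UNIV F'" "\<And>x. M < norm x \<Longrightarrow> F' x = 0"
    and d: "\<And>x. ((\<lambda>t. F (x + t *\<^sub>R v)) has_real_derivative F' x) (at 0)"
  shows "(\<integral>x. F' x \<partial>lborel) = 0"
proof -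
  obtain B where B: "B > 0" "\<And>x. norm (F' x) \<le> B"
    using continuous_compact_support_bounded[OF F'] by metis
  have dt: "((\<lambda>t. F (x + t *\<^sub>R v)) has_real_derivative F' (x + t *\<^sub>R v)) (at t)" for x t
    using d[of "x + t *\<^sub>R v"] DERIV_shift[of "\<lambda>t. F (x + t *\<^sub>R v)" "F' (x + t *\<^sub>R v)" 0 t]
    by (simp add: algebra_simps)
  note [measurable] = borel_measurable_continuous_onI[OF F(1)] borel_measurable_continuous_onI[OF F'(1)]
  have Fint: "integrable lborel F" by (rule integrable_continuous_compact_support[OF F])
  have Fsint: "integrable lborel (\<lambda>x. F (x + w))" for w
  proof (rule integrable_continuous_compact_support[of _ "M + norm w"])
    show "continuous_on UNIV (\<lambda>x. F (x + w))" by (intro continuous_on_compose2[OF F(1)] continuous_intros) auto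
    show "F (x + w) = 0" if "M + norm w < norm x" for x
      using that norm_triangle_ineq4[of "x + w" w] by (intro F(2)) simp
  qed
  define q where "q = (\<lambda>n x. real (Suc n) * (F (x + inverse (real (Suc n)) *\<^sub>R v) - F x))"
  have "(\<lambda>n. \<integral>x. q n x \<partial>lborel) \<longlonglongrightarrow> (\<integral>x. F' x \<partial>lborel)"
  proof (rule integral_dominated_convergence[where w = "\<lambda>x. indicator (cball 0 (M + norm v)) x * B"])
    show "integrable lborel (\<lambda>x::'p. indicator (cball 0 (M + norm v)) x * B)"
      using emeasure_lborel_cball_finite[of "0::'p" "M + norm v"] by (intro integrable_mult_left) simp
    show "AE x in lborel. (\<lambda>n. q n x) \<longlonglongrightarrow> F' x"
    proof (rule AE_I2)
      fix x
      have "((\<lambda>h. (F (x + h *\<^sub>R v) - F x) / h) \<longlongrightarrow> F' x) (at 0)"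
        using d[of x] by (simp add: DERIV_def)
      from filterlim_compose[OF this, of "\<lambda>n. inverse (real (Suc n))" sequentially]
      show "(\<lambda>n. q n x) \<longlonglongrightarrow> F' x"
        unfolding q_def using LIMSEQ_inverse_real_of_nat
        by (simp add: filterlim_at divide_inverse mult.commute)
    qed
    show "AE x in lborel. norm (q n x) \<le> indicator (cball 0 (M + norm v)) x * B" for n
    proof (rule AE_I2)
      fix x
      let ?h = "inverse (real (Suc n))"
      have h: "0 < ?h" "?h \<le> 1" by (auto simp: inverse_le_1_iff)
      show "norm (q n x) \<le> indicator (cball 0 (M + norm v)) x * B"
      proof (cases "norm x \<le> M + norm v")
        case True
        have "\<bar>F (x + ?h *\<^sub>R v) - F (x + 0 *\<^sub>R v)\<bar> \<le> B * \<bar>?h - 0\<bar>"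
          using differentiable_bound[of UNIV "\<lambda>t. F (x + t *\<^sub>R v)" "\<lambda>t. (*) (F' (x + t *\<^sub>R v))" B ?h 0] dt B
          by (auto simp: has_field_derivative_def onorm_le abs_mult mult_right_mono intro!: onorm_le)
        then have "real (Suc n) * \<bar>F (x + ?h *\<^sub>R v) - F x\<bar> \<le> real (Suc n) * (B * ?h)"
          using h by (intro mult_left_mono) auto
        also have "\<dots> = B" by simp
        finally have "norm (q n x) \<le> B"
          unfolding q_def real_norm_def abs_mult by simp
        then show ?thesis using True by simp
      next
        case False
        have "norm (?h *\<^sub>R v) \<le> norm v" using h by (simp add: mult_left_le_one_le)
        then have "M < norm (x + ?h *\<^sub>R v)" "M < norm x"
          using False norm_triangle_ineq2[of x "- (?h *\<^sub>R v)"] norm_ge_zero[of v] unfolding norm_minus_cancel by (auto simp: not_le simp del: norm_ge_zero)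
        then show ?thesis unfolding q_def using F(2) B(1) by (simp add: indicator_def)
      qed
    qed
    show "q n \<in> borel_measurable lborel" for n unfolding q_def by measurable
  qed simp
  moreover have "(\<integral>x. q n x \<partial>lborel) = 0" for n
    unfolding q_def using Fint Fsint integral_lborel_shift[of F] by simp
  ultimately have "(\<lambda>n. 0) \<longlonglongrightarrow> (\<integral>x. F' x \<partial>lborel)" by (simp only:)
  from LIMSEQ_unique[OF this tendsto_const] show ?thesis .
qed

lemma Dd_along_line:
  assumes "f differentiable (at x)"
  shows "((\<lambda>t. f (x + t *\<^sub>R v)) has_vector_derivative Dd f v x) (at 0)"
proof -
  have "((\<lambda>t. x + t *\<^sub>R v) has_derivative (\<lambda>t. t *\<^sub>R v)) (at 0)"
    by (auto intro!: derivative_eq_intros)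
  moreover have "(f has_derivative (\<lambda>w. Dd f w x)) (at (x + 0 *\<^sub>R v))"
    using has_derivative_Dd[OF assms] by simp
  ultimately have "((\<lambda>t. f (x + t *\<^sub>R v)) has_derivative (\<lambda>t. Dd f (t *\<^sub>R v) x)) (at 0)"
    by (rule has_derivative_compose)
  then show ?thesis
    unfolding has_vector_derivative_def by (simp add: Dd_scale[OF assms])
qed

text \<open>The weight a is constant along v, so it is not differentiated; this covers a = 1 in
  horizontal directions and a = V in vertical ones. The derivative along v of a \<eta>^2 Re(D_v U
  cnj U) has integral zero, and completing a square disposes of the remaining terms.\<close>

lemma directional_energy:
  fixes U :: "'p::euclidean_space \<Rightarrow> complex" and \<eta> a :: "'p \<Rightarrow> real"
  assumes U: "smooth U" and \<eta>: "smooth \<eta>" and supp: "\<And>x. M < norm x \<Longrightarrow> \<eta> x = 0"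
    and a: "continuous_on UNIV a" "\<And>x. 0 \<le> a x" "\<And>x t. a (x + t *\<^sub>R v) = a x"
  shows "- (\<integral>x. a x * (Dd \<eta> v x)\<^sup>2 * (norm (U x))\<^sup>2 \<partial>lborel)
     \<le> (\<integral>x. Re (- (complex_of_real (a x * (\<eta> x)\<^sup>2) * Ditr [v, v] U x * cnj (U x))) \<partial>lborel)"
proof -
  define DU where "DU = Dd U v"
  define D2U where "D2U = Dd DU v"
  define D\<eta> where "D\<eta> = Dd \<eta> v"
  have sm: "smooth DU" "smooth D\<eta>" "smooth D2U"
    unfolding DU_def D\<eta>_def D2U_def by (intro smooth_Dd U \<eta>)+
  have D\<eta>0: "M < norm x \<Longrightarrow> D\<eta> x = 0" for x unfolding D\<eta>_def by (rule Dd_zero_outside[OF supp])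
  note cont = smooth_continuous[OF U] smooth_continuous[OF \<eta>] smooth_continuous[OF sm(1)] smooth_continuous[OF sm(2)] smooth_continuous[OF sm(3)] a(1)
  define F where "F = (\<lambda>x. a x * ((\<eta> x)\<^sup>2 * Re (DU x * cnj (U x))))"
  define F' where "F' = (\<lambda>x. a x * (2 * \<eta> x * D\<eta> x * Re (DU x * cnj (U x)) + (\<eta> x)\<^sup>2 * (Re (D2U x * cnj (U x)) + (norm (DU x))\<^sup>2)))"
  have "(\<integral>x. F' x \<partial>lborel) = 0"
  proof (rule integral_directional_derivative_zero[of F M F' v])
    fix x
    have d: "((\<lambda>t. U (x + t *\<^sub>R v)) has_vector_derivative DU x) (at 0)"
      "((\<lambda>t. DU (x + t *\<^sub>R v)) has_vector_derivative D2U x) (at 0)"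
      unfolding DU_def D2U_def by (intro Dd_along_line smooth_differentiable U smooth_Dd)+
    have d\<eta>: "((\<lambda>t. \<eta> (x + t *\<^sub>R v)) has_real_derivative D\<eta> x) (at 0)"
      unfolding D\<eta>_def has_real_derivative_iff_has_vector_derivative by (intro Dd_along_line smooth_differentiable \<eta>)
    have "((\<lambda>t. DU (x + t *\<^sub>R v) * cnj (U (x + t *\<^sub>R v))) has_vector_derivative
        DU (x + 0 *\<^sub>R v) * cnj (DU x) + D2U x * cnj (U (x + 0 *\<^sub>R v))) (at 0)"
      by (intro has_vector_derivative_mult d has_vector_derivative_cnj)
    then have "((\<lambda>t. Re (DU (x + t *\<^sub>R v) * cnj (U (x + t *\<^sub>R v)))) has_vector_derivative
        Re (DU x * cnj (DU x) + D2U x * cnj (U x))) (at 0)"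
      by (drule_tac bounded_linear.has_vector_derivative[OF bounded_linear_Re]) (simp only: scaleR_zero_left add_0_right)
    then have dR: "((\<lambda>t. Re (DU (x + t *\<^sub>R v) * cnj (U (x + t *\<^sub>R v)))) has_real_derivative
        Re (DU x * cnj (DU x) + D2U x * cnj (U x))) (at 0)"
      by (simp only: has_real_derivative_iff_has_vector_derivative)
    have "((\<lambda>t. a x * ((\<eta> (x + t *\<^sub>R v))\<^sup>2 * Re (DU (x + t *\<^sub>R v) * cnj (U (x + t *\<^sub>R v))))) has_real_derivative
        a x * ((2 * \<eta> x * D\<eta> x) * Re (DU x * cnj (U x)) + Re (DU x * cnj (DU x) + D2U x * cnj (U x)) * (\<eta> x)\<^sup>2)) (at 0)"
      by (rule derivative_eq_intros d\<eta> dR refl | simp add: power2_eq_square)+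
    moreover have "Re (DU x * cnj (DU x)) = (norm (DU x))\<^sup>2" by (simp add: complex_mult_cnj cmod_power2)
    then have "a x * ((2 * \<eta> x * D\<eta> x) * Re (DU x * cnj (U x)) + Re (DU x * cnj (DU x) + D2U x * cnj (U x)) * (\<eta> x)\<^sup>2) = F' x"
      by (simp only: F'_def plus_complex.sel) (simp add: algebra_simps)
    ultimately show "((\<lambda>t. F (x + t *\<^sub>R v)) has_real_derivative F' x) (at 0)"
      by (simp only: F_def a(3))
  next
    show "continuous_on UNIV F" "continuous_on UNIV F'"
      unfolding F_def F'_def by (intro continuous_intros cont)+
  qed (simp_all add: supp D\<eta>0 F_def F'_def)
  moreover have pt: "- (a x * (D\<eta> x)\<^sup>2 * (norm (U x))\<^sup>2) - F' x \<le> Re (- (complex_of_real (a x * (\<eta> x)\<^sup>2) * D2U x * cnj (U x)))" for x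
  proof -
    \<comment> \<open>The square is that of D_v(\<eta> U), whose expansion contains the mixed term
      produced by the integration by parts.\<close>
    have "0 \<le> (norm (complex_of_real (D\<eta> x) * U x + complex_of_real (\<eta> x) * DU x))\<^sup>2" by simp
    also have "\<dots> = (D\<eta> x)\<^sup>2 * (norm (U x))\<^sup>2 + 2 * \<eta> x * D\<eta> x * Re (DU x * cnj (U x)) + (\<eta> x)\<^sup>2 * (norm (DU x))\<^sup>2"
      unfolding cmod_power2 by (simp add: algebra_simps power2_eq_square)
    finally have "0 \<le> a x * ((D\<eta> x)\<^sup>2 * (norm (U x))\<^sup>2 + 2 * \<eta> x * D\<eta> x * Re (DU x * cnj (U x)) + (\<eta> x)\<^sup>2 * (norm (DU x))\<^sup>2)"
      using a(2) by simp
    then show ?thesis unfolding F'_def by (simp add: algebra_simps)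
  qed
  have int1: "integrable lborel (\<lambda>x. a x * (D\<eta> x)\<^sup>2 * (norm (U x))\<^sup>2)"
    by (rule integrable_continuous_compact_support[of _ M]) (intro continuous_intros cont, simp add: D\<eta>0)
  have int2: "integrable lborel F'"
    by (rule integrable_continuous_compact_support[of _ M]) (unfold F'_def, intro continuous_intros cont, simp add: supp D\<eta>0)
  have int3: "integrable lborel (\<lambda>x. Re (- (complex_of_real (a x * (\<eta> x)\<^sup>2) * D2U x * cnj (U x))))"
    by (rule integrable_continuous_compact_support[of _ M]) (intro continuous_intros cont, simp add: supp)
  have "(\<integral>x. - (a x * (D\<eta> x)\<^sup>2 * (norm (U x))\<^sup>2) - F' x \<partial>lborel) \<le> (\<integral>x. Re (- (complex_of_real (a x * (\<eta> x)\<^sup>2) * D2U x * cnj (U x))) \<partial>lborel)"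
    by (rule integral_mono[OF _ int3]) (use int1 int2 pt in auto)
  then show ?thesis
    using int1 int2 \<open>(\<integral>x. F' x \<partial>lborel) = 0\<close> by (simp add: D\<eta>_def D2U_def DU_def)
qed

section \<open>Non-negativity of the spectrum\<close>

lemma Ditr_add_cmult:
  fixes f g :: "'p::real_normed_vector \<Rightarrow> complex"
  assumes f: "smooth f" and g: "smooth g"
  shows "Ditr vs (\<lambda>x. f x + c * g x) = (\<lambda>x. Ditr vs f x + c * Ditr vs g x)"
proof (induction vs)
  case (Cons v vs)
  have "Dd (\<lambda>x. Ditr vs f x + c * Ditr vs g x) v x = Dd (Ditr vs f) v x + c * Dd (Ditr vs g) v x" for x
    by (rule Dd_eqI)
       (auto intro!: derivative_eq_intros has_derivative_Dd smooth_differentiable[OF smooth_Ditr] f g)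
  then show ?case by (intro ext) (simp only: Ditr.simps Cons.IH)
qed simp

lemma test_fun_smooth: "test_fun \<phi> \<Longrightarrow> smooth \<phi>"
  by (simp add: test_fun_def smooth_def)

lemma test_fun_support:
  assumes "test_fun \<phi>" obtains M where "\<And>x. M < norm x \<Longrightarrow> \<phi> x = 0"
proof -
  have "bounded {x. \<phi> x \<noteq> 0}"
    using assms compact_imp_bounded bounded_subset closure_subset unfolding test_fun_def by metis
  then obtain M where "\<forall>x\<in>{x. \<phi> x \<noteq> 0}. norm x \<le> M" using bounded_pos by blast
  then show ?thesis using that[of M] by force
qed

lemma test_fun_L2: "test_fun \<phi> \<Longrightarrow> \<phi> \<in> L2"
  by (metis test_fun_support test_fun_smooth smooth_continuous continuous_compact_support_L2)

lemma test_fun_add_cmult: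
  assumes "test_fun \<phi>" "test_fun \<psi>" shows "test_fun (\<lambda>x. \<phi> x + c * \<psi> x)"
proof -
  obtain M N where MN: "\<And>x. M < norm x \<Longrightarrow> \<phi> x = 0" "\<And>x. N < norm x \<Longrightarrow> \<psi> x = 0"
    using test_fun_support assms by metis
  have "smooth (\<lambda>x. \<phi> x + c * \<psi> x)"
    unfolding smooth_def Ditr_add_cmult[OF assms[THEN test_fun_smooth]]
    by (intro allI derivative_intros smooth_differentiable[OF smooth_Ditr] assms[THEN test_fun_smooth])
  moreover have "compact (closure {x. \<phi> x + c * \<psi> x \<noteq> 0})"
    by (rule bounded_support_compact_closure[of "max M N"]) (simp add: MN)
  ultimately show ?thesis by (simp add: test_fun_def smooth_def)
qed

lemma Grushin_add_cmult:
  assumes "test_fun \<phi>" "test_fun \<psi>"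
  shows "Grushin hom \<kappa> (\<lambda>x. \<phi> x + c * \<psi> x) = (\<lambda>x. Grushin hom \<kappa> \<phi> x + c * Grushin hom \<kappa> \<psi> x)"
  unfolding Grushin_def[abs_def] Ditr_add_cmult[OF assms[THEN test_fun_smooth]]
  by (simp add: sum.distrib sum_distrib_left algebra_simps del: Ditr.simps)

lemma continuous_Vpot: "continuous_on S (\<lambda>x. Vpot hom \<kappa> (fst x))"
  unfolding Vpot_def by (cases hom) (auto intro!: continuous_intros)

lemma Vpot_nonneg: "0 \<le> Vpot hom \<kappa> x"
  by (auto simp: Vpot_def intro!: sum_nonneg zero_le_even_power)

lemma Vpot_le: "Vpot hom \<kappa> (x :: real^'a::finite) \<le> real CARD('a) * norm x ^ (2 * \<kappa>)"
proof (cases hom)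
  case True
  have "1 * norm x ^ (2 * \<kappa>) \<le> real CARD('a) * norm x ^ (2 * \<kappa>)"
    by (intro mult_right_mono) (auto simp: Suc_leI)
  then show ?thesis using True by (simp add: Vpot_def)
next
  case False
  have "(\<Sum>j\<in>UNIV. (x $ j) ^ (2 * \<kappa>)) \<le> (\<Sum>j\<in>(UNIV::'a set). norm x ^ (2 * \<kappa>))"
  proof (rule sum_mono)
    fix j
    have "\<bar>x $ j\<bar> ^ (2 * \<kappa>) \<le> norm x ^ (2 * \<kappa>)" by (intro power_mono component_le_norm_cart) auto
    then show "(x $ j) ^ (2 * \<kappa>) \<le> norm x ^ (2 * \<kappa>)" by (simp add: power_even_abs)
  qed
  then show ?thesis using False by (simp add: Vpot_def)
qed

lemma Grushin_test_fun_L2: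
  assumes "test_fun \<phi>" shows "Grushin hom \<kappa> \<phi> \<in> L2"
proof -
  obtain M where M: "\<And>x. M < norm x \<Longrightarrow> \<phi> x = 0" using test_fun_support[OF assms] by metis
  show ?thesis
  proof (rule continuous_compact_support_L2)
    show "continuous_on UNIV (Grushin hom \<kappa> \<phi>)"
      unfolding Grushin_def[abs_def]
      by (intro continuous_intros continuous_Vpot smooth_continuous smooth_Ditr test_fun_smooth assms)
    show "Grushin hom \<kappa> \<phi> x = 0" if "M < norm x" for x
      unfolding Grushin_def using Ditr_zero_outside[OF M that] by (simp del: Ditr.simps)
  qed
qed

lemma test_fun_dense:
  fixes u :: "('a::finite, 'b::finite) pt \<Rightarrow> complex"
  assumes u: "u \<in> L2" and e: "e > 0"
  shows "\<exists>\<psi>. test_fun \<psi> \<and> L2norm (\<lambda>x. \<psi> x - u x) < e"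
proof -
  obtain g M where g: "continuous_on UNIV g" "\<And>x. M < norm x \<Longrightarrow> g x = 0" "L2norm (\<lambda>x. g x - u x) < e / 2"
    using L2_dense_continuous[OF u, of "e / 2"] e by auto
  have gL: "g \<in> L2" by (rule continuous_compact_support_L2[OF g(1)]) (rule g(2))
  obtain \<delta> where \<delta>: "\<delta> > 0" "\<And>k. mollifier \<delta> k \<Longrightarrow> L2norm (\<lambda>x. conv k g x - g x) < e / 2"
    by (rule mollify_continuous[of g M "e / 2"]) (use g e in auto)
  define k where "k = (bump_kernel (2 / \<delta>) (2 / \<delta>) :: ('a, 'b) pt \<Rightarrow> real)"
  have k: "mollifier \<delta> k" unfolding k_def by (rule mollifier_bump_kernel) (use \<delta> in auto)
  have "test_fun (conv k g)"
    by (rule test_fun_conv[OF L2_locint[OF gL], of M _ \<delta>]) (use g(2) k in \<open>auto simp: mollifier_def\<close>)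
  moreover have "conv k g \<in> L2" by (rule test_fun_L2) fact
  then have "L2norm (\<lambda>x. conv k g x - u x) < e"
    using L2norm_triangle_diff[OF _ gL u, of "conv k g"] \<delta>(2)[OF k] g(3) by simp
  ultimately show ?thesis by blast
qed

lemma conv_even_adjoint:
  fixes k :: "'p::euclidean_space \<Rightarrow> real"
  assumes "\<psi> \<in> L2" "u \<in> L2" "integrable lborel k" "\<And>z. k (- z) = k z"
  shows "L2inner (conv k \<psi>) u = L2inner \<psi> (conv k u)"
  using conv_adjoint[OF assms(1-3)] assms(4) by simp

text \<open>The test function mollifies u, multiplies by \<eta>^2 and mollifies again. As the kernel
  is even, one mollification moves across to u, so pairing with u yields the energy of U localised
  by \<eta>. Horizontal second derivatives commute with this exactly; in the vertical ones V has to
  be pulled out of the convolution, at the price \<omega> B for each of the \<open>CARD('b)\<close>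
  directions.\<close>

lemma grushin_lower_bound:
  fixes u :: "('a::finite, 'b::finite) pt \<Rightarrow> complex"
  assumes u: "u \<in> L2" and st: "s > 0" "t > 0"
    and \<eta>: "smooth \<eta>" "\<And>x. M < norm x \<Longrightarrow> \<eta> x = 0" "\<And>x. 0 \<le> \<eta> x" "\<And>x. \<eta> x \<le> 1"
    and \<sigma>: "\<And>x. (\<Sum>j\<in>UNIV. (Dd \<eta> (e1 j) x)\<^sup>2) + Vpot hom \<kappa> (fst x) * (\<Sum>k\<in>UNIV. (Dd \<eta> (e2 k) x)\<^sup>2) \<le> \<sigma>"
    and \<omega>: "\<And>x y :: ('a, 'b) pt. norm x \<le> M \<Longrightarrow> norm (fst x - fst y) \<le> 1 / s \<Longrightarrow> norm (snd x - snd y) \<le> 1 / t \<Longrightarrow>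
        \<bar>Vpot hom \<kappa> (fst y) - Vpot hom \<kappa> (fst x)\<bar> \<le> \<omega>" "0 \<le> \<omega>"
    and B: "\<And>k. (\<integral>z. \<bar>Ditr [e2 k, e2 k] (bump_kernel s t) (z::('a, 'b) pt)\<bar> \<partial>lborel) \<le> B"
  defines "U \<equiv> conv (bump_kernel s t) u"
  defines "\<phi> \<equiv> conv (bump_kernel s t) (\<lambda>x. complex_of_real ((\<eta> x)\<^sup>2) * U x)"
  shows "test_fun \<phi>"
    and "- (\<sigma> + real CARD('b) * (\<omega> * B)) * (L2norm u)\<^sup>2 \<le> Re (L2inner (Grushin hom \<kappa> \<phi>) u)"
    and "L2inner \<phi> u = complex_of_real ((L2norm (\<lambda>x. complex_of_real (\<eta> x) * U x))\<^sup>2)"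
    and "L2norm \<phi> \<le> L2norm u"
proof -
  define d where "d = 1 / s + 1 / t"
  define j where "j = (bump_kernel s t :: ('a, 'b) pt \<Rightarrow> real)"
  have "mollifier d j" unfolding j_def d_def by (rule mollifier_bump_kernel[OF st order_refl])
  then have js: "smooth j" and jint: "integrable lborel j" and j1: "(\<integral>x. \<bar>j x\<bar> \<partial>lborel) \<le> 1" and jsupp: "\<And>x. d < norm x \<Longrightarrow> j x = 0"
    by (auto simp: mollifier_def simp del: split_paired_All)
  have jeven: "j (- z) = j z" for z unfolding j_def by (rule bump_kernel_even)
  define \<psi> where "\<psi> = (\<lambda>x. complex_of_real ((\<eta> x)\<^sup>2) * U x)"
  have \<phi>: "\<phi> = conv j \<psi>" and U: "U = conv j u" by (simp_all add: \<phi>_def \<psi>_def U_def j_def)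
  have UL: "U \<in> L2" and Un: "L2norm U \<le> L2norm u"
    unfolding U using conv_L2[OF u jint j1] by auto
  have Us: "smooth U" unfolding U by (rule smooth_conv[OF L2_locint[OF u] js, of d]) (rule jsupp)
  have \<eta>sq: "(\<eta> x)\<^sup>2 \<le> 1" for x using power_mono[OF \<eta>(4) \<eta>(3), of x 2] by simp
  note cU = smooth_continuous[OF Us] and c\<eta> = smooth_continuous[OF \<eta>(1)]
  have c\<psi>: "continuous_on UNIV \<psi>" unfolding \<psi>_def by (intro continuous_intros cU c\<eta>)
  have \<psi>0: "M < norm x \<Longrightarrow> \<psi> x = 0" for x using \<eta>(2) by (simp add: \<psi>_def)
  have \<psi>L: "\<psi> \<in> L2" by (rule continuous_compact_support_L2[OF c\<psi>]) (rule \<psi>0)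
  have \<psi>n: "L2norm \<psi> \<le> L2norm u"
  proof -
    have "norm (\<psi> x) \<le> norm (U x)" for x
      unfolding \<psi>_def norm_mult norm_of_real using \<eta>sq[of x] by (intro mult_left_le_one_le) auto
    then have "L2norm \<psi> \<le> L2norm U" by (intro L2norm_mono \<psi>L UL) auto
    then show ?thesis using Un by simp
  qed
  show "test_fun \<phi>"
    unfolding \<phi> by (rule test_fun_conv[OF L2_locint[OF \<psi>L], of M _ d]) (use \<psi>0 js jsupp in auto)
  show "L2norm \<phi> \<le> L2norm u"
    unfolding \<phi> using conv_L2(2)[OF \<psi>L jint j1] \<psi>n by simp
  show "L2inner \<phi> u = complex_of_real ((L2norm (\<lambda>x. complex_of_real (\<eta> x) * U x))\<^sup>2)"
    unfolding \<phi> conv_even_adjoint[OF \<psi>L u jint jeven] U[symmetric]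
    unfolding L2inner_self[symmetric] L2inner_def \<psi>_def by (simp add: power2_eq_square ac_simps)

  define D1 where "D1 = (\<lambda>i::'a. Ditr [e1 i, e1 i] j)"
  define D2 where "D2 = (\<lambda>k::'b. Ditr [e2 k, e2 k] j)"
  have D_eq: "Ditr [e1 i, e1 i] j = D1 i" "Ditr [e2 k, e2 k] j = D2 k" for i k
    by (simp_all only: D1_def D2_def)
  have Ds: "smooth (D1 i)" "smooth (D2 k)" for i k
    unfolding D1_def D2_def by (intro smooth_Ditr js)+
  have Dsupp: "d < norm x \<Longrightarrow> D1 i x = 0" "d < norm x \<Longrightarrow> D2 k x = 0" for i k x
    unfolding D1_def D2_def by (rule Ditr_zero_outside[OF jsupp]; assumption)+
  have Dint: "integrable lborel (D1 i)" "integrable lborel (D2 k)" for i k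
    by (rule integrable_continuous_compact_support[of _ d]; use Ds Dsupp smooth_continuous in blast)+
  have Deven: "D1 i (- z) = D1 i z" "D2 k (- z) = D2 k z" for i k z
    unfolding D1_def D2_def by (rule Ditr2_even[OF js jeven])+
  have conv_u: "Ditr [v, v] U = conv (Ditr [v, v] j) u" for v
    unfolding U by (rule Ditr_conv[OF L2_locint[OF u] js]) (rule jsupp)
  have conv_\<psi>: "Ditr [v, v] \<phi> = conv (Ditr [v, v] j) \<psi>" for v
    unfolding \<phi> by (rule Ditr_conv[OF L2_locint[OF \<psi>L] js]) (rule jsupp)
  define V where "V = (\<lambda>x::('a, 'b) pt. Vpot hom \<kappa> (fst x))"
  have cV: "continuous_on S V" for S unfolding V_def by (rule continuous_Vpot)
  have V0: "0 \<le> V x" for x unfolding V_def by (rule Vpot_nonneg)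
  note [measurable] = borel_measurable_continuous_onI[OF cV] L2_measurable[OF u] L2_measurable[OF \<psi>L] L2_measurable[OF UL]
  \<comment> \<open>V is unbounded, so V u need not lie in L2. The indicator c repairs this and is
    invisible in the pairing, because convolving \<psi> with \<open>D2 k\<close> stays supported
    within radius M + d.\<close>
  define c where "c = (\<lambda>x::('a, 'b) pt. indicator (cball 0 (M + d)) x :: complex)"
  have [measurable]: "c \<in> borel_measurable borel" unfolding c_def by (rule borel_measurable_indicator) simp
  obtain Vm where Vm: "\<And>x. norm x \<le> M + d \<Longrightarrow> V x \<le> Vm"
  proof -
    have "compact (V ` cball 0 (M + d))" by (intro compact_continuous_image cV) auto
    then obtain Vm where "\<forall>y\<in>V ` cball 0 (M + d). norm y \<le> Vm" using compact_imp_bounded bounded_pos by blast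
    then show ?thesis using that[of Vm] by force
  qed
  define Vu where "Vu = (\<lambda>x. complex_of_real (V x) * (c x * u x))"
  have cut_L2: "(\<lambda>x. complex_of_real (V x) * (c x * f x)) \<in> L2" if f: "f \<in> L2" for f
  proof (rule L2_bound[OF f])
    note [measurable] = L2_measurable[OF f]
    show "(\<lambda>x. complex_of_real (V x) * (c x * f x)) \<in> borel_measurable borel" by measurable
    show "norm (complex_of_real (V x) * (c x * f x)) \<le> \<bar>Vm\<bar> * norm (f x)" for x
      using Vm[of x] V0[of x] by (auto simp: c_def norm_mult indicator_def intro!: mult_right_mono)
  qed
  have VuL: "Vu \<in> L2" unfolding Vu_def by (rule cut_L2[OF u])
  have c_conv: "c x * conv (D2 k) \<psi> x = conv (D2 k) \<psi> x" for x k
    using conv_zero_outside[of d "D2 k" M \<psi> x] Dsupp \<psi>0 by (cases "norm x \<le> M + d") (auto simp: c_def add.commute)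
  have c_\<psi>: "c x * \<psi> x = \<psi> x" for x
    using \<psi>0[of x] st by (cases "norm x \<le> M + d") (auto simp: c_def d_def not_le add_pos_pos intro!: \<psi>0 le_less_trans[of M "M + d"])
  have conv2L: "conv (D1 i) f \<in> L2" "conv (D2 k) f \<in> L2" if "f \<in> L2" for f i k
    using conv_L2[OF that Dint(1) order_refl] conv_L2[OF that Dint(2) order_refl] by auto
  have V\<psi>L: "(\<lambda>x. complex_of_real (V x) * \<psi> x) \<in> L2"
    using cut_L2[OF \<psi>L] unfolding c_\<psi> .
  have VcL: "(\<lambda>x. complex_of_real (V x) * conv (D2 k) \<psi> x) \<in> L2" for k
    using cut_L2[OF conv2L(2)[OF \<psi>L, of k]] unfolding c_conv .

  have G: "Grushin hom \<kappa> \<phi> = (\<lambda>x. - 1 * ((\<Sum>i\<in>UNIV. conv (D1 i) \<psi> x) + (\<Sum>k\<in>UNIV. complex_of_real (V x) * conv (D2 k) \<psi> x)))"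
    unfolding Grushin_def[abs_def] conv_\<psi> D1_def D2_def V_def by (simp add: sum_distrib_left fun_eq_iff del: Ditr.simps)
  \<comment> \<open>The real weight V c is attached to u before the even kernel crosses, which
    leaves V inside the convolution.\<close>
  have I2: "L2inner (\<lambda>x. complex_of_real (V x) * conv (D2 k) \<psi> x) u = L2inner \<psi> (conv (D2 k) Vu)" for k
  proof -
    have "complex_of_real (V x) * conv (D2 k) \<psi> x * cnj (u x) = conv (D2 k) \<psi> x * cnj (Vu x)" for x
    proof -
      have "cnj (c x) = c x" by (simp add: c_def indicator_def)
      then have "conv (D2 k) \<psi> x * cnj (Vu x) = complex_of_real (V x) * (c x * conv (D2 k) \<psi> x) * cnj (u x)"
        by (simp add: Vu_def mult_ac)
      then show ?thesis by (simp only: c_conv)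
    qed
    then have "L2inner (\<lambda>x. complex_of_real (V x) * conv (D2 k) \<psi> x) u = L2inner (conv (D2 k) \<psi>) Vu"
      unfolding L2inner_def by presburger
    then show ?thesis by (simp only: conv_even_adjoint[OF \<psi>L VuL Dint(2) Deven(2)])
  qed
  have GI: "L2inner (Grushin hom \<kappa> \<phi>) u = - ((\<Sum>i\<in>UNIV. L2inner \<psi> (conv (D1 i) u)) + (\<Sum>k\<in>UNIV. L2inner \<psi> (conv (D2 k) Vu)))"
  proof -
    have a: "L2inner (\<lambda>x. \<Sum>i\<in>UNIV. conv (D1 i) \<psi> x) u = (\<Sum>i\<in>UNIV. L2inner (conv (D1 i) \<psi>) u)"
      by (rule L2inner_sum_left) (rule conv2L(1)[OF \<psi>L] u)+
    have b: "L2inner (\<lambda>x. \<Sum>k\<in>UNIV. complex_of_real (V x) * conv (D2 k) \<psi> x) u = (\<Sum>k\<in>UNIV. L2inner (\<lambda>x. complex_of_real (V x) * conv (D2 k) \<psi> x) u)"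
      by (rule L2inner_sum_left) (rule VcL u)+
    have "L2inner (Grushin hom \<kappa> \<phi>) u = - 1 * ((\<Sum>i\<in>UNIV. L2inner (conv (D1 i) \<psi>) u) + (\<Sum>k\<in>UNIV. L2inner (\<lambda>x. complex_of_real (V x) * conv (D2 k) \<psi> x) u))"
      unfolding G L2inner_scale_left
      by (subst L2inner_add_left[OF L2_sum L2_sum u]) (rule conv2L(1)[OF \<psi>L] VcL | simp only: a b)+
    then show ?thesis by (simp only: conv_even_adjoint[OF \<psi>L u Dint(1) Deven(1)] I2) simp
  qed

  have Re_int: "(\<integral>x. Re (- f x) \<partial>lborel) = Re (- (\<integral>x. f x \<partial>lborel))" if "integrable lborel f" for f :: "('a, 'b) pt \<Rightarrow> complex"
    unfolding Bochner_Integration.integral_minus[symmetric]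
    by (rule Bochner_Integration.integral_Re) (use that in simp)
  have en1: "- (\<integral>x. (Dd \<eta> (e1 i) x)\<^sup>2 * (norm (U x))\<^sup>2 \<partial>lborel) \<le> Re (- L2inner \<psi> (conv (D1 i) u))" for i
  proof -
    have "- (\<integral>x. 1 * (Dd \<eta> (e1 i) x)\<^sup>2 * (norm (U x))\<^sup>2 \<partial>lborel)
        \<le> (\<integral>x. Re (- (complex_of_real (1 * (\<eta> x)\<^sup>2) * Ditr [e1 i, e1 i] U x * cnj (U x))) \<partial>lborel)"
      by (rule directional_energy[OF Us \<eta>(1), of M]) (auto intro: \<eta>(2))
    also have "\<dots> = (\<integral>x. Re (- (\<psi> x * cnj (conv (D1 i) u x))) \<partial>lborel)"
      unfolding conv_u D_eq \<psi>_def by (intro Bochner_Integration.integral_cong refl) (simp add: algebra_simps)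
    also have "\<dots> = Re (- L2inner \<psi> (conv (D1 i) u))"
      unfolding L2inner_def using Re_int[OF L2_integrable_inner[OF \<psi>L conv2L(1)[OF u, of i]]] .
    finally show ?thesis by simp
  qed
  have en2: "- (\<integral>x. V x * (Dd \<eta> (e2 k) x)\<^sup>2 * (norm (U x))\<^sup>2 \<partial>lborel) \<le> Re (- L2inner (\<lambda>x. complex_of_real (V x) * \<psi> x) (conv (D2 k) u))" for k
  proof -
    have "- (\<integral>x. V x * (Dd \<eta> (e2 k) x)\<^sup>2 * (norm (U x))\<^sup>2 \<partial>lborel)
        \<le> (\<integral>x. Re (- (complex_of_real (V x * (\<eta> x)\<^sup>2) * Ditr [e2 k, e2 k] U x * cnj (U x))) \<partial>lborel)"
      by (rule directional_energy[OF Us \<eta>(1) \<eta>(2) cV V0]) (simp_all add: V_def e2_def)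
    also have "\<dots> = (\<integral>x. Re (- (complex_of_real (V x) * \<psi> x * cnj (conv (D2 k) u x))) \<partial>lborel)"
      unfolding conv_u D_eq \<psi>_def by (intro Bochner_Integration.integral_cong refl) (simp add: algebra_simps)
    also have "\<dots> = Re (- L2inner (\<lambda>x. complex_of_real (V x) * \<psi> x) (conv (D2 k) u))"
      unfolding L2inner_def using Re_int[OF L2_integrable_inner[OF V\<psi>L conv2L(2)[OF u, of k]]] .
    finally show ?thesis by simp
  qed
  \<comment> \<open>The commutator has kernel (V y - V x) \<open>D2 k\<close> (x - y), at most
    \<omega> |\<open>D2 k\<close> (x - y)| for x in the support of \<psi>. Young's inequality for
    |\<open>D2 k\<close>| against |u| then gives the factor B.\<close>
  have comm: "norm (L2inner \<psi> (conv (D2 k) Vu) - L2inner (\<lambda>x. complex_of_real (V x) * \<psi> x) (conv (D2 k) u)) \<le> \<omega> * B * (L2norm u)\<^sup>2" for k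
  proof -
    define u' where "u' = (\<lambda>y. complex_of_real (norm (u y)))"
    define A where "A = conv (\<lambda>z. \<bar>D2 k z\<bar>) u'"
    have u'L: "u' \<in> L2" by (rule L2_bound[OF u, where C = 1]) (auto simp: u'_def)
    have u'n: "L2norm u' = L2norm u" by (simp add: L2norm_def u'_def)
    have BB: "(\<integral>z. \<bar>\<bar>D2 k z\<bar>\<bar> \<partial>lborel) \<le> B" using B[of k] by (simp add: D2_def j_def del: Ditr.simps)
    have AL: "A \<in> L2" and An: "L2norm A \<le> B * L2norm u"
      using conv_L2[OF u'L integrable_abs[OF Dint(2)] BB] by (auto simp: A_def u'n)
    have int2: "integrable lborel (\<lambda>y. complex_of_real (D2 k (x - y)) * f y)" if "f \<in> L2" for f x
      by (rule conv_integrable[OF L2_locint[OF that] smooth_continuous[OF Ds(2)], of d]) (rule Dsupp)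
    have intA: "integrable lborel (\<lambda>y. \<bar>D2 k (x - y)\<bar> * norm (u y))" for x
      using integrable_norm[OF int2[OF u, of x]] by (simp add: norm_mult)
    have A_eq: "A x = complex_of_real (\<integral>y. \<bar>D2 k (x - y)\<bar> * norm (u y) \<partial>lborel)" for x
      unfolding A_def conv_def u'_def by (simp flip: of_real_mult)
    have pt: "norm (\<psi> x * cnj (conv (D2 k) Vu x) - complex_of_real (V x) * \<psi> x * cnj (conv (D2 k) u x)) \<le> \<omega> * (norm (\<psi> x) * norm (A x))" for x
    proof (cases "norm x \<le> M")
      case True
      have "conv (D2 k) Vu x - complex_of_real (V x) * conv (D2 k) u x
          = (\<integral>y. complex_of_real (D2 k (x - y)) * Vu y - complex_of_real (V x) * (complex_of_real (D2 k (x - y)) * u y) \<partial>lborel)"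
        unfolding conv_def using int2[OF VuL, of x] int2[OF u, of x] by simp
      also have "norm \<dots> \<le> (\<integral>y. \<omega> * (\<bar>D2 k (x - y)\<bar> * norm (u y)) \<partial>lborel)"
      proof (rule Bochner_Integration.integral_norm_bound_integral)
        show "integrable lborel (\<lambda>y. complex_of_real (D2 k (x - y)) * Vu y - complex_of_real (V x) * (complex_of_real (D2 k (x - y)) * u y))"
          using int2[OF VuL, of x] int2[OF u, of x] by simp
        show "integrable lborel (\<lambda>y. \<omega> * (\<bar>D2 k (x - y)\<bar> * norm (u y)))" using intA by simp
        fix y
        show "norm (complex_of_real (D2 k (x - y)) * Vu y - complex_of_real (V x) * (complex_of_real (D2 k (x - y)) * u y)) \<le> \<omega> * (\<bar>D2 k (x - y)\<bar> * norm (u y))"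
        proof (cases "D2 k (x - y) = 0")
          case False
          then have xy: "norm (fst x - fst y) \<le> 1 / s" "norm (snd x - snd y) \<le> 1 / t"
            using Ditr_bump_kernel_zero[OF st, of "x - y"] unfolding D2_def j_def by (auto simp: not_less[symmetric] simp del: Ditr.simps)
          have "norm (x - y) \<le> d" using Dsupp(2)[of "x - y" k] False by (meson not_le)
          then have "norm y \<le> M + d" using True norm_triangle_ineq2[of y x] by (simp add: norm_minus_commute)
          then have "complex_of_real (D2 k (x - y)) * Vu y - complex_of_real (V x) * (complex_of_real (D2 k (x - y)) * u y)
             = complex_of_real ((V y - V x) * D2 k (x - y)) * u y"
            by (simp add: Vu_def c_def algebra_simps)
          also have "norm \<dots> = \<bar>V y - V x\<bar> * (\<bar>D2 k (x - y)\<bar> * norm (u y))"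
            by (simp only: norm_mult norm_of_real abs_mult mult.assoc)
          also have "\<dots> \<le> \<omega> * (\<bar>D2 k (x - y)\<bar> * norm (u y))"
            using \<omega>(1)[OF True xy] by (intro mult_right_mono) (auto simp: V_def)
          finally show ?thesis .
        qed simp
      qed
      also have "\<dots> = \<omega> * norm (A x)"
        unfolding A_eq norm_of_real by (subst abs_of_nonneg) (auto intro!: integral_nonneg_AE)
      finally have "norm (conv (D2 k) Vu x - complex_of_real (V x) * conv (D2 k) u x) \<le> \<omega> * norm (A x)" .
      then have "norm (\<psi> x) * norm (cnj (conv (D2 k) Vu x - complex_of_real (V x) * conv (D2 k) u x)) \<le> norm (\<psi> x) * (\<omega> * norm (A x))"
        unfolding complex_mod_cnj by (intro mult_left_mono) auto
      then show ?thesis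
        unfolding norm_mult[symmetric] by (simp add: algebra_simps norm_mult)
    qed (use \<psi>0[of x] in \<open>simp add: not_le\<close>)
    note i1 = L2_integrable_inner[OF \<psi>L conv2L(2)[OF VuL, of k]] L2_integrable_inner[OF V\<psi>L conv2L(2)[OF u, of k]]
    have iA: "integrable lborel (\<lambda>x. norm (\<psi> x) * norm (A x))"
      using integrable_norm[OF L2_integrable_mult[OF \<psi>L AL]] by (simp add: norm_mult)
    have "norm (L2inner \<psi> (conv (D2 k) Vu) - L2inner (\<lambda>x. complex_of_real (V x) * \<psi> x) (conv (D2 k) u))
        = norm (\<integral>x. \<psi> x * cnj (conv (D2 k) Vu x) - complex_of_real (V x) * \<psi> x * cnj (conv (D2 k) u x) \<partial>lborel)"
      unfolding L2inner_def using i1 by simp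
    also have "\<dots> \<le> (\<integral>x. \<omega> * (norm (\<psi> x) * norm (A x)) \<partial>lborel)"
      by (rule Bochner_Integration.integral_norm_bound_integral) (use i1 iA pt in auto)
    also have "\<dots> = \<omega> * (\<integral>x. norm (\<psi> x) * norm (A x) \<partial>lborel)" by simp
    also have "\<dots> \<le> \<omega> * (L2norm \<psi> * L2norm A)"
      by (intro mult_left_mono L2_norm_CS \<psi>L AL \<omega>(2))
    also have "\<dots> \<le> \<omega> * (L2norm u * (B * L2norm u))"
      by (intro mult_left_mono mult_mono \<psi>n An \<omega>(2)) auto
    finally show ?thesis by (simp add: power2_eq_square mult_ac)
  qed
  have en3: "- (\<integral>x. V x * (Dd \<eta> (e2 k) x)\<^sup>2 * (norm (U x))\<^sup>2 \<partial>lborel) - \<omega> * B * (L2norm u)\<^sup>2 \<le> Re (- L2inner \<psi> (conv (D2 k) Vu))" for k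
    using en2[of k] comm[of k] abs_Re_le_cmod[of "L2inner \<psi> (conv (D2 k) Vu) - L2inner (\<lambda>x. complex_of_real (V x) * \<psi> x) (conv (D2 k) u)"]
    by simp
  have cD\<eta>: "continuous_on UNIV (Dd \<eta> v)" for v by (rule smooth_continuous[OF smooth_Dd[OF \<eta>(1)]])
  have D\<eta>0: "M < norm x \<Longrightarrow> Dd \<eta> v x = 0" for v x by (rule Dd_zero_outside[OF \<eta>(2)])
  have iD1: "integrable lborel (\<lambda>x. (Dd \<eta> v x)\<^sup>2 * (norm (U x))\<^sup>2)" and iD2: "integrable lborel (\<lambda>x. V x * (Dd \<eta> v x)\<^sup>2 * (norm (U x))\<^sup>2)" for v
    by (rule integrable_continuous_compact_support[of _ M], intro continuous_intros cD\<eta> cU cV, simp add: D\<eta>0)+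
  have "(\<Sum>i\<in>UNIV. \<integral>x. (Dd \<eta> (e1 i) x)\<^sup>2 * (norm (U x))\<^sup>2 \<partial>lborel) + (\<Sum>k\<in>UNIV. \<integral>x. V x * (Dd \<eta> (e2 k) x)\<^sup>2 * (norm (U x))\<^sup>2 \<partial>lborel)
      = (\<integral>x. ((\<Sum>i\<in>UNIV. (Dd \<eta> (e1 i) x)\<^sup>2) + V x * (\<Sum>k\<in>UNIV. (Dd \<eta> (e2 k) x)\<^sup>2)) * (norm (U x))\<^sup>2 \<partial>lborel)"
  proof -
    have "(\<integral>x. (\<Sum>i\<in>UNIV. (Dd \<eta> (e1 i) x)\<^sup>2 * (norm (U x))\<^sup>2) + (\<Sum>k\<in>UNIV. V x * (Dd \<eta> (e2 k) x)\<^sup>2 * (norm (U x))\<^sup>2) \<partial>lborel)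
      = (\<integral>x. (\<Sum>i\<in>UNIV. (Dd \<eta> (e1 i) x)\<^sup>2 * (norm (U x))\<^sup>2) \<partial>lborel) + (\<integral>x. (\<Sum>k\<in>UNIV. V x * (Dd \<eta> (e2 k) x)\<^sup>2 * (norm (U x))\<^sup>2) \<partial>lborel)"
      by (rule Bochner_Integration.integral_add; intro Bochner_Integration.integrable_sum iD1 iD2)
    also have "(\<integral>x. (\<Sum>i\<in>UNIV. (Dd \<eta> (e1 i) x)\<^sup>2 * (norm (U x))\<^sup>2) \<partial>lborel) = (\<Sum>i\<in>UNIV. \<integral>x. (Dd \<eta> (e1 i) x)\<^sup>2 * (norm (U x))\<^sup>2 \<partial>lborel)"
      by (rule Bochner_Integration.integral_sum[OF iD1])
    also have "(\<integral>x. (\<Sum>k\<in>UNIV. V x * (Dd \<eta> (e2 k) x)\<^sup>2 * (norm (U x))\<^sup>2) \<partial>lborel) = (\<Sum>k\<in>UNIV. \<integral>x. V x * (Dd \<eta> (e2 k) x)\<^sup>2 * (norm (U x))\<^sup>2 \<partial>lborel)"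
      by (rule Bochner_Integration.integral_sum[OF iD2])
    finally show ?thesis
      by (simp only: sum_distrib_left sum_distrib_right distrib_right mult.assoc)
  qed
  also have "\<dots> \<le> (\<integral>x. \<sigma> * (norm (U x))\<^sup>2 \<partial>lborel)"
  proof (rule Bochner_Integration.integral_mono)
    show "integrable lborel (\<lambda>x. ((\<Sum>i\<in>UNIV. (Dd \<eta> (e1 i) x)\<^sup>2) + V x * (\<Sum>k\<in>UNIV. (Dd \<eta> (e2 k) x)\<^sup>2)) * (norm (U x))\<^sup>2)"
      by (rule integrable_continuous_compact_support[of _ M], intro continuous_intros cD\<eta> cU cV, simp add: D\<eta>0)
    show "((\<Sum>i\<in>UNIV. (Dd \<eta> (e1 i) x)\<^sup>2) + V x * (\<Sum>k\<in>UNIV. (Dd \<eta> (e2 k) x)\<^sup>2)) * (norm (U x))\<^sup>2 \<le> \<sigma> * (norm (U x))\<^sup>2" for x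
      using \<sigma>[of x] by (intro mult_right_mono) (auto simp: V_def)
  qed (use L2_integrable_sq[OF UL] in simp)
  also have "\<dots> = \<sigma> * (L2norm U)\<^sup>2" by (simp add: L2norm_sq)
  also have "\<dots> \<le> \<sigma> * (L2norm u)\<^sup>2"
  proof (intro mult_left_mono power_mono Un L2norm_nonneg)
    \<comment> \<open>Evaluating the gradient bound at the origin shows \<sigma> nonnegative, so the
      norm of U may be enlarged to that of u.\<close>
    have "0 \<le> (\<Sum>j\<in>UNIV. (Dd \<eta> (e1 j) 0)\<^sup>2) + V 0 * (\<Sum>k\<in>UNIV. (Dd \<eta> (e2 k) 0)\<^sup>2)"
      by (intro add_nonneg_nonneg mult_nonneg_nonneg sum_nonneg V0) auto
    then show "0 \<le> \<sigma>" using \<sigma>[of 0] unfolding V_def by linarith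
  qed
  finally have S: "(\<Sum>i\<in>UNIV. \<integral>x. (Dd \<eta> (e1 i) x)\<^sup>2 * (norm (U x))\<^sup>2 \<partial>lborel) + (\<Sum>k\<in>UNIV. \<integral>x. V x * (Dd \<eta> (e2 k) x)\<^sup>2 * (norm (U x))\<^sup>2 \<partial>lborel) \<le> \<sigma> * (L2norm u)\<^sup>2" .
  have S1: "(\<Sum>i\<in>UNIV. - (\<integral>x. (Dd \<eta> (e1 i) x)\<^sup>2 * (norm (U x))\<^sup>2 \<partial>lborel)) \<le> (\<Sum>i\<in>UNIV. Re (- L2inner \<psi> (conv (D1 i) u)))"
    by (intro sum_mono en1)
  have S2: "(\<Sum>k\<in>UNIV. - (\<integral>x. V x * (Dd \<eta> (e2 k) x)\<^sup>2 * (norm (U x))\<^sup>2 \<partial>lborel) - \<omega> * B * (L2norm u)\<^sup>2) \<le> (\<Sum>k\<in>UNIV. Re (- L2inner \<psi> (conv (D2 k) Vu)))"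
    by (intro sum_mono en3)
  have "Re (L2inner (Grushin hom \<kappa> \<phi>) u) = (\<Sum>i\<in>UNIV. Re (- L2inner \<psi> (conv (D1 i) u))) + (\<Sum>k\<in>UNIV. Re (- L2inner \<psi> (conv (D2 k) Vu)))"
    unfolding GI by (simp add: sum_negf)
  then show "- (\<sigma> + real CARD('b) * (\<omega> * B)) * (L2norm u)\<^sup>2 \<le> Re (L2inner (Grushin hom \<kappa> \<phi>) u)"
    using S S1 S2 by (simp add: sum_subtractf sum_negf algebra_simps)
qed

text \<open>The scales n and n^(1 + \<kappa>) follow the dilations of the operator. Where the cutoff
  lives, V is at most of order n^(2 \<kappa>) and squared vertical derivatives are of order n^(-2 -
  2 \<kappa>), so both contributions are of order n^(-2).\<close>

lemma cutoff_gradient: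
  obtains C where "C \<ge> 0" "\<And>n::nat. \<And>x::('a::finite, 'b::finite) pt. n > 0 \<Longrightarrow>
    (\<Sum>j\<in>UNIV. (Dd (\<lambda>z. exp 2 * bump (1 / real n) (1 / real n ^ (1 + \<kappa>)) z) (e1 j) x)\<^sup>2)
    + Vpot hom \<kappa> (fst x) * (\<Sum>k\<in>UNIV. (Dd (\<lambda>z. exp 2 * bump (1 / real n) (1 / real n ^ (1 + \<kappa>)) z) (e2 k) x)\<^sup>2) \<le> C / (real n)\<^sup>2"
proof -
  have "\<And>x::('a, 'b) pt. 2 < norm x \<Longrightarrow> bump 1 1 x = 0" using bump_support[of 1 1] by simp
  from Dd_bounded[OF smooth_bump this]
  obtain B where B: "B > 0" "\<And>x v. \<bar>Dd (bump 1 1 :: ('a, 'b) pt \<Rightarrow> real) v x\<bar> \<le> B * norm v"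
    by blast
  define C where "C = (exp 2 * B)\<^sup>2 * (real CARD('a) + real CARD('a) * real CARD('b))"
  have "(\<Sum>j\<in>UNIV. (Dd (\<lambda>z. exp 2 * bump (1 / real n) (1 / real n ^ (1 + \<kappa>)) z) (e1 j) x)\<^sup>2)
    + Vpot hom \<kappa> (fst x) * (\<Sum>k\<in>UNIV. (Dd (\<lambda>z. exp 2 * bump (1 / real n) (1 / real n ^ (1 + \<kappa>)) z) (e2 k) x)\<^sup>2) \<le> C / (real n)\<^sup>2"
    if n: "n > 0" for n :: nat and x :: "('a, 'b) pt"
  proof -
    define s t where "s = 1 / real n" and "t = 1 / real n ^ (1 + \<kappa>)"
    have st: "s > 0" "t > 0" using n by (auto simp: s_def t_def)
    have D: "\<bar>Dd (\<lambda>z. exp 2 * bump s t z) v x\<bar> \<le> exp 2 * (B * norm (s *\<^sub>R fst v, t *\<^sub>R snd v))" for v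
    proof -
      have "Dd (\<lambda>z. exp 2 * bump s t z) v x = exp 2 * Dd (bump s t) v x"
        by (rule Dd_cmult[OF smooth_differentiable[OF smooth_bump]])
      also have "Dd (bump s t) v x = Dd (bump 1 1) (s *\<^sub>R fst v, t *\<^sub>R snd v) (s *\<^sub>R fst x, t *\<^sub>R snd x)"
        using Ditr_bump_scale[of "[v]" s t x] by simp
      finally show ?thesis
        using B(2)[of "(s *\<^sub>R fst v, t *\<^sub>R snd v)" "(s *\<^sub>R fst x, t *\<^sub>R snd x)"] by (simp add: abs_mult)
    qed
    have D1: "(Dd (\<lambda>z. exp 2 * bump s t z) (e1 j) x)\<^sup>2 \<le> (exp 2 * B)\<^sup>2 * s\<^sup>2" for j
      using power_mono[OF D[of "e1 j"] abs_ge_zero, of 2] st by (simp add: e1_def norm_Pair power_mult_distrib mult_ac)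
    have D2: "(Dd (\<lambda>z. exp 2 * bump s t z) (e2 k) x)\<^sup>2 \<le> (exp 2 * B)\<^sup>2 * t\<^sup>2" for k
      using power_mono[OF D[of "e2 k"] abs_ge_zero, of 2] st by (simp add: e2_def norm_Pair power_mult_distrib mult_ac)
    have "Vpot hom \<kappa> (fst x) * (\<Sum>k\<in>UNIV. (Dd (\<lambda>z. exp 2 * bump s t z) (e2 k) x)\<^sup>2) \<le> (exp 2 * B)\<^sup>2 * (real CARD('a) * real CARD('b)) * s\<^sup>2"
    proof (cases "norm (fst x) \<le> real n")
      case True
      have "Vpot hom \<kappa> (fst x) \<le> real CARD('a) * real n ^ (2 * \<kappa>)"
        using Vpot_le[of hom \<kappa> "fst x"] power_mono[OF True norm_ge_zero, of "2 * \<kappa>"]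
        by (meson mult_left_mono of_nat_0_le_iff order_trans)
      moreover have "(\<Sum>k\<in>(UNIV::'b set). (Dd (\<lambda>z. exp 2 * bump s t z) (e2 k) x)\<^sup>2) \<le> (\<Sum>k\<in>(UNIV::'b set). (exp 2 * B)\<^sup>2 * t\<^sup>2)"
        by (intro sum_mono D2)
      ultimately have "Vpot hom \<kappa> (fst x) * (\<Sum>k\<in>UNIV. (Dd (\<lambda>z. exp 2 * bump s t z) (e2 k) x)\<^sup>2)
          \<le> (real CARD('a) * real n ^ (2 * \<kappa>)) * (\<Sum>k\<in>(UNIV::'b set). (exp 2 * B)\<^sup>2 * t\<^sup>2)"
        by (intro mult_mono) (auto intro: sum_nonneg)
      also have "\<dots> = (exp 2 * B)\<^sup>2 * (real CARD('a) * real CARD('b)) * (real n ^ (2 * \<kappa>) * t\<^sup>2)"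
        by simp
      also have "real n ^ (2 * \<kappa>) * t\<^sup>2 = s\<^sup>2"
        using n by (simp add: s_def t_def power_divide power_mult_distrib power2_eq_square power_add field_simps flip: power_mult_distrib)
          (simp add: power_mult power2_eq_square power_mult_distrib)
      finally show ?thesis .
    next
      case False
      \<comment> \<open>Beyond horizontal radius n the cutoff vanishes on an open set, so the growth
        of V there does no harm.\<close>
      have "Dd (\<lambda>z. exp 2 * bump s t z) (e2 k) x = 0" for k
      proof (rule Dd_zero_open)
        show "open {z :: ('a, 'b) pt. real n < norm (fst z)}" by (intro open_Collect_less continuous_intros)
        show "exp 2 * bump s t z = 0" if "z \<in> {z. real n < norm (fst z)}" for z :: "('a, 'b) pt"
          using that bump_eq_0[OF st, of z] by (simp add: s_def)
      qed (use False in simp)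
      then show ?thesis by simp
    qed
    moreover have "(\<Sum>j\<in>(UNIV::'a set). (Dd (\<lambda>z. exp 2 * bump s t z) (e1 j) x)\<^sup>2) \<le> (\<Sum>j\<in>(UNIV::'a set). (exp 2 * B)\<^sup>2 * s\<^sup>2)"
      by (intro sum_mono D1)
    ultimately have "(\<Sum>j\<in>UNIV. (Dd (\<lambda>z. exp 2 * bump s t z) (e1 j) x)\<^sup>2)
        + Vpot hom \<kappa> (fst x) * (\<Sum>k\<in>UNIV. (Dd (\<lambda>z. exp 2 * bump s t z) (e2 k) x)\<^sup>2) \<le> C * s\<^sup>2"
      by (simp add: C_def algebra_simps)
    then show ?thesis by (simp add: s_def t_def power_divide)
  qed
  moreover have "C \<ge> 0" by (simp add: C_def)
  ultimately show ?thesis using that by blast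
qed

lemma cutoff_tendsto:
  "(\<lambda>n. exp 2 * bump (1 / real (Suc n)) (1 / real (Suc n) ^ (1 + \<kappa>)) z) \<longlonglongrightarrow> 1"
proof -
  have fl: "(\<lambda>n. flat 1 (1 - (X n)\<^sup>2 * c)) \<longlonglongrightarrow> exp (-1)" if "X \<longlonglongrightarrow> 0" for X :: "nat \<Rightarrow> real" and c
  proof -
    have "isCont (flat 1) 1" by (rule DERIV_isCont[OF flat_has_derivative])
    moreover have "(\<lambda>n. 1 - (X n)\<^sup>2 * c) \<longlonglongrightarrow> 1 - 0\<^sup>2 * c" by (intro tendsto_intros that)
    ultimately have "(\<lambda>n. flat 1 (1 - (X n)\<^sup>2 * c)) \<longlonglongrightarrow> flat 1 1"
      using isCont_tendsto_compose by fastforce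
    then show ?thesis by (simp add: flat_def)
  qed
  have X1: "(\<lambda>n. 1 / real (Suc n)) \<longlonglongrightarrow> 0"
    using LIMSEQ_inverse_real_of_nat by (simp add: inverse_eq_divide)
  have X2: "(\<lambda>n. 1 / real (Suc n) ^ (1 + \<kappa>)) \<longlonglongrightarrow> 0"
    using tendsto_power[OF X1, of "1 + \<kappa>"] by (simp add: power_divide power_one_over)
  have "(\<lambda>n. exp 2 * bump (1 / real (Suc n)) (1 / real (Suc n) ^ (1 + \<kappa>)) z) \<longlonglongrightarrow> exp 2 * (exp (-1) * exp (-1))"
    unfolding bump_def by (intro tendsto_intros fl X1 X2)
  then show ?thesis by (simp flip: exp_add)
qed

lemma Vpot_uniform:
  fixes M :: real
  assumes "\<omega> > 0"
  shows "\<exists>s0>0. \<forall>s\<ge>s0. \<forall>x y :: real^'a::finite. norm x \<le> M \<longrightarrow> norm (x - y) \<le> 1 / s \<longrightarrow>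
    \<bar>Vpot hom \<kappa> y - Vpot hom \<kappa> x\<bar> \<le> \<omega>"
proof -
  have "continuous_on (cball 0 (M + 1)) (Vpot hom \<kappa> :: real^'a \<Rightarrow> real)"
    unfolding Vpot_def by (cases hom) (auto intro!: continuous_intros)
  then have "uniformly_continuous_on (cball 0 (M + 1)) (Vpot hom \<kappa> :: real^'a \<Rightarrow> real)"
    by (rule compact_uniformly_continuous) simp
  then obtain e where e: "e > 0" "\<And>x y::real^'a. x \<in> cball 0 (M + 1) \<Longrightarrow> y \<in> cball 0 (M + 1) \<Longrightarrow> dist y x < e \<Longrightarrow> dist (Vpot hom \<kappa> y) (Vpot hom \<kappa> x) < \<omega>"
    unfolding uniformly_continuous_on_def using assms by metis
  have "\<bar>Vpot hom \<kappa> y - Vpot hom \<kappa> x\<bar> \<le> \<omega>"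
    if s: "max 1 (2 / e) \<le> s" and x: "norm x \<le> M" and xy: "norm (x - y) \<le> 1 / s" for s and x y :: "real^'a"
  proof -
    have s0: "s \<ge> 1" "2 / e \<le> s" using s by auto
    have "2 \<le> s * e" using s0 e(1) by (simp add: divide_le_eq)
    then have "1 / s \<le> 1" "1 / s < e" using s0 by (auto simp: divide_le_eq divide_less_eq mult.commute)
    moreover have "norm y \<le> norm x + norm (x - y)"
      using norm_triangle_ineq2[of y x] by (simp add: norm_minus_commute)
    ultimately show ?thesis
      using e(2)[of x y] xy x by (auto simp: dist_norm norm_minus_commute less_imp_le)
  qed
  then show ?thesis by (intro exI[of _ "max 1 (2 / e)"]) auto
qed

text \<open>Regularising \<open>u\<close> at scale \<open>1/s\<close> in the first and \<open>1/t\<close> in the second variables with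
  \<open>1/s\<close> much smaller than \<open>1/t\<close> makes the commutator of the mollifier with the potential negligible.\<close>
lemma spectral_interval_zero:
  fixes u :: "('a::finite, 'b::finite) pt \<Rightarrow> complex"
  assumes E: "spectral_resolution_G hom \<kappa> E" and u: "u \<in> L2" and Eu: "AE x in lborel. E {a..<b} u x = u x"
    and ab: "a < b" "b < 0"
  shows "L2norm u = 0"
proof (rule ccontr)
  assume "L2norm u \<noteq> 0"
  then have N: "L2norm u > 0" using L2norm_nonneg[of u] by linarith
  interpret spectral E using E by unfold_locales (simp add: spectral_resolution_G_def)
  have form: "norm (L2inner (Grushin hom \<kappa> \<phi>) u - complex_of_real a * L2inner \<phi> u) \<le> (b - a) * L2norm u * L2norm \<phi>"
    if "test_fun \<phi>" for \<phi>
    by (rule form_on_interval[where D = "Collect test_fun" and G = "Grushin hom \<kappa>"])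
       (use E that u Eu ab test_fun_dense in \<open>auto simp: spectral_resolution_G_def test_fun_L2 Grushin_test_fun_L2 test_fun_add_cmult Grushin_add_cmult\<close>)
  define N2 where "N2 = (L2norm u)\<^sup>2"
  have N2: "N2 > 0" using N by (simp add: N2_def)
  \<comment> \<open>Chosen so that the accumulated errors, \<epsilon> (- a) + 2 \<epsilon>, stay
    below 3/8 of - b and cannot compensate b.\<close>
  define \<epsilon> where "\<epsilon> = - b / (8 * (1 - a))"
  have \<epsilon>: "\<epsilon> > 0" "\<epsilon> * (- a) \<le> - b / 8" "\<epsilon> \<le> - b / 8"
    using ab by (auto simp: \<epsilon>_def field_simps mult_nonneg_nonneg mult_nonpos_nonpos)
  \<comment> \<open>Two errors of this size, one from cutting off and one from mollifying, cost
    \<epsilon>/2 times the norm of u.\<close>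
  define e where "e = \<epsilon> * L2norm u / 4"
  have e: "e > 0" using \<epsilon> N by (simp add: e_def)
  obtain C where C: "C \<ge> 0" "\<And>n::nat. \<And>x::('a, 'b) pt. n > 0 \<Longrightarrow>
    (\<Sum>j\<in>UNIV. (Dd (\<lambda>z. exp 2 * bump (1 / real n) (1 / real n ^ (1 + \<kappa>)) z) (e1 j) x)\<^sup>2)
    + Vpot hom \<kappa> (fst x) * (\<Sum>k\<in>UNIV. (Dd (\<lambda>z. exp 2 * bump (1 / real n) (1 / real n ^ (1 + \<kappa>)) z) (e2 k) x)\<^sup>2) \<le> C / (real n)\<^sup>2"
    by (rule cutoff_gradient[where hom = hom and \<kappa> = \<kappa>]) (rule that)
  define \<eta> where "\<eta> = (\<lambda>n (z::('a, 'b) pt). exp 2 * bump (1 / real (Suc n)) (1 / real (Suc n) ^ (1 + \<kappa>)) z)"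
  have \<eta>01: "0 \<le> \<eta> n x" "\<eta> n x \<le> 1" for n x
  proof -
    have "exp 2 * bump s t x \<le> exp 2 * exp (-2)" for s t by (intro mult_left_mono bump_le) simp
    then have "exp 2 * bump s t x \<le> 1" for s t by (simp flip: exp_add)
    then show "\<eta> n x \<le> 1" unfolding \<eta>_def .
    show "0 \<le> \<eta> n x" unfolding \<eta>_def by (intro mult_nonneg_nonneg bump_nonneg) simp
  qed
  have \<eta>s: "smooth (\<eta> n)" for n unfolding \<eta>_def by (rule smooth_cmult[OF smooth_bump])
  note [measurable] = L2_measurable[OF u] borel_measurable_continuous_onI[OF smooth_continuous[OF \<eta>s]]
  have "(\<lambda>n. L2norm (\<lambda>x. complex_of_real (\<eta> n x) * u x - u x)) \<longlonglongrightarrow> 0"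
  proof (rule L2norm_dominated_convergence[OF _ L2_integrable_sq[OF u]])
    show "AE x in lborel. (norm (complex_of_real (\<eta> n x) * u x - u x))\<^sup>2 \<le> (norm (u x))\<^sup>2" for n
    proof (intro AE_I2 power_mono norm_ge_zero)
      fix x
      have "complex_of_real (\<eta> n x) * u x - u x = complex_of_real (\<eta> n x - 1) * u x" by (simp add: algebra_simps)
      then have "norm (complex_of_real (\<eta> n x) * u x - u x) = \<bar>\<eta> n x - 1\<bar> * norm (u x)"
        by (simp only: norm_mult norm_of_real)
      also have "\<dots> \<le> norm (u x)" using \<eta>01[of n x] by (intro mult_left_le_one_le) auto
      finally show "norm (complex_of_real (\<eta> n x) * u x - u x) \<le> norm (u x)" .
    qed
    show "AE x in lborel. (\<lambda>n. complex_of_real (\<eta> n x) * u x - u x) \<longlonglongrightarrow> 0"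
    proof (rule AE_I2)
      fix x
      have "(\<lambda>n. complex_of_real (\<eta> n x) * u x - u x) \<longlonglongrightarrow> complex_of_real 1 * u x - u x"
        unfolding \<eta>_def by (intro tendsto_intros cutoff_tendsto)
      then show "(\<lambda>n. complex_of_real (\<eta> n x) * u x - u x) \<longlonglongrightarrow> 0" by simp
    qed
  qed measurable
  then have ev1: "\<forall>\<^sub>F n in sequentially. L2norm (\<lambda>x. complex_of_real (\<eta> n x) * u x - u x) < e"
    using e by (rule order_tendstoD)
  have "(\<lambda>n. C * (inverse (real (Suc n)))\<^sup>2) \<longlonglongrightarrow> C * 0\<^sup>2"
    by (intro tendsto_intros LIMSEQ_inverse_real_of_nat)
  then have ev2: "\<forall>\<^sub>F n in sequentially. C * (inverse (real (Suc n)))\<^sup>2 < \<epsilon>"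
    using \<epsilon>(1) by (intro order_tendstoD) auto
  obtain n where n: "L2norm (\<lambda>x. complex_of_real (\<eta> n x) * u x - u x) < e" "C * (inverse (real (Suc n)))\<^sup>2 < \<epsilon>"
    using eventually_happens'[OF sequentially_bot eventually_conj[OF ev1 ev2]] by blast
  define M where "M = real (Suc n) + real (Suc n) ^ (1 + \<kappa>)"
  have \<eta>0: "\<eta> n x = 0" if "M < norm x" for x
    using bump_support[of "1 / real (Suc n)" "1 / real (Suc n) ^ (1 + \<kappa>)" x] that by (simp add: \<eta>_def M_def del: power_Suc)
  obtain \<delta> where \<delta>: "\<delta> > 0" "\<And>k. mollifier \<delta> k \<Longrightarrow> L2norm (\<lambda>x. conv k u x - u x) < e"
    using mollify_L2[OF u e] by metis
  define t where "t = 2 / \<delta>"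
  have t: "t > 0" using \<delta> by (simp add: t_def)
  have "\<exists>A>0. \<forall>s t. s > 0 \<longrightarrow> t > 0 \<longrightarrow> (\<integral>z. \<bar>Ditr [e2 k, e2 k] (bump_kernel s t) (z::('a, 'b) pt)\<bar> \<partial>lborel) \<le> A * t\<^sup>2" for k :: 'b
    unfolding e2_def by (rule bump_kernel_second_derivative_L1) blast
  then obtain A where A: "\<And>k::'b. A k > 0" "\<And>k s t. s > 0 \<Longrightarrow> t > 0 \<Longrightarrow> (\<integral>z. \<bar>Ditr [e2 k, e2 k] (bump_kernel s t) (z::('a, 'b) pt)\<bar> \<partial>lborel) \<le> A k * t\<^sup>2"
    by metis
  define B where "B = (\<Sum>k\<in>UNIV. A k) * t\<^sup>2"
  have Ak: "A k \<le> (\<Sum>k\<in>UNIV. A k)" for k by (rule member_le_sum) (auto simp: A(1) less_imp_le)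
  have B0: "B > 0" unfolding B_def using t A(1) by (intro mult_pos_pos sum_pos) auto
  define \<omega> where "\<omega> = \<epsilon> / (real CARD('b) * B)"
  have \<omega>: "\<omega> > 0" using \<epsilon> B0 by (simp add: \<omega>_def)
  \<comment> \<open>Order of choice: n fixes the cutoff and M, \<delta> fixes t, and t fixes B and
    \<omega>. None of these involves s, so s may now be made as large as the modulus of continuity
    of V requires.\<close>
  obtain s0 where s0: "s0 > 0" "\<And>s. \<And>x y::real^'a. s \<ge> s0 \<Longrightarrow> norm x \<le> M \<Longrightarrow>
    norm (x - y) \<le> 1 / s \<Longrightarrow> \<bar>Vpot hom \<kappa> y - Vpot hom \<kappa> x\<bar> \<le> \<omega>"
    using Vpot_uniform[OF \<omega>, of M hom \<kappa>] by metis
  define s where "s = max s0 t"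
  have s: "s > 0" "s \<ge> s0" "1 / s + 1 / t \<le> \<delta>"
  proof -
    show "s > 0" "s \<ge> s0" using t by (auto simp: s_def)
    have "1 / s \<le> 1 / t" using t by (intro divide_left_mono) (auto simp: s_def)
    then show "1 / s + 1 / t \<le> \<delta>" by (simp add: t_def)
  qed
  define U where "U = conv (bump_kernel s t) u"
  define \<phi> where "\<phi> = conv (bump_kernel s t) (\<lambda>x. complex_of_real ((\<eta> n x)\<^sup>2) * U x)"
  have mol: "mollifier \<delta> (bump_kernel s t :: ('a, 'b) pt \<Rightarrow> real)" by (rule mollifier_bump_kernel[OF s(1) t s(3)])
  have \<sigma>: "(\<Sum>j\<in>UNIV. (Dd (\<eta> n) (e1 j) x)\<^sup>2) + Vpot hom \<kappa> (fst x) * (\<Sum>k\<in>UNIV. (Dd (\<eta> n) (e2 k) x)\<^sup>2) \<le> \<epsilon>" for x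
    using C(2)[of "Suc n" x] n(2) unfolding \<eta>_def by (simp add: divide_inverse power_inverse del: of_nat_Suc)
  have Bk: "(\<integral>z. \<bar>Ditr [e2 k, e2 k] (bump_kernel s t) (z::('a, 'b) pt)\<bar> \<partial>lborel) \<le> B" for k
    using A(2)[OF s(1) t, of k] mult_right_mono[OF Ak[of k] zero_le_power2[of t]] unfolding B_def by linarith
  note glb = grushin_lower_bound[OF u s(1) t \<eta>s \<eta>0 \<eta>01 \<sigma> _ less_imp_le[OF \<omega>] Bk, folded U_def, folded \<phi>_def]
  have \<omega>': "\<bar>Vpot hom \<kappa> (fst y) - Vpot hom \<kappa> (fst x)\<bar> \<le> \<omega>" if "norm x \<le> M" "norm (fst x - fst y) \<le> 1 / s" for x y :: "('a, 'b) pt"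
    using s0(2)[OF s(2) order_trans[OF _ that(1)] that(2)] norm_fst_le[of "fst x" "snd x"] by simp
  have test: "test_fun \<phi>" and low: "- (\<epsilon> + real CARD('b) * (\<omega> * B)) * (L2norm u)\<^sup>2 \<le> Re (L2inner (Grushin hom \<kappa> \<phi>) u)"
    and inner: "L2inner \<phi> u = complex_of_real ((L2norm (\<lambda>x. complex_of_real (\<eta> n x) * U x))\<^sup>2)" and \<phi>n: "L2norm \<phi> \<le> L2norm u"
    by (rule glb; use \<omega>' in blast)+
  have UL: "U \<in> L2"
    unfolding U_def using mol conv_L2(1)[OF u _ order_refl] by (auto simp: mollifier_def simp del: split_paired_All)
  define r where "r = L2norm (\<lambda>x. complex_of_real (\<eta> n x) * U x)"
  have r: "r \<ge> (1 - \<epsilon> / 2) * L2norm u"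
  proof -
    have \<eta>L: "(\<lambda>x. complex_of_real (\<eta> n x) * f x) \<in> L2" if f: "f \<in> L2" for f
    proof (rule L2_bound[OF f, of _ 1])
      note [measurable] = L2_measurable[OF f]
      show "(\<lambda>x. complex_of_real (\<eta> n x) * f x) \<in> borel_measurable borel" by measurable
      show "norm (complex_of_real (\<eta> n x) * f x) \<le> 1 * norm (f x)" for x
        using \<eta>01[of n x] by (auto simp: norm_mult intro!: mult_left_le_one_le)
    qed
    have "L2norm (\<lambda>x. u x + 0) = L2norm (\<lambda>x. (u x - complex_of_real (\<eta> n x) * u x) + (complex_of_real (\<eta> n x) * u x - complex_of_real (\<eta> n x) * U x) + complex_of_real (\<eta> n x) * U x)"
      by simp
    also have "\<dots> \<le> L2norm (\<lambda>x. (u x - complex_of_real (\<eta> n x) * u x) + (complex_of_real (\<eta> n x) * u x - complex_of_real (\<eta> n x) * U x)) + r"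
      unfolding r_def by (intro L2norm_triangle L2_add L2_diff \<eta>L u UL)
    also have "L2norm (\<lambda>x. (u x - complex_of_real (\<eta> n x) * u x) + (complex_of_real (\<eta> n x) * u x - complex_of_real (\<eta> n x) * U x))
        \<le> L2norm (\<lambda>x. u x - complex_of_real (\<eta> n x) * u x) + L2norm (\<lambda>x. complex_of_real (\<eta> n x) * u x - complex_of_real (\<eta> n x) * U x)"
      by (intro L2norm_triangle L2_diff \<eta>L u UL)
    also have "L2norm (\<lambda>x. u x - complex_of_real (\<eta> n x) * u x) \<le> e"
      using n(1) L2norm_minus_commute[of u] by (simp add: less_imp_le)
    also have "L2norm (\<lambda>x. complex_of_real (\<eta> n x) * u x - complex_of_real (\<eta> n x) * U x) \<le> L2norm (\<lambda>x. U x - u x)"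
    proof (intro L2norm_mono L2_diff \<eta>L u UL AE_I2)
      fix x
      show "norm (complex_of_real (\<eta> n x) * u x - complex_of_real (\<eta> n x) * U x) \<le> norm (U x - u x)"
        using \<eta>01[of n x] unfolding right_diff_distrib[symmetric] norm_mult norm_minus_commute[of "U x"]
        by (intro mult_left_le_one_le) auto
    qed
    also have "\<dots> \<le> e" using \<delta>(2)[OF mol] by (simp add: U_def)
    finally show ?thesis by (simp add: e_def algebra_simps)
  qed
  \<comment> \<open>For \<epsilon> at most 1 this is (1 - \<epsilon>/2)^2 \<ge> 1 - \<epsilon>;
    otherwise the left side is nonpositive.\<close>
  have r2: "(1 - \<epsilon>) * N2 \<le> r\<^sup>2"
  proof (cases "\<epsilon> \<le> 1")
    case True
    have "(1 - \<epsilon>) * N2 \<le> (1 - \<epsilon> / 2)\<^sup>2 * N2"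
      using N2 by (intro mult_right_mono) (auto simp: power2_eq_square algebra_simps)
    also have "\<dots> = ((1 - \<epsilon> / 2) * L2norm u)\<^sup>2" by (simp add: N2_def power_mult_distrib)
    also have "\<dots> \<le> r\<^sup>2" using r True by (intro power_mono) auto
    finally show ?thesis .
  next
    case False
    then have "(1 - \<epsilon>) * N2 \<le> 0" using N2 by (intro mult_nonpos_nonneg) auto
    then show ?thesis using zero_le_power2[of r] by linarith
  qed
  have "\<bar>Re (L2inner (Grushin hom \<kappa> \<phi>) u - complex_of_real a * L2inner \<phi> u)\<bar> \<le> (b - a) * L2norm u * L2norm \<phi>"
    by (rule order_trans[OF abs_Re_le_cmod form[OF test]])
  then have "Re (L2inner (Grushin hom \<kappa> \<phi>) u) \<le> a * r\<^sup>2 + (b - a) * L2norm u * L2norm \<phi>"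
    unfolding inner r_def by simp
  also have "(b - a) * L2norm u * L2norm \<phi> \<le> (b - a) * L2norm u * L2norm u"
    using ab by (intro mult_left_mono \<phi>n) auto
  also have "\<dots> = (b - a) * N2" by (simp add: N2_def power2_eq_square)
  also have "a * r\<^sup>2 \<le> a * ((1 - \<epsilon>) * N2)" using r2 ab by (intro mult_left_mono_neg) auto
  finally have up: "Re (L2inner (Grushin hom \<kappa> \<phi>) u) \<le> a * ((1 - \<epsilon>) * N2) + (b - a) * N2"
    by simp
  have CB: "real CARD('b) * (\<omega> * B) = \<epsilon>" using B0 by (simp add: \<omega>_def)
  \<comment> \<open>On the right a N2 cancels, leaving b N2 - \<epsilon> a N2. This is where the
    length of the window drops out.\<close>
  have "- (\<epsilon> + \<epsilon>) * N2 \<le> a * ((1 - \<epsilon>) * N2) + (b - a) * N2"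
    using order_trans[OF low up] unfolding CB N2_def .
  then have "0 \<le> (b + \<epsilon> * (- a) + 2 * \<epsilon>) * N2" by (simp add: algebra_simps)
  moreover have "b + \<epsilon> * (- a) + 2 * \<epsilon> < 0" using \<epsilon> ab by linarith
  ultimately show False using N2 by (simp add: zero_le_mult_iff)
qed

text \<open>The negative half line is a countable union of windows bounded away from 0 and from
  minus infinity. Idempotence puts E of each window applied to f into the range treated by
  \<open>spectral_interval_zero\<close>, and a countable union of null sets of the spectral measure
  is null.\<close>

lemma spectral_negative_zero:
  fixes f :: "('a::finite, 'b::finite) pt \<Rightarrow> complex"
  assumes E: "spectral_resolution_G hom \<kappa> E" and f: "f \<in> L2"
  shows "L2norm (E {..<0} f) = 0"
proof -
  interpret spectral E using E by unfold_locales (simp add: spectral_resolution_G_def)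
  define A where "A = (\<lambda>n::nat. {- real (Suc n) ..< - inverse (real (Suc n))})"
  have A: "A n \<in> sets borel" for n by (simp add: A_def)
  have z: "L2norm (E (A n) f) = 0" for n
  \<comment> \<open>For n = 0 both endpoints are -1 and the window is empty; proper windows start at
    n = 1.\<close>
  proof (cases "n = 0")
    case True
    then show ?thesis using E_empty[OF f] by (simp add: A_def)
  next
    case False
    have "AE x in lborel. E (A n) (E (A n) f) x = E (A n) f x"
      using E_Int[OF A A f, of n n] by eventually_elim simp
    then have AE: "AE x in lborel. E {- real (Suc n) ..< - inverse (real (Suc n))} (E (A n) f) x = E (A n) f x"
      by (simp only: A_def)
    have lt: "inverse (real (Suc n)) < real (Suc n)"
      using False by (simp add: inverse_less_iff_less[of _ 1, simplified] field_simps) (smt (verit) of_nat_0_less_iff mult_pos_pos)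
    show ?thesis
      by (rule spectral_interval_zero[OF E E_L2[OF A f] AE]) (use lt in auto)
  qed
  have U: "{..<0} = (\<Union>n. A n)"
  proof (intro equalityI subsetI)
    fix x :: real assume "x \<in> {..<0}"
    then have x: "x < 0" by simp
    obtain n where n: "inverse (real (Suc n)) < - x" using reals_Archimedean[of "- x"] x by auto
    obtain m where m: "- x \<le> real m" using real_arch_simple by blast
    have "inverse (real (Suc (max n m))) \<le> inverse (real (Suc n))" by (simp add: le_imp_inverse_le)
    then have "x < - inverse (real (Suc (max n m)))" using n by linarith
    moreover have "- real (Suc (max n m)) \<le> x" using m by simp
    ultimately have "x \<in> A (max n m)" unfolding A_def by simp
    then show "x \<in> (\<Union>n. A n)" by blast
  next
    fix x assume "x \<in> (\<Union>n. A n)"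
    then obtain n where "x < - inverse (real (Suc n))" by (auto simp: A_def)
    moreover have "0 < inverse (real (Suc n))" by simp
    ultimately show "x \<in> {..<0}" unfolding lessThan_iff by linarith
  qed
  have "A n \<in> null_sets (spec_mu E f)" for n
    using A z by (auto simp: null_sets_def emeasure_spec_mu[OF f])
  then have "(\<Union>n. A n) \<in> null_sets (spec_mu E f)" by (rule null_sets_UN)
  then have "ennreal ((L2norm (E {..<0} f))\<^sup>2) = 0"
    unfolding U[symmetric] using emeasure_spec_mu[OF f, of "{..<0}"] by (auto simp: null_sets_def)
  then show ?thesis by (simp add: ennreal_eq_0_iff)
qed

section \<open>Geometry of the control distance\<close>

text \<open>The vertical summand of the distance. At s = 0 the quotient is meant to be infinite,
  whereas division by zero in HOL gives 0, hence the separate branch.\<close>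

definition vert :: "nat \<Rightarrow> real \<Rightarrow> real \<Rightarrow> real" where
  "vert \<kappa> s \<rho> = (if s = 0 then \<rho> powr (1 / (1 + real \<kappa>)) else min (\<rho> / s ^ \<kappa>) (\<rho> powr (1 / (1 + real \<kappa>))))"

lemma dist_k_eq:
  "dist_k \<kappa> x y = norm (fst x - fst y) + vert \<kappa> (norm (fst x) + norm (fst y)) (norm (snd x - snd y))"
  by (simp add: dist_k_def vert_def Let_def)

lemma dist_k_commute: "dist_k \<kappa> x y = dist_k \<kappa> y x"
  by (simp add: dist_k_eq norm_minus_commute add.commute)

lemma vert_nonneg: "0 \<le> s \<Longrightarrow> 0 \<le> \<rho> \<Longrightarrow> 0 \<le> vert \<kappa> s \<rho>"
  by (simp add: vert_def)

lemma vert_0 [simp]: "vert \<kappa> s 0 = 0"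
  by (simp add: vert_def)

lemma norm_fst_le_dist_k: "norm (fst x - fst y) \<le> dist_k \<kappa> x y"
  by (simp add: dist_k_eq vert_nonneg)

lemma dist_k_nonneg: "0 \<le> dist_k \<kappa> x y"
  using norm_fst_le_dist_k[of x y \<kappa>] norm_ge_zero[of "fst x - fst y"] by linarith

lemma dist_k_same_snd: "snd x = snd y \<Longrightarrow> dist_k \<kappa> x y = norm (fst x - fst y)"
  by (simp add: dist_k_eq)

lemma powr_root_less_iff:
  assumes "0 \<le> \<rho>" "0 < m"
  shows "\<rho> powr (1 / (1 + real \<kappa>)) < m \<longleftrightarrow> \<rho> < m ^ Suc \<kappa>"
proof -
  have "(\<rho> powr (1 / (1 + real \<kappa>))) ^ Suc \<kappa> = \<rho>"
  proof (cases "\<rho> = 0")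
    case False
    then have "(\<rho> powr (1 / (1 + real \<kappa>))) ^ Suc \<kappa> = \<rho> powr (1 / (1 + real \<kappa>) * real (Suc \<kappa>))"
      using assms by (simp add: powr_realpow[symmetric] powr_powr del: power_Suc)
    also have "1 / (1 + real \<kappa>) * real (Suc \<kappa>) = 1" by (simp add: field_simps)
    finally show ?thesis using assms False by simp
  qed simp
  then show ?thesis
    using power_mono_iff[of m "\<rho> powr (1 / (1 + real \<kappa>))" "Suc \<kappa>"] assms by (metis less_imp_le not_le powr_ge_zero zero_less_Suc)
qed

text \<open>Roots and quotients disappear: a minimum is below m exactly if one of its entries is.
  The branch s = 0 fits the same formula, since \<kappa> \<ge> 1 makes
  \<open>m * s ^ \<kappa>\<close> equal to 0 there.\<close>

lemma vert_less_iff: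
  assumes "\<kappa> \<ge> 1" "0 \<le> s" "0 \<le> \<rho>" "0 < m"
  shows "vert \<kappa> s \<rho> < m \<longleftrightarrow> \<rho> < m * s ^ \<kappa> \<or> \<rho> < m ^ Suc \<kappa>"
proof (cases "s = 0")
  case True
  then show ?thesis using assms powr_root_less_iff[OF assms(3,4), of \<kappa>] by (simp add: vert_def zero_power)
next
  case False
  then have "\<rho> / s ^ \<kappa> < m \<longleftrightarrow> \<rho> < m * s ^ \<kappa>" using assms by (simp add: divide_less_eq)
  then show ?thesis using False powr_root_less_iff[OF assms(3,4), of \<kappa>] by (simp add: vert_def min_less_iff_disj)
qed

lemma dist_k_less_iff:
  assumes "\<kappa> \<ge> 1"
  shows "dist_k \<kappa> x y < r \<longleftrightarrow> norm (fst x - fst y) < r \<and>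
    (norm (snd x - snd y) < (r - norm (fst x - fst y)) * (norm (fst x) + norm (fst y)) ^ \<kappa>
     \<or> norm (snd x - snd y) < (r - norm (fst x - fst y)) ^ Suc \<kappa>)"
proof (cases "norm (fst x - fst y) < r")
  case True
  have "dist_k \<kappa> x y < r \<longleftrightarrow> vert \<kappa> (norm (fst x) + norm (fst y)) (norm (snd x - snd y)) < r - norm (fst x - fst y)"
    unfolding dist_k_eq by linarith
  also have "\<dots> \<longleftrightarrow> norm (snd x - snd y) < (r - norm (fst x - fst y)) * (norm (fst x) + norm (fst y)) ^ \<kappa>
     \<or> norm (snd x - snd y) < (r - norm (fst x - fst y)) ^ Suc \<kappa>"
    by (rule vert_less_iff) (use assms True in auto)
  finally show ?thesis using True by simp
next
  case False
  then show ?thesis using norm_fst_le_dist_k[of x y \<kappa>] by linarith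
qed

lemma dist_k_measurable [measurable]: "(\<lambda>y. dist_k \<kappa> z y) \<in> borel_measurable borel"
proof -
  have [measurable]: "(\<lambda>y::('a::finite, 'b::finite) pt. norm (fst z - fst y)) \<in> borel_measurable borel"
    "(\<lambda>y::('a, 'b) pt. norm (fst y)) \<in> borel_measurable borel" "(\<lambda>y::('a, 'b) pt. norm (snd z - snd y)) \<in> borel_measurable borel"
    by (intro borel_measurable_continuous_onI continuous_intros)+
  show ?thesis
    unfolding dist_k_eq vert_def by measurable
qed

lemma dball_measurable [measurable]: "dball \<kappa> z r \<in> sets borel"
  unfolding dball_def by measurable

lemma dball_mono: "r \<le> R \<Longrightarrow> dball \<kappa> z r \<subseteq> dball \<kappa> z R"
  by (auto simp: dball_def)

section \<open>Comparison of balls with boxes, and volumes\<close>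

lemma dball_subset_box:
  assumes "\<kappa> \<ge> 1" "r > 0"
  shows "dball \<kappa> x r \<subseteq> ball (fst x) r \<times> ball (snd x) (3 ^ \<kappa> * (r * (max r (norm (fst x))) ^ \<kappa>))"
proof
  fix y assume "y \<in> dball \<kappa> x r"
  then have h: "norm (fst x - fst y) < r" and
    v: "norm (snd x - snd y) < (r - norm (fst x - fst y)) * (norm (fst x) + norm (fst y)) ^ \<kappa>
     \<or> norm (snd x - snd y) < (r - norm (fst x - fst y)) ^ Suc \<kappa>"
    using dist_k_less_iff[OF assms(1), of x y r] by (auto simp: dball_def)
  let ?m = "max r (norm (fst x))"
  have s: "norm (fst x) + norm (fst y) \<le> 3 * ?m"
    using norm_triangle_ineq2[of "fst y" "fst x"] h by (auto simp: norm_minus_commute max_def)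
  have "(r - norm (fst x - fst y)) * (norm (fst x) + norm (fst y)) ^ \<kappa> \<le> r * (3 * ?m) ^ \<kappa>"
    using h s assms(2) by (intro mult_mono power_mono) auto
  moreover have "(r - norm (fst x - fst y)) ^ Suc \<kappa> \<le> r * (3 * ?m) ^ \<kappa>"
  proof -
    have "r - norm (fst x - fst y) \<le> 3 * ?m"
      using max.cobounded1[of r "norm (fst x)"] assms(2) norm_ge_zero[of "fst x - fst y"] by linarith
    then show ?thesis unfolding power_Suc using h assms(2) by (intro mult_mono power_mono) auto
  qed
  ultimately have "norm (snd x - snd y) < 3 ^ \<kappa> * (r * ?m ^ \<kappa>)"
    using v by (auto simp: power_mult_distrib mult_ac)
  then show "y \<in> ball (fst x) r \<times> ball (snd x) (3 ^ \<kappa> * (r * ?m ^ \<kappa>))"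
    using h by (auto simp: mem_Times_iff dist_norm)
qed

lemma box_subset_dball:
  assumes "\<kappa> \<ge> 1" "r > 0"
  shows "ball (fst x) (r / 2) \<times> ball (snd x) ((1 / 2) ^ Suc \<kappa> * (r * (max r (norm (fst x))) ^ \<kappa>)) \<subseteq> dball \<kappa> x r"
proof
  fix y assume "y \<in> ball (fst x) (r / 2) \<times> ball (snd x) ((1 / 2) ^ Suc \<kappa> * (r * (max r (norm (fst x))) ^ \<kappa>))"
  then have h: "norm (fst x - fst y) < r / 2" and v: "norm (snd x - snd y) < (1 / 2) ^ Suc \<kappa> * (r * (max r (norm (fst x))) ^ \<kappa>)"
    by (auto simp: mem_Times_iff dist_norm)
  let ?m = "r - norm (fst x - fst y)"
  have m: "r / 2 \<le> ?m" using h by simp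
  have "norm (snd x - snd y) < ?m * (norm (fst x) + norm (fst y)) ^ \<kappa> \<or> norm (snd x - snd y) < ?m ^ Suc \<kappa>"
  proof (cases "norm (fst x) \<ge> r")
    case True
    have "(1 / 2) ^ Suc \<kappa> * (r * norm (fst x) ^ \<kappa>) \<le> (1 / 2) * (r * norm (fst x) ^ \<kappa>)"
      unfolding power_Suc using assms(2) by (intro mult_right_mono mult_left_le) (auto simp: power_le_one)
    also have "\<dots> = (r / 2) * norm (fst x) ^ \<kappa>" by simp
    also have "\<dots> \<le> ?m * (norm (fst x) + norm (fst y)) ^ \<kappa>"
      using m assms(2) by (intro mult_mono power_mono) auto
    finally show ?thesis using v True by (simp add: max_def)
  next
    case False
    have "(1 / 2) ^ Suc \<kappa> * (r * r ^ \<kappa>) = (r / 2) ^ Suc \<kappa>" by (simp add: power_divide)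
    also have "\<dots> \<le> ?m ^ Suc \<kappa>" using m assms(2) by (intro power_mono) auto
    finally show ?thesis using v False by (simp add: max_def)
  qed
  then show "y \<in> dball \<kappa> x r"
    unfolding dball_def mem_Collect_eq dist_k_less_iff[OF assms(1)] using h assms(2) by auto
qed

text \<open>Up to constants, the volume of a box with horizontal size r and vertical size r max(r,
  |x'|)^\<kappa>, which sandwiches the ball. It does not depend on the second component of the
  centre.\<close>

definition vol :: "nat \<Rightarrow> ('a::finite, 'b::finite) pt \<Rightarrow> real \<Rightarrow> real" where
  "vol \<kappa> x r = r ^ CARD('a) * (r * (max r (norm (fst x))) ^ \<kappa>) ^ CARD('b)"

lemma vol_pos: "r > 0 \<Longrightarrow> vol \<kappa> x r > 0"
  unfolding vol_def by (intro mult_pos_pos zero_less_power) auto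

lemma dball_volume:
  fixes x :: "('a::finite, 'b::finite) pt"
  assumes "\<kappa> \<ge> 1"
  obtains c1 c2 where "0 < c1" "0 < c2"
    "\<And>x::('a, 'b) pt. \<And>r. r > 0 \<Longrightarrow> emeasure lborel (dball \<kappa> x r) = ennreal (measure lborel (dball \<kappa> x r))"
    "\<And>x::('a, 'b) pt. \<And>r. r > 0 \<Longrightarrow> c1 * vol \<kappa> x r \<le> measure lborel (dball \<kappa> x r)"
    "\<And>x::('a, 'b) pt. \<And>r. r > 0 \<Longrightarrow> measure lborel (dball \<kappa> x r) \<le> c2 * vol \<kappa> x r"
proof -
  define u where "u = unit_ball_vol DIM(real^'a) * unit_ball_vol DIM(real^'b)"
  have u: "u > 0" by (simp add: u_def)
  define c1 where "c1 = u * (1 / 2) ^ CARD('a) * ((1 / 2) ^ Suc \<kappa>) ^ CARD('b)"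
  define c2 where "c2 = u * (3 ^ \<kappa>) ^ CARD('b)"
  have up: "emeasure lborel (dball \<kappa> x r) \<le> ennreal (c2 * vol \<kappa> x r)" if r: "r > 0" for x :: "('a, 'b) pt" and r
  proof -
    have "emeasure lborel (dball \<kappa> x r) \<le> emeasure lborel (ball (fst x) r \<times> ball (snd x) (3 ^ \<kappa> * (r * (max r (norm (fst x))) ^ \<kappa>)))"
      by (intro emeasure_mono dball_subset_box[OF assms r]) (auto intro!: borel_open open_Times)
    also have "\<dots> = ennreal (u * r ^ CARD('a) * (3 ^ \<kappa> * (r * (max r (norm (fst x))) ^ \<kappa>)) ^ CARD('b))"
      unfolding u_def using r by (subst emeasure_ball_times) auto
    also have "\<dots> = ennreal (c2 * vol \<kappa> x r)" unfolding c2_def vol_def by (simp add: power_mult_distrib mult_ac)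
    finally show ?thesis .
  qed
  have fin: "emeasure lborel (dball \<kappa> x r) = ennreal (measure lborel (dball \<kappa> x r))" if r: "r > 0" for x :: "('a, 'b) pt" and r
    using up[OF r, of x] by (intro emeasure_eq_ennreal_measure) (auto simp: top_unique)
  have lo: "c1 * vol \<kappa> x r \<le> measure lborel (dball \<kappa> x r)" if r: "r > 0" for x :: "('a, 'b) pt" and r
  proof -
    have "ennreal (c1 * vol \<kappa> x r) = ennreal (u * (r / 2) ^ CARD('a) * ((1 / 2) ^ Suc \<kappa> * (r * (max r (norm (fst x))) ^ \<kappa>)) ^ CARD('b))"
      unfolding c1_def vol_def by (simp add: power_mult_distrib power_divide mult_ac del: power_Suc)
    also have "\<dots> = emeasure lborel (ball (fst x) (r / 2) \<times> ball (snd x) ((1 / 2) ^ Suc \<kappa> * (r * (max r (norm (fst x))) ^ \<kappa>)))"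
      unfolding u_def using r by (subst emeasure_ball_times) (auto simp del: power_Suc)
    also have "\<dots> \<le> emeasure lborel (dball \<kappa> x r)"
      by (intro emeasure_mono box_subset_dball[OF assms r]) simp
    finally show ?thesis unfolding fin[OF r] by (simp add: ennreal_le_iff)
  qed
  have hi: "measure lborel (dball \<kappa> x r) \<le> c2 * vol \<kappa> x r" if r: "r > 0" for x :: "('a, 'b) pt" and r
    using up[OF r, of x] u vol_pos[OF r, of \<kappa> x] unfolding fin[OF r] by (subst (asm) ennreal_le_iff) (auto simp: c2_def)
  show ?thesis
    by (rule that[OF _ _ fin lo hi]) (use u in \<open>auto simp: c1_def c2_def\<close>)
qed

text \<open>Changing centre costs 1 + L in the maximum, and passing from \<rho> to R costs R/\<rho>
  in every length, including each of the \<kappa> factors of the maximum. Counting the factors gives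
  the homogeneous dimension n1 + (1 + \<kappa>) n2 as exponent.\<close>

lemma vol_compare:
  fixes z y :: "('a::finite, 'b::finite) pt"
  assumes r: "0 < \<rho>" "\<rho> \<le> R" and zy: "norm (fst z - fst y) \<le> L * R" and L: "0 \<le> L"
  shows "vol \<kappa> z R \<le> ((1 + L) ^ \<kappa>) ^ CARD('b) * (R / \<rho>) ^ (CARD('a) + (1 + \<kappa>) * CARD('b)) * vol \<kappa> y \<rho>"
proof -
  let ?t = "R / \<rho>"
  have t: "1 \<le> ?t" using r by simp
  have R: "R = ?t * \<rho>" using r by simp
  have "norm (fst z) \<le> norm (fst y) + L * R"
    using zy norm_triangle_ineq2[of "fst z" "fst y"] by linarith
  then have "max R (norm (fst z)) \<le> (1 + L) * max R (norm (fst y))"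
  proof -
    define m where "m = max R (norm (fst y))"
    have "R \<le> m" "norm (fst y) \<le> m" by (simp_all add: m_def)
    moreover have "L * R \<le> L * m" using L \<open>R \<le> m\<close> by (rule mult_left_mono[rotated])
    moreover have "0 \<le> L * m" using L r \<open>R \<le> m\<close> by (intro mult_nonneg_nonneg) auto
    ultimately have "max R (norm (fst z)) \<le> m + L * m"
      using \<open>norm (fst z) \<le> norm (fst y) + L * R\<close> by (intro max.boundedI) linarith+
    then show ?thesis by (simp add: m_def distrib_right)
  qed
  also have "max R (norm (fst y)) \<le> ?t * max \<rho> (norm (fst y))"
  proof (rule max.boundedI)
    show "R \<le> ?t * max \<rho> (norm (fst y))" using r t by (subst R) (intro mult_left_mono; simp)
    have "1 * norm (fst y) \<le> ?t * max \<rho> (norm (fst y))" using t r by (intro mult_mono) auto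
    then show "norm (fst y) \<le> ?t * max \<rho> (norm (fst y))" by simp
  qed
  finally have m: "max R (norm (fst z)) \<le> (1 + L) * (?t * max \<rho> (norm (fst y)))"
    using L by (simp add: mult_left_mono)
  have "vol \<kappa> z R \<le> R ^ CARD('a) * (R * ((1 + L) * (?t * max \<rho> (norm (fst y)))) ^ \<kappa>) ^ CARD('b)"
    unfolding vol_def using r m by (intro mult_left_mono power_mono mult_nonneg_nonneg) auto
  also have "\<dots> = (?t * \<rho>) ^ CARD('a) * ((?t * \<rho>) * ((1 + L) * (?t * max \<rho> (norm (fst y)))) ^ \<kappa>) ^ CARD('b)"
    using r by simp
  also have "\<dots> = ((1 + L) ^ \<kappa>) ^ CARD('b) * (?t ^ CARD('a) * (?t * ?t ^ \<kappa>) ^ CARD('b)) * vol \<kappa> y \<rho>"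
    unfolding vol_def by (simp only: power_mult_distrib mult_ac)
  also have "?t ^ CARD('a) * (?t * ?t ^ \<kappa>) ^ CARD('b) = ?t ^ (CARD('a) + (1 + \<kappa>) * CARD('b))"
    by (simp only: power_add power_mult power_one_right)
  finally show ?thesis .
qed

text \<open>For \<rho> above R the centres are first compared at the common radius R, and
  monotonicity of balls does the rest; the maximum with 1 merges both cases.\<close>

lemma dball_volume_compare:
  assumes "\<kappa> \<ge> 1" "0 \<le> L"
  obtains C where "C > 0" "\<And>(z::('a::finite, 'b::finite) pt) (y::('a, 'b) pt) R \<rho>. 0 < \<rho> \<Longrightarrow> 0 < R \<Longrightarrow> norm (fst z - fst y) \<le> L * R \<Longrightarrow>
    measure lborel (dball \<kappa> z R) \<le> C * (max 1 (R / \<rho>)) ^ (CARD('a) + (1 + \<kappa>) * CARD('b)) * measure lborel (dball \<kappa> y \<rho>)"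
proof -
  let ?Q = "CARD('a) + (1 + \<kappa>) * CARD('b)"
  obtain c1 c2 where c: "0 < c1" "0 < c2" and
    fin: "\<And>x::('a, 'b) pt. \<And>r. r > 0 \<Longrightarrow> emeasure lborel (dball \<kappa> x r) = ennreal (measure lborel (dball \<kappa> x r))" and
    lo: "\<And>x::('a, 'b) pt. \<And>r. r > 0 \<Longrightarrow> c1 * vol \<kappa> x r \<le> measure lborel (dball \<kappa> x r)" and
    hi: "\<And>x::('a, 'b) pt. \<And>r. r > 0 \<Longrightarrow> measure lborel (dball \<kappa> x r) \<le> c2 * vol \<kappa> x r"
    using dball_volume[OF assms(1), where 'a = 'a and 'b = 'b] by metis
  define A where "A = ((1 + L) ^ \<kappa>) ^ CARD('b)"
  have A: "A > 0" using assms(2) by (simp add: A_def add_pos_nonneg)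
  define C where "C = c2 * A / c1"
  have C: "C > 0" using c A by (simp add: C_def)
  have le: "measure lborel (dball \<kappa> z R) \<le> C * (R / \<rho>) ^ ?Q * measure lborel (dball \<kappa> y \<rho>)"
    if "0 < \<rho>" "\<rho> \<le> R" "norm (fst z - fst y) \<le> L * R" for z y :: "('a, 'b) pt" and R \<rho>
  proof -
    have "measure lborel (dball \<kappa> z R) \<le> c2 * vol \<kappa> z R" using that by (intro hi) auto
    also have "\<dots> \<le> c2 * (A * (R / \<rho>) ^ ?Q * vol \<kappa> y \<rho>)"
      unfolding A_def using c vol_compare[OF that assms(2), of \<kappa>] by (intro mult_left_mono) auto
    also have "\<dots> = C * (R / \<rho>) ^ ?Q * (c1 * vol \<kappa> y \<rho>)" using c by (simp add: C_def)
    also have "\<dots> \<le> C * (R / \<rho>) ^ ?Q * measure lborel (dball \<kappa> y \<rho>)"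
      using lo[OF that(1)] C that by (intro mult_left_mono) auto
    finally show ?thesis .
  qed
  have main: "measure lborel (dball \<kappa> z R) \<le> C * (max 1 (R / \<rho>)) ^ ?Q * measure lborel (dball \<kappa> y \<rho>)"
    if that: "0 < \<rho>" "0 < R" "norm (fst z - fst y) \<le> L * R" for z y :: "('a, 'b) pt" and R \<rho>
  proof (cases "\<rho> \<le> R")
    case True
    then show ?thesis using le[OF that(1) True that(3)] that(1) by (simp add: max_def)
  next
    case False
    then have one: "max 1 (R / \<rho>) = 1" using that by (simp add: max_def)
    have zR: "measure lborel (dball \<kappa> z R) \<le> C * measure lborel (dball \<kappa> y R)"
      using le[OF that(2) order_refl that(3)] that(2) by simp
    have mono: "measure lborel (dball \<kappa> y R) \<le> measure lborel (dball \<kappa> y \<rho>)"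
    proof (rule measure_mono_fmeasurable)
      show "dball \<kappa> y R \<subseteq> dball \<kappa> y \<rho>" using False by (intro dball_mono) auto
      show "dball \<kappa> y \<rho> \<in> fmeasurable lborel" using fin[OF that(1), of y] by (intro fmeasurableI) auto
    qed simp
    show ?thesis
      using order_trans[OF zR mult_left_mono[OF mono less_imp_le[OF C]]] unfolding one by (simp only: power_one mult_1_right)
  qed
  show ?thesis by (rule that[OF C main])
qed

section \<open>A mean value estimate for merely differentiable functions\<close>

lemma norm_sum_scaleR_le_sqrt:
  fixes g :: "'i \<Rightarrow> 'c::real_normed_vector"
  assumes "finite I"
  shows "norm (\<Sum>i\<in>I. v i *\<^sub>R g i) \<le> sqrt (\<Sum>i\<in>I. (v i)\<^sup>2) * sqrt (\<Sum>i\<in>I. (norm (g i))\<^sup>2)"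
proof -
  have "norm (\<Sum>i\<in>I. v i *\<^sub>R g i) \<le> (\<Sum>i\<in>I. \<bar>v i\<bar> * \<bar>norm (g i)\<bar>)"
    by (rule order_trans[OF norm_sum]) simp
  also have "\<dots> \<le> L2_set v I * L2_set (\<lambda>i. norm (g i)) I" by (rule L2_set_mult_ineq)
  finally show ?thesis by (simp add: L2_set_def)
qed

lemma norm_vec_eq_sqrt: "norm (v :: real^'n::finite) = sqrt (\<Sum>i\<in>UNIV. (v $ i)\<^sup>2)"
  by (simp add: norm_vec_def L2_set_def)

lemma Xlen_horizontal:
  fixes f :: "('a::finite, 'b::finite) pt \<Rightarrow> 'c::real_normed_vector"
  assumes "f differentiable (at x)"
  shows "norm (Dd f (v, 0) x) \<le> norm v * Xlen \<kappa> f x"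
proof -
  have lin: "linear (\<lambda>v. Dd f v x)"
    using has_derivative_Dd[OF assms] has_derivative_linear by blast
  have "(v, 0) = (\<Sum>j\<in>UNIV. (v $ j) *\<^sub>R (e1 j :: ('a, 'b) pt))"
    by (simp add: prod_eq_iff fst_sum snd_sum e1_def vec_eq_iff axis_def if_distrib sum.delta cong: if_cong)
  then have "Dd f (v, 0) x = (\<Sum>j\<in>UNIV. (v $ j) *\<^sub>R Dd f (e1 j) x)"
    by (simp only: linear_sum[OF lin] linear_cmul[OF lin])
  then have "norm (Dd f (v, 0) x) \<le> norm v * sqrt (\<Sum>j\<in>UNIV. (norm (Dd f (e1 j) x))\<^sup>2)"
    using norm_sum_scaleR_le_sqrt[of UNIV "\<lambda>j. v $ j" "\<lambda>j. Dd f (e1 j) x"] by (simp add: norm_vec_eq_sqrt)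
  also have "\<dots> \<le> norm v * Xlen \<kappa> f x"
    unfolding Xlen_def by (intro mult_left_mono real_sqrt_le_mono) (auto intro!: sum_nonneg)
  finally show ?thesis .
qed

lemma finite_mindex: "finite (mindex \<kappa> :: ('a::finite \<Rightarrow> nat) set)"
proof (rule finite_subset)
  show "mindex \<kappa> \<subseteq> (PiE UNIV (\<lambda>_::'a. {..\<kappa>}))"
    by (auto simp: mindex_def PiE_def extensional_def intro: member_le_sum[of _ UNIV, simplified])
qed (intro finite_PiE; simp)

text \<open>Take the coordinate i of largest modulus. Its pure power x_i^\<kappa> is one of the
  monomials of degree \<kappa> in \<open>Xlen\<close>, and |x'| is at most n1 |x_i|; this is the
  source of the constant \<open>real CARD('a) ^ \<kappa>\<close>.\<close>

lemma Xlen_vertical: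
  fixes f :: "('a::finite, 'b::finite) pt \<Rightarrow> 'c::real_normed_vector"
  assumes "f differentiable (at x)"
  shows "norm (fst x) ^ \<kappa> * norm (Dd f (0, w) x) \<le> real CARD('a) ^ \<kappa> * norm w * Xlen \<kappa> f x"
proof -
  let ?S = "sqrt (\<Sum>k\<in>UNIV. (norm (Dd f (e2 k) x))\<^sup>2)"
  have lin: "linear (\<lambda>v. Dd f v x)"
    using has_derivative_Dd[OF assms] has_derivative_linear by blast
  have "(0, w) = (\<Sum>k\<in>UNIV. (w $ k) *\<^sub>R (e2 k :: ('a, 'b) pt))"
    by (simp add: prod_eq_iff fst_sum snd_sum e2_def vec_eq_iff axis_def if_distrib sum.delta cong: if_cong)
  then have "Dd f (0, w) x = (\<Sum>k\<in>UNIV. (w $ k) *\<^sub>R Dd f (e2 k) x)"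
    by (simp only: linear_sum[OF lin] linear_cmul[OF lin])
  then have D: "norm (Dd f (0, w) x) \<le> norm w * ?S"
    using norm_sum_scaleR_le_sqrt[of UNIV "\<lambda>k. w $ k" "\<lambda>k. Dd f (e2 k) x"] by (simp add: norm_vec_eq_sqrt)
  obtain i where i: "norm (fst x) \<le> real CARD('a) * \<bar>fst x $ i\<bar>"
  proof -
    have "Max (range (\<lambda>j. \<bar>fst x $ j\<bar>)) \<in> range (\<lambda>j. \<bar>fst x $ j\<bar>)" by (rule Max_in) auto
    then obtain i where "Max (range (\<lambda>j. \<bar>fst x $ j\<bar>)) = \<bar>fst x $ i\<bar>" by blast
    moreover have "\<bar>fst x $ j\<bar> \<le> Max (range (\<lambda>j. \<bar>fst x $ j\<bar>))" for j by (rule Max_ge) auto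
    ultimately have i: "\<bar>fst x $ j\<bar> \<le> \<bar>fst x $ i\<bar>" for j by simp
    have "norm (fst x) \<le> (\<Sum>j\<in>UNIV. \<bar>fst x $ j\<bar>)" by (rule norm_le_l1_cart)
    also have "\<dots> \<le> (\<Sum>j\<in>(UNIV::'a set). \<bar>fst x $ i\<bar>)" by (intro sum_mono i)
    finally show ?thesis using that by simp
  qed
  define \<alpha> where "\<alpha> = (\<lambda>j. if j = i then \<kappa> else 0)"
  have \<alpha>: "\<alpha> \<in> mindex \<kappa>" by (simp add: \<alpha>_def mindex_def sum.delta)
  have mono: "mono_x \<alpha> (fst x) = (fst x $ i) ^ \<kappa>"
    unfolding mono_x_def \<alpha>_def by (simp add: if_distrib prod.delta cong: if_cong)
  have "\<bar>fst x $ i\<bar> ^ \<kappa> * ?S = sqrt (\<Sum>k\<in>UNIV. (norm (mono_x \<alpha> (fst x) *\<^sub>R Dd f (e2 k) x))\<^sup>2)"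
    by (simp add: mono power_mult_distrib real_sqrt_mult power_abs flip: sum_distrib_left)
  also have "\<dots> \<le> sqrt (\<Sum>\<alpha>\<in>mindex \<kappa>. \<Sum>k\<in>UNIV. (norm (mono_x \<alpha> (fst x) *\<^sub>R Dd f (e2 k) x))\<^sup>2)"
    by (intro real_sqrt_le_mono member_le_sum[OF \<alpha>, of "\<lambda>\<alpha>. \<Sum>k\<in>UNIV. (norm (mono_x \<alpha> (fst x) *\<^sub>R Dd f (e2 k) x))\<^sup>2"] finite_mindex sum_nonneg) auto
  also have "\<dots> \<le> Xlen \<kappa> f x"
    unfolding Xlen_def by (intro real_sqrt_le_mono) (auto intro!: sum_nonneg)
  finally have X: "\<bar>fst x $ i\<bar> ^ \<kappa> * ?S \<le> Xlen \<kappa> f x" .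
  have "norm (fst x) ^ \<kappa> * norm (Dd f (0, w) x) \<le> (real CARD('a) * \<bar>fst x $ i\<bar>) ^ \<kappa> * (norm w * ?S)"
    using i D by (intro mult_mono power_mono) auto
  also have "\<dots> = real CARD('a) ^ \<kappa> * norm w * (\<bar>fst x $ i\<bar> ^ \<kappa> * ?S)" by (simp add: power_mult_distrib)
  also have "\<dots> \<le> real CARD('a) ^ \<kappa> * norm w * Xlen \<kappa> f x" using X by (intro mult_left_mono) auto
  finally show ?thesis .
qed

text \<open>The one-variable mean value inequality replaces integration of the gradient, so
  continuity of the derivative does not enter.\<close>

lemma segment_bound:
  fixes f :: "'p::real_normed_vector \<Rightarrow> 'c::real_normed_vector"
  assumes f: "\<And>x. f differentiable (at x)" and B: "\<And>t. 0 \<le> t \<Longrightarrow> t \<le> 1 \<Longrightarrow> norm (Dd f v (a + t *\<^sub>R v)) \<le> B"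
  shows "norm (f (a + v) - f a) \<le> B"
proof -
  have d: "((\<lambda>t. f (a + t *\<^sub>R v)) has_derivative (\<lambda>h. h *\<^sub>R Dd f v (a + t *\<^sub>R v))) (at t within {0..1})" for t
  proof -
    have "((\<lambda>t. a + t *\<^sub>R v) has_derivative (\<lambda>h. h *\<^sub>R v)) (at t within {0..1})"
      by (auto intro!: derivative_eq_intros)
    from has_derivative_compose[OF this has_derivative_Dd[OF f]] show ?thesis
      by (simp add: Dd_scale[OF f])
  qed
  have "norm ((\<lambda>t. f (a + t *\<^sub>R v)) 1 - (\<lambda>t. f (a + t *\<^sub>R v)) 0) \<le> B * norm (1 - 0 :: real)"
  proof (rule differentiable_bound[OF _ d])
    fix t :: real assume t: "t \<in> {0..1}"
    show "onorm (\<lambda>h. h *\<^sub>R Dd f v (a + t *\<^sub>R v)) \<le> B"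
    proof (rule onorm_le)
      show "norm (h *\<^sub>R Dd f v (a + t *\<^sub>R v)) \<le> B * norm h" for h
        using mult_right_mono[OF B[of t], of "\<bar>h\<bar>"] t by (simp add: mult.commute)
    qed
  qed auto
  then show ?thesis by simp
qed

text \<open>Walk from \<open>z\<close> to \<open>(q, snd z)\<close>, then to \<open>(q, snd y)\<close>, then to \<open>y\<close>.\<close>
lemma three_segment_bound:
  fixes f :: "('a::finite, 'b::finite) pt \<Rightarrow> 'c::real_normed_vector"
  assumes C0: "C0 > 1" and tri: "\<And>x y z :: ('a, 'b) pt. dist_k \<kappa> x y \<le> C0 * (dist_k \<kappa> x z + dist_k \<kappa> z y)"
    and f: "\<And>x. f differentiable (at x)" and zy: "dist_k \<kappa> z y < r"
    and N: "\<And>p. dist_k \<kappa> z p < 2 * C0 * r \<Longrightarrow> Xlen \<kappa> f p \<le> N"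
    and q: "norm (q - fst z) \<le> r" "norm (q - fst y) \<le> r"
    and vert: "\<And>t. 0 \<le> t \<Longrightarrow> t \<le> 1 \<Longrightarrow> dist_k \<kappa> z (q, snd z + t *\<^sub>R (snd y - snd z)) < 2 * C0 * r"
    and len: "norm (snd y - snd z) \<le> 2 ^ \<kappa> * r * norm q ^ \<kappa>"
  shows "norm (f y - f z) \<le> (2 + (2 * real CARD('a)) ^ \<kappa>) * r * N"
proof -
  have r: "r > 0" using zy dist_k_nonneg[of \<kappa> z y] by linarith
  have r2: "r < 2 * C0 * r" using C0 r by simp
  have "0 \<le> Xlen \<kappa> f z" unfolding Xlen_def by (intro real_sqrt_ge_zero add_nonneg_nonneg sum_nonneg) auto
  moreover have "dist_k \<kappa> z z < 2 * C0 * r" using r2 r by (simp add: dist_k_same_snd)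
  ultimately have N0: "0 \<le> N" using N[of z] by linarith
  have 1: "norm (f (z + (q - fst z, 0)) - f z) \<le> r * N"
  proof (rule segment_bound[OF f])
    fix t :: real assume t: "0 \<le> t" "t \<le> 1"
    let ?p = "z + t *\<^sub>R (q - fst z, 0)"
    have "dist_k \<kappa> z ?p = t * norm (q - fst z)" using t by (subst dist_k_same_snd) (auto simp: norm_minus_commute)
    also have "\<dots> \<le> 1 * r" using t q r by (intro mult_mono) auto
    finally have "Xlen \<kappa> f ?p \<le> N" using r2 by (intro N) simp
    have "norm (Dd f (q - fst z, 0) ?p) \<le> norm (q - fst z) * Xlen \<kappa> f ?p" by (rule Xlen_horizontal[OF f])
    also have "\<dots> \<le> r * N" using q r N0 \<open>Xlen \<kappa> f ?p \<le> N\<close> by (intro mult_mono) (auto simp: Xlen_def intro!: add_nonneg_nonneg sum_nonneg)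
    finally show "norm (Dd f (q - fst z, 0) ?p) \<le> r * N" .
  qed
  have 2: "norm (f ((q, snd z) + (0, snd y - snd z)) - f (q, snd z)) \<le> (2 * real CARD('a)) ^ \<kappa> * r * N"
  proof (rule segment_bound[OF f])
    fix t :: real assume t: "0 \<le> t" "t \<le> 1"
    let ?p = "(q, snd z) + t *\<^sub>R (0, snd y - snd z)"
    have X: "Xlen \<kappa> f ?p \<le> N" using vert[OF t] by (intro N) simp
    show "norm (Dd f (0, snd y - snd z) ?p) \<le> (2 * real CARD('a)) ^ \<kappa> * r * N"
    \<comment> \<open>A nonzero vertical displacement forces |q| > 0 through the hypothesis on its
      length, so |q|^\<kappa> may be cancelled. A zero displacement is treated apart because q may
      then be the origin.\<close>
    proof (cases "snd y - snd z = 0")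
      case True
      have "Dd f 0 ?p = 0" using linear_0[OF has_derivative_linear[OF has_derivative_Dd[OF f]]] .
      then show ?thesis using True r N0 by (simp add: zero_prod_def)
    next
      case False
      then have "0 < 2 ^ \<kappa> * r * norm q ^ \<kappa>" using len by (meson le_less_trans not_le zero_less_norm_iff less_le_trans)
      then have q0: "norm q ^ \<kappa> > 0" using r by (simp add: zero_less_mult_iff)
      have "norm q ^ \<kappa> * norm (Dd f (0, snd y - snd z) ?p) \<le> real CARD('a) ^ \<kappa> * norm (snd y - snd z) * Xlen \<kappa> f ?p"
        using Xlen_vertical[OF f, of ?p \<kappa> "snd y - snd z"] by simp
      also have "\<dots> \<le> real CARD('a) ^ \<kappa> * (2 ^ \<kappa> * r * norm q ^ \<kappa>) * N"
        using len X r by (intro mult_mono) (auto simp: Xlen_def intro!: add_nonneg_nonneg sum_nonneg)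
      also have "\<dots> = norm q ^ \<kappa> * ((2 * real CARD('a)) ^ \<kappa> * r * N)" by (simp add: power_mult_distrib)
      finally show ?thesis using q0 by (simp add: mult_le_cancel_left_pos)
    qed
  qed
  have 3: "norm (f (y + (q - fst y, 0)) - f y) \<le> r * N"
  proof (rule segment_bound[OF f])
    fix t :: real assume t: "0 \<le> t" "t \<le> 1"
    let ?p = "y + t *\<^sub>R (q - fst y, 0)"
    have "dist_k \<kappa> y ?p = t * norm (q - fst y)" using t by (subst dist_k_same_snd) (auto simp: norm_minus_commute)
    also have "\<dots> \<le> 1 * r" using t q r by (intro mult_mono) auto
    finally have "dist_k \<kappa> z y + dist_k \<kappa> y ?p < 2 * r" using zy by simp
    then have "C0 * (dist_k \<kappa> z y + dist_k \<kappa> y ?p) < C0 * (2 * r)" using C0 by (intro mult_strict_left_mono) auto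
    then have "Xlen \<kappa> f ?p \<le> N" using tri[of z ?p y] by (intro N) simp
    have "norm (Dd f (q - fst y, 0) ?p) \<le> norm (q - fst y) * Xlen \<kappa> f ?p" by (rule Xlen_horizontal[OF f])
    also have "\<dots> \<le> r * N" using q r N0 \<open>Xlen \<kappa> f ?p \<le> N\<close> by (intro mult_mono) (auto simp: Xlen_def intro!: add_nonneg_nonneg sum_nonneg)
    finally show "norm (Dd f (q - fst y, 0) ?p) \<le> r * N" .
  qed
  have e: "z + (q - fst z, 0) = (q, snd z)" "(q, snd z) + (0, snd y - snd z) = (q, snd y)" "y + (q - fst y, 0) = (q, snd y)"
    by (auto simp: prod_eq_iff)
  have "f y - f z = (f (q, snd z) - f z) + ((f (q, snd y) - f (q, snd z)) - (f (q, snd y) - f y))" by simp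
  also have "norm \<dots> \<le> norm (f (q, snd z) - f z) + (norm (f (q, snd y) - f (q, snd z)) + norm (f (q, snd y) - f y))"
    by (rule order_trans[OF norm_triangle_ineq add_left_mono[OF norm_triangle_ineq4]])
  finally show ?thesis
    using 1 2 3 unfolding e by (simp add: algebra_simps)
qed

text \<open>The two entries of the minimum in the distance suggest two choices of q. If the quotient
  entry is small, q is the longer of the two horizontal components, so that their norms sum to at
  most 2 |q|. If the root entry is small, q is reached by moving away from the origin by the
  remaining radius, making |q| large enough for the vertical step.\<close>

lemma mean_value_bound:
  fixes f :: "('a::finite, 'b::finite) pt \<Rightarrow> 'c::real_normed_vector"
  assumes \<kappa>: "\<kappa> \<ge> 1" and C0: "C0 > 1" and tri: "\<And>x y z :: ('a, 'b) pt. dist_k \<kappa> x y \<le> C0 * (dist_k \<kappa> x z + dist_k \<kappa> z y)"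
    and f: "\<And>x. f differentiable (at x)" and zy: "dist_k \<kappa> z y < r"
    and N: "\<And>p. dist_k \<kappa> z p < 2 * C0 * r \<Longrightarrow> Xlen \<kappa> f p \<le> N"
  shows "norm (f y - f z) \<le> (2 + (2 * real CARD('a)) ^ \<kappa>) * r * N"
proof -
  let ?m = "r - norm (fst z - fst y)" and ?s = "norm (fst z) + norm (fst y)" and ?L = "norm (snd z - snd y)"
  note conc = three_segment_bound[OF C0 tri f zy N]
  have m: "0 < ?m" "?m \<le> r" and alt: "?L < ?m * ?s ^ \<kappa> \<or> ?L < ?m ^ Suc \<kappa>"
    using zy unfolding dist_k_less_iff[OF \<kappa>] by auto
  have r: "r > 0" using m by linarith
  have C0r: "r < C0 * r" using C0 r by simp
  have part: "norm (t *\<^sub>R (snd y - snd z)) \<le> ?L" if "0 \<le> t" "t \<le> 1" for t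
    using that by (simp add: norm_minus_commute mult_left_le_one_le)
  from alt show ?thesis
  proof
    assume L: "?L < ?m * ?s ^ \<kappa>"
    show ?thesis
    proof (cases "norm (fst y) \<le> norm (fst z)")
      case True
      have s: "?s ^ \<kappa> \<le> (2 * norm (fst z)) ^ \<kappa>" using True by (intro power_mono) auto
      have L': "?L < ?m * (norm (fst z) + norm (fst z)) ^ \<kappa>"
        using L mult_left_mono[OF s less_imp_le[OF m(1)]] unfolding mult_2 by linarith
      then have Lr: "?L < r * (norm (fst z) + norm (fst z)) ^ \<kappa>"
        using mult_right_mono[OF m(2) zero_le_power[of "norm (fst z) + norm (fst z)" \<kappa>]] by (meson add_nonneg_nonneg norm_ge_zero less_le_trans)
      show ?thesis
      proof (rule conc[of "fst z"])
        show "dist_k \<kappa> z (fst z, snd z + t *\<^sub>R (snd y - snd z)) < 2 * C0 * r" if t: "0 \<le> t" "t \<le> 1" for t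
        proof -
          have "dist_k \<kappa> z (fst z, snd z + t *\<^sub>R (snd y - snd z)) < r"
            unfolding dist_k_less_iff[OF \<kappa>]
            using le_less_trans[OF part[OF t] Lr] r by (simp add: norm_minus_commute)
          then show ?thesis using C0r r by linarith
        qed
        have "?L \<le> r * (2 * norm (fst z)) ^ \<kappa>"
          using Lr unfolding mult_2 by simp
        then show "norm (snd y - snd z) \<le> 2 ^ \<kappa> * r * norm (fst z) ^ \<kappa>"
          by (simp add: norm_minus_commute power_mult_distrib mult_ac)
      qed (use m r in \<open>auto simp: norm_minus_commute\<close>)
    next
      case False
      have s: "?s ^ \<kappa> \<le> (2 * norm (fst y)) ^ \<kappa>" using False by (intro power_mono) auto
      have L': "?L < ?m * (norm (fst y) + norm (fst y)) ^ \<kappa>"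
        using L mult_left_mono[OF s less_imp_le[OF m(1)]] unfolding mult_2 by linarith
      then have Lr: "?L < r * (norm (fst y) + norm (fst y)) ^ \<kappa>"
        using mult_right_mono[OF m(2) zero_le_power[of "norm (fst y) + norm (fst y)" \<kappa>]] by (meson add_nonneg_nonneg norm_ge_zero less_le_trans)
      show ?thesis
      proof (rule conc[of "fst y"])
        show "dist_k \<kappa> z (fst y, snd z + t *\<^sub>R (snd y - snd z)) < 2 * C0 * r" if t: "0 \<le> t" "t \<le> 1" for t
        proof -
          let ?p = "(fst y, snd z + t *\<^sub>R (snd y - snd z))"
          have "snd y - snd ?p = (1 - t) *\<^sub>R (snd y - snd z)" by (simp add: algebra_simps)
          then have "norm (snd y - snd ?p) \<le> ?L" using part[of "1 - t"] t by simp
          then have "dist_k \<kappa> y ?p < r"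
            unfolding dist_k_less_iff[OF \<kappa>]
            using le_less_trans[OF _ Lr, of "norm (snd y - snd ?p)"] r by simp
          then have "C0 * (dist_k \<kappa> z y + dist_k \<kappa> y ?p) < C0 * (r + r)" using C0 zy by (intro mult_strict_left_mono add_strict_mono) auto
          then show ?thesis using tri[of z ?p y] by simp
        qed
        have "?L \<le> r * (2 * norm (fst y)) ^ \<kappa>"
          using Lr unfolding mult_2 by simp
        then show "norm (snd y - snd z) \<le> 2 ^ \<kappa> * r * norm (fst y) ^ \<kappa>"
          by (simp add: norm_minus_commute power_mult_distrib mult_ac)
      qed (use m r in \<open>auto simp: norm_minus_commute\<close>)
    qed
  next
    assume L: "?L < ?m ^ Suc \<kappa>"
    \<comment> \<open>Moving radially outwards; from the origin any direction serves.\<close>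
    obtain q where q: "norm q = norm (fst z) + ?m" "norm (q - fst z) = ?m"
    proof (cases "fst z = 0")
      case True
      obtain q :: "real^'a" where "norm q = ?m" using vector_choose_size[of ?m] m by auto
      then show ?thesis using that True by simp
    next
      case False
      let ?q = "(1 + ?m / norm (fst z)) *\<^sub>R fst z"
      have "norm ?q = norm (fst z) + ?m" using False m by (simp add: distrib_right)
      moreover have "?q - fst z = (?m / norm (fst z)) *\<^sub>R fst z" by (simp add: algebra_simps)
      then have "norm (?q - fst z) = ?m" using False m by simp
      ultimately show ?thesis using that by blast
    qed
    show ?thesis
    proof (rule conc[of q])
      show "norm (q - fst z) \<le> r" using q m by simp
      show "norm (q - fst y) \<le> r" using norm_triangle_ineq[of "q - fst z" "fst z - fst y"] q by simp
      show "dist_k \<kappa> z (q, snd z + t *\<^sub>R (snd y - snd z)) < 2 * C0 * r" if t: "0 \<le> t" "t \<le> 1" for t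
      proof -
        have "?m ^ Suc \<kappa> \<le> (2 * r - ?m) ^ Suc \<kappa>" using m by (intro power_mono) auto
        have "dist_k \<kappa> z (q, snd z + t *\<^sub>R (snd y - snd z)) < 2 * r"
        proof -
          have "norm (fst z - q) = ?m" using q by (simp add: norm_minus_commute)
          moreover have "?m < 2 * r" using m r by linarith
          moreover have "norm (t *\<^sub>R (snd y - snd z)) < (2 * r - ?m) ^ Suc \<kappa>"
            using le_less_trans[OF part[OF t] L] \<open>?m ^ Suc \<kappa> \<le> (2 * r - ?m) ^ Suc \<kappa>\<close> by (rule less_le_trans)
          moreover have "snd z - (snd z + t *\<^sub>R (snd y - snd z)) = - (t *\<^sub>R (snd y - snd z))" by simp
          ultimately show ?thesis
            unfolding dist_k_less_iff[OF \<kappa>] fst_conv snd_conv by (simp only: norm_minus_cancel simp_thms)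
        qed
        then show ?thesis using C0r by linarith
      qed
      have "?m ^ \<kappa> \<le> norm q ^ \<kappa>" using q m by (intro power_mono) auto
      then have "?m * ?m ^ \<kappa> \<le> r * norm q ^ \<kappa>" using m r by (intro mult_mono) auto
      also have "\<dots> \<le> 2 ^ \<kappa> * (r * norm q ^ \<kappa>)"
    proof -
      have "1 * (r * norm q ^ \<kappa>) \<le> 2 ^ \<kappa> * (r * norm q ^ \<kappa>)" using r by (intro mult_right_mono) auto
      then show ?thesis by simp
    qed
      finally show "norm (snd y - snd z) \<le> 2 ^ \<kappa> * r * norm q ^ \<kappa>"
        using L by (simp add: norm_minus_commute)
    qed
  qed
qed

section \<open>Kernel estimates\<close>

text \<open>For positive t and \<theta> this is min(t, 1/t)^\<theta>. Decay on both sides makes it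
  summable along any geometric progression, with a bound independent of the starting point.\<close>

definition tent :: "real \<Rightarrow> real \<Rightarrow> real" where
  "tent \<theta> t = (if 1 \<le> t then t powr (- \<theta>) else t powr \<theta>)"

lemma tent_nonneg: "0 \<le> tent \<theta> t"
  by (simp add: tent_def)

text \<open>The sum telescopes against \<open>F x = (if x < 1 then x else 2 - 1 / x)\<close>.\<close>
lemma sum_tent_geometric:
  fixes Q x :: real
  assumes Q: "Q > 1" and x: "x > 0"
  shows "(\<Sum>k<n. (if 1 \<le> Q ^ k * x then 1 / (Q ^ k * x) else Q ^ k * x)) \<le> 2 / (1 - 1 / Q)"
proof -
  define F where "F = (\<lambda>x::real. if x < 1 then x else 2 - 1 / x)"
  define G where "G = (\<lambda>x::real. if 1 \<le> x then 1 / x else x)"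
  have Q1: "0 < 1 - 1 / Q" using Q by simp
  have step: "(1 - 1 / Q) * G y \<le> F (Q * y) - F y" if y: "y > 0" for y
  proof (cases "1 \<le> y")
    case True
    then have "1 \<le> Q * y" using Q mult_mono[of 1 Q 1 y] by simp
    then show ?thesis using True Q by (simp add: F_def G_def field_simps)
  next
    case y1: False
    show ?thesis
    proof (cases "Q * y < 1")
      case True
      have "2 \<le> Q + 1 / Q"
      proof -
        have "0 \<le> (Q - 1)\<^sup>2 / Q" using Q by simp
        then show ?thesis using Q by (simp add: power2_eq_square field_simps)
      qed
      then have "(1 - 1 / Q) * y \<le> (Q - 1) * y" using y by (intro mult_right_mono) auto
      then show ?thesis using True y1 by (simp add: F_def G_def algebra_simps)
    next
      case False
      \<comment> \<open>Here y < 1 \<le> Q y, so the step crosses the peak. The slack of the claim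
        factors as displayed, with both factors of the numerator nonnegative.\<close>
      have "0 \<le> (1 - y) * (2 * (Q * y) - 1 - y) / (Q * y)"
        using False y1 y Q by (intro divide_nonneg_pos mult_nonneg_nonneg) auto
      also have "\<dots> = 2 - 1 / (Q * y) - y - (1 - 1 / Q) * y"
        using y Q by (simp add: field_simps power2_eq_square)
      finally show ?thesis using False y1 by (simp add: F_def G_def)
    qed
  qed
  have "(1 - 1 / Q) * (\<Sum>k<n. G (Q ^ k * x)) \<le> F (Q ^ n * x) - F x"
  proof (induction n)
    case (Suc n)
    have "(1 - 1 / Q) * G (Q ^ n * x) \<le> F (Q ^ Suc n * x) - F (Q ^ n * x)"
      using step[of "Q ^ n * x"] Q x by (simp add: mult.assoc)
    then show ?case using Suc by (simp add: distrib_left)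
  qed simp
  also have "\<dots> \<le> 2"
  proof -
    have "0 < Q ^ n * x" using Q x by simp
    then have "F (Q ^ n * x) \<le> 2" by (simp add: F_def)
    moreover have "0 \<le> F x" using x by (auto simp: F_def not_less divide_le_eq)
    ultimately show ?thesis by simp
  qed
  finally show ?thesis unfolding pos_le_divide_eq[OF Q1] G_def by (simp only: mult.commute[of _ "1 - 1 / Q"])
qed

text \<open>The substitution Q = q^\<theta> reduces to exponent 1. Later q = sqrt 2 serves the sum
  over the spectral index j, and q = 2 the sum over annuli.\<close>

lemma suminf_tent:
  assumes "q > 1" "\<theta> > 0"
  obtains S where "S > 0" "\<And>R. R > 0 \<Longrightarrow> (\<Sum>k. ennreal (tent \<theta> (q ^ k * R))) \<le> ennreal S"
proof -
  define Q where "Q = q powr \<theta>"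
  have Q: "Q > 1" unfolding Q_def using assms by (simp add: gr_one_powr)
  define S where "S = 2 / (1 - 1 / Q)"
  have S: "S > 0" using Q by (simp add: S_def)
  have "(\<Sum>k. ennreal (tent \<theta> (q ^ k * R))) \<le> ennreal S" if R: "R > 0" for R
  proof (rule suminf_le_const)
    fix n
    have "tent \<theta> (q ^ k * R) = (if 1 \<le> Q ^ k * R powr \<theta> then 1 / (Q ^ k * R powr \<theta>) else Q ^ k * R powr \<theta>)" for k
    proof -
      have p: "0 < q ^ k * R" using assms R by simp
      have e: "Q ^ k * R powr \<theta> = (q ^ k * R) powr \<theta>"
        unfolding Q_def using assms R by (simp add: powr_mult powr_realpow[symmetric] powr_powr mult.commute)
      have "1 \<le> q ^ k * R \<longleftrightarrow> 1 \<le> (q ^ k * R) powr \<theta>"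
        using p assms(2) powr_less_mono2[of \<theta> "q ^ k * R" 1] ge_one_powr_ge_zero[of "q ^ k * R" \<theta>]
        by (cases "1 \<le> q ^ k * R") auto
      then show ?thesis unfolding e tent_def by (simp add: powr_minus_divide)
    qed
    then have "(\<Sum>k<n. tent \<theta> (q ^ k * R)) \<le> S"
      unfolding S_def using sum_tent_geometric[OF Q, of "R powr \<theta>" n] R by simp
    then show "(\<Sum>k<n. ennreal (tent \<theta> (q ^ k * R))) \<le> ennreal S"
      by (subst sum_ennreal) (auto simp: tent_nonneg intro: ennreal_leI)
  qed (rule summableI)
  then show ?thesis using that S by blast
qed

text \<open>The number N stands for the modulus of a kernel or for the length of its gradient. With
  u = 2^(j/2) R, the volume of the ball exceeds the volumes in \<open>Wj\<close> by at most a
  multiple of max(1, u)^Q. For u < 1 exponent 0 is used; for u \<ge> 1 exponent R0 beats the growth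
  and leaves u^(Q - R0) = u^(-a).\<close>

lemma kernel_bound:
  assumes \<kappa>: "\<kappa> \<ge> 1" and R0: "R0 > real CARD('a::finite) + (1 + real \<kappa>) * real CARD('b::finite)" and c: "c > 0" and L: "L \<ge> 0"
  defines "a \<equiv> R0 - (real CARD('a) + (1 + real \<kappa>) * real CARD('b))"
  obtains C where "C > 0" "\<And>(z :: ('a, 'b) pt) (y :: ('a, 'b) pt) (w :: ('a, 'b) pt) R j N A.
    0 < R \<Longrightarrow> norm (fst z - fst y) \<le> L * R \<Longrightarrow> norm (fst z - fst w) \<le> L * R \<Longrightarrow> c * R \<le> dist_k \<kappa> y w \<Longrightarrow> 0 \<le> N \<Longrightarrow>
    (\<And>r. 0 \<le> r \<Longrightarrow> r \<le> R0 \<Longrightarrow> Wj \<kappa> j r y w * N \<le> A * 2 powr (- real j * r / 2)) \<Longrightarrow>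
    N * measure lborel (dball \<kappa> z R) \<le> C * A * (if 1 \<le> sqrt 2 ^ j * R then (sqrt 2 ^ j * R) powr (- a) else 1)"
proof -
  define nQ where "nQ = CARD('a) + (1 + \<kappa>) * CARD('b)"
  have a: "a = R0 - real nQ" by (simp add: a_def nQ_def algebra_simps)
  have R0': "R0 > 0" using R0 by (smt (verit) mult_nonneg_nonneg of_nat_0_le_iff)
  obtain Cc where Cc: "Cc > 0" "\<And>(z::('a, 'b) pt) (y::('a, 'b) pt) R \<rho>. 0 < \<rho> \<Longrightarrow> 0 < R \<Longrightarrow> norm (fst z - fst y) \<le> L * R \<Longrightarrow>
    measure lborel (dball \<kappa> z R) \<le> Cc * (max 1 (R / \<rho>)) ^ nQ * measure lborel (dball \<kappa> y \<rho>)"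
    using dball_volume_compare[OF \<kappa> L, where 'a = 'a and 'b = 'b, folded nQ_def] by metis
  define C where "C = Cc * max 1 (c powr (- R0))"
  have C: "C > 0" "Cc \<le> C" "Cc * c powr (- R0) \<le> C"
  proof -
    have "0 < max 1 (c powr (- R0))" by (rule less_max_iff_disj[THEN iffD2]) simp
    then show "C > 0" unfolding C_def using Cc(1) by (rule mult_pos_pos[rotated])
    show "Cc \<le> C" unfolding C_def using Cc(1) mult_left_mono[of 1 "max 1 (c powr (- R0))" Cc] by simp
    show "Cc * c powr (- R0) \<le> C" unfolding C_def using Cc(1) by (intro mult_left_mono) auto
  qed
  have main: "N * measure lborel (dball \<kappa> z R) \<le> C * A * (if 1 \<le> sqrt 2 ^ j * R then (sqrt 2 ^ j * R) powr (- a) else 1)"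
    if R: "0 < R" and zy: "norm (fst z - fst y) \<le> L * R" and zw: "norm (fst z - fst w) \<le> L * R" and d: "c * R \<le> dist_k \<kappa> y w"
      and N: "0 \<le> N" and W: "\<And>r. 0 \<le> r \<Longrightarrow> r \<le> R0 \<Longrightarrow> Wj \<kappa> j r y w * N \<le> A * 2 powr (- real j * r / 2)"
    for z y w :: "('a, 'b) pt" and R j N A
  proof -
    define \<rho> where "\<rho> = 2 powr (- real j / 2)"
    define t where "t = sqrt 2 ^ j * R"
    have s2: "sqrt 2 ^ j = 2 powr (real j / 2)"
      by (simp add: powr_half_sqrt[symmetric] powr_realpow[symmetric] powr_powr)
    have \<rho>: "\<rho> > 0" by (simp add: \<rho>_def)
    have t: "t = R / \<rho>" "t > 0" using R by (auto simp: t_def s2 \<rho>_def powr_minus field_simps)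
    define V where "V = measure lborel (dball \<kappa> z R)"
    define P where "P = sqrt (measure lborel (dball \<kappa> y \<rho>)) * sqrt (measure lborel (dball \<kappa> w \<rho>))"
    have P0: "P \<ge> 0" by (simp add: P_def)
    let ?m = "Cc * (max 1 t) ^ nQ"
    have m0: "0 \<le> ?m" using Cc(1) by simp
    \<comment> \<open>Comparing with the small balls around y and around w separately and taking the
      geometric mean produces exactly the square roots in \<open>Wj\<close>.\<close>
    have VP: "V \<le> ?m * P"
    proof -
      have 1: "V \<le> ?m * measure lborel (dball \<kappa> y \<rho>)" and 2: "V \<le> ?m * measure lborel (dball \<kappa> w \<rho>)"
        unfolding V_def t by (intro Cc(2) \<rho> R zy zw)+
      have "V = sqrt (V * V)" by (simp add: V_def)
      also have "\<dots> \<le> sqrt ((?m * measure lborel (dball \<kappa> y \<rho>)) * (?m * measure lborel (dball \<kappa> w \<rho>)))"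
        using 1 2 m0 by (intro real_sqrt_le_mono mult_mono) (auto simp: V_def)
      also have "\<dots> = sqrt ((?m * ?m) * (measure lborel (dball \<kappa> y \<rho>) * measure lborel (dball \<kappa> w \<rho>)))"
        by (simp only: mult_ac)
      also have "\<dots> = ?m * P"
      proof -
        have "sqrt ((m * m) * (u * v)) = m * (sqrt u * sqrt v)" if "0 \<le> m" for m u v :: real
          using that by (simp add: real_sqrt_mult)
        from this[OF m0] show ?thesis unfolding P_def .
      qed
      finally show ?thesis .
    qed
    have Wj_eq: "Wj \<kappa> j r y w = P * pow0 (dist_k \<kappa> y w) r" for r
      unfolding Wj_def P_def \<rho>_def by simp
    have A0: "P * N \<le> A" using W[of 0] R0' unfolding Wj_eq by (simp add: pow0_def)
    have A_nonneg: "0 \<le> A" using A0 P0 N by (meson mult_nonneg_nonneg order_trans)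
    have NV: "N * V \<le> ?m * (P * N)" using mult_left_mono[OF VP N] by (simp only: mult_ac)
    show ?thesis
    proof (cases "1 \<le> t")
      case True
      have "P * (c * R) powr R0 * N \<le> P * dist_k \<kappa> y w powr R0 * N"
        using d c R R0' P0 N by (intro mult_right_mono mult_left_mono powr_mono2) auto
      also have "\<dots> \<le> A * 2 powr (- real j * R0 / 2)"
        using W[of R0] R0' unfolding Wj_eq by (simp add: pow0_def)
      finally have "P * N * (c * R) powr R0 \<le> A * 2 powr (- real j * R0 / 2)" by (simp only: mult_ac)
      then have "P * N \<le> A * 2 powr (- real j * R0 / 2) / (c * R) powr R0"
        using c R by (subst pos_le_divide_eq) auto
      also have "\<dots> = A * (c powr (- R0) * t powr (- R0))"
      proof -
        have e1: "2 powr (- real j * R0 / 2) = (sqrt 2 ^ j) powr (- R0)"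
          unfolding s2 by (simp add: powr_powr)
        have "c powr (- R0) * t powr (- R0) = (c * t) powr (- R0)" using c t(2) by (simp add: powr_mult)
        also have "c * t = (c * R) * sqrt 2 ^ j" by (simp add: t_def)
        also have "((c * R) * sqrt 2 ^ j) powr (- R0) = (c * R) powr (- R0) * (sqrt 2 ^ j) powr (- R0)"
          by (rule powr_mult)
        also have "(c * R) powr (- R0) = inverse ((c * R) powr R0)" by (rule powr_minus)
        finally show ?thesis unfolding e1 by (simp only: divide_inverse mult_ac)
      qed
      finally have "?m * (P * N) \<le> ?m * (A * (c powr (- R0) * t powr (- R0)))" using m0 by (rule mult_left_mono)
      also have "\<dots> = (Cc * c powr (- R0)) * (A * (t powr real nQ * t powr (- R0)))"
        using True t(2) by (simp add: max_def powr_realpow)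
      also have "t powr real nQ * t powr (- R0) = t powr (- a)" by (simp add: a powr_add[symmetric])
      also have "(Cc * c powr (- R0)) * (A * t powr (- a)) \<le> C * (A * t powr (- a))"
        using C(3) A_nonneg by (intro mult_right_mono) auto
      finally show ?thesis using NV True unfolding V_def t_def by (simp add: mult.assoc)
    next
      case False
      then have "?m * (P * N) = Cc * (P * N)" by (simp add: max_def)
      also have "\<dots> \<le> C * A" using C A0 Cc(1) P0 N by (intro mult_mono) auto
      finally show ?thesis using NV False unfolding V_def t_def by simp
    qed
  qed
  show ?thesis by (rule that[OF C(1) main])
qed

lemma min_one_le_powr: "0 < (x::real) \<Longrightarrow> 0 < \<theta> \<Longrightarrow> \<theta> \<le> 1 \<Longrightarrow> min 1 x \<le> x powr \<theta>"
proof (cases "x \<le> 1")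
  assume x: "0 < x" "0 < \<theta>" "\<theta> \<le> 1" and "x \<le> 1"
  then have "x powr 1 \<le> x powr \<theta>" by (intro powr_mono') auto
  then show ?thesis using x by simp
next
  assume "0 < x" "0 < \<theta>" "\<theta> \<le> 1" "\<not> x \<le> 1"
  then show ?thesis by (simp add: ge_one_powr_ge_zero)
qed

lemma Xlen_nonneg: "0 \<le> Xlen \<kappa> f x"
  unfolding Xlen_def by (intro real_sqrt_ge_zero add_nonneg_nonneg sum_nonneg) auto

text \<open>Near the diagonal the regularity condition is interpolated with the size condition;
  at distance larger than one the size condition alone suffices because \<open>R0 > Q\<close>.\<close>
lemma kernel_oscillation:
  fixes K :: "nat \<Rightarrow> ('a::finite, 'b::finite) pt \<Rightarrow> ('a, 'b) pt \<Rightarrow> complex"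
  assumes \<kappa>: "\<kappa> \<ge> 1" and R0: "R0 > real CARD('a) + (1 + real \<kappa>) * real CARD('b)"
    and K3: "cond_K3 \<kappa> R0 K" and K5: "cond_K5 \<kappa> R0 K"
    and C0: "quasi_tri_const \<kappa> (TYPE(('a, 'b) pt)) C0"
  obtains C \<theta> where "C > 0" "\<theta> > 0" "\<And>(z :: ('a, 'b) pt) y y2 w r R j.
    0 < r \<Longrightarrow> y \<in> dball \<kappa> z r \<Longrightarrow> y2 \<in> dball \<kappa> z r \<Longrightarrow> 8 * C0 ^ 3 * r \<le> R \<Longrightarrow> R \<le> dist_k \<kappa> z w \<Longrightarrow> dist_k \<kappa> z w < 2 * R \<Longrightarrow>
    norm (K j y w - K j y2 w) * measure lborel (dball \<kappa> z R)
      \<le> C * (if R \<le> 1 then (r / R) powr \<theta> else R powr (- \<theta>)) * tent \<theta> (sqrt 2 ^ j * R)"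
proof -
  define a where "a = R0 - (real CARD('a) + (1 + real \<kappa>) * real CARD('b))"
  \<comment> \<open>Interpolation needs \<theta> \<le> 1, and 2 \<theta> \<le> a leaves one power of
    decay for the sum over j after another has been spent on R or on the interpolation.\<close>
  define \<theta> where "\<theta> = min a 1 / 2"
  have \<theta>: "0 < \<theta>" "\<theta> \<le> 1" "2 * \<theta> \<le> a" using R0 by (auto simp: \<theta>_def a_def)
  have c0: "C0 > 1" and tri: "\<And>x y z :: ('a, 'b) pt. dist_k \<kappa> x y \<le> C0 * (dist_k \<kappa> x z + dist_k \<kappa> z y)"
    using C0 by (auto simp: quasi_tri_const_def)
  obtain C1 where C1: "C1 > 0" "\<And>(z :: ('a, 'b) pt) (y :: ('a, 'b) pt) (w :: ('a, 'b) pt) R j N A.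
    0 < R \<Longrightarrow> norm (fst z - fst y) \<le> 2 * R \<Longrightarrow> norm (fst z - fst w) \<le> 2 * R \<Longrightarrow> 1 / (2 * C0) * R \<le> dist_k \<kappa> y w \<Longrightarrow> 0 \<le> N \<Longrightarrow>
    (\<And>r. 0 \<le> r \<Longrightarrow> r \<le> R0 \<Longrightarrow> Wj \<kappa> j r y w * N \<le> A * 2 powr (- real j * r / 2)) \<Longrightarrow>
    N * measure lborel (dball \<kappa> z R) \<le> C1 * A * (if 1 \<le> sqrt 2 ^ j * R then (sqrt 2 ^ j * R) powr (- a) else 1)"
  proof -
    have "1 / (2 * C0) > 0" "2 \<ge> (0::real)" using c0 by auto
    from kernel_bound[OF \<kappa> R0 this, folded a_def] show ?thesis using that by metis
  qed
  obtain A3 where A3: "\<And>j r x y. 0 \<le> r \<Longrightarrow> r \<le> R0 \<Longrightarrow> Wj \<kappa> j r x y * norm (K j x y) \<le> A3 * 2 powr (- real j * r / 2)"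
    using K3 unfolding cond_K3_def by blast
  have dK: "\<And>j x y. (\<lambda>x. K j x y) differentiable (at x)" using K5 unfolding cond_K5_def by blast
  \<comment> \<open>The gradient condition is local. For R \<le> 1 all points of the path stay
    within 3 \<open>C0\<close> of w, which is the radius chosen here.\<close>
  have "3 * C0 > 0" using c0 by simp
  with K5 have "\<exists>C. \<forall>j r x y. 0 \<le> r \<and> r \<le> R0 \<and> dist_k \<kappa> x y < 3 * C0 \<longrightarrow>
      Wj \<kappa> j r x y * Xlen \<kappa> (\<lambda>x. K j x y) x \<le> C * 2 powr (- real j * r / 2) * 2 powr (real j / 2)"
    unfolding cond_K5_def by (elim conjE allE[of _ "3 * C0"] impE)
  then obtain A5 where A5: "\<And>j r x y. 0 \<le> r \<Longrightarrow> r \<le> R0 \<Longrightarrow> dist_k \<kappa> x y < 3 * C0 \<Longrightarrow>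
      Wj \<kappa> j r x y * Xlen \<kappa> (\<lambda>x. K j x y) x \<le> A5 * 2 powr (- real j * r / 2) * 2 powr (real j / 2)"
    by metis
  define Cm where "Cm = 2 + (2 * real CARD('a)) ^ \<kappa>"
  have Cm: "Cm > 0" by (simp add: Cm_def add_pos_nonneg)
  define C where "C = 2 * C1 * (\<bar>A3\<bar> + Cm * \<bar>A5\<bar>) + 1"
  have C: "C > 0" using C1(1) Cm by (auto simp: C_def intro!: add_nonneg_pos)
  have main: "norm (K j y w - K j y2 w) * measure lborel (dball \<kappa> z R)
      \<le> C * (if R \<le> 1 then (r / R) powr \<theta> else R powr (- \<theta>)) * tent \<theta> (sqrt 2 ^ j * R)"
    if r: "0 < r" and y: "y \<in> dball \<kappa> z r" "y2 \<in> dball \<kappa> z r" and R: "8 * C0 ^ 3 * r \<le> R" and w: "R \<le> dist_k \<kappa> z w" "dist_k \<kappa> z w < 2 * R"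
    for z y y2 w :: "('a, 'b) pt" and r R j
  proof -
    have c03: "C0 \<le> C0 ^ 3" "C0 ^ 2 \<le> C0 ^ 3" using c0 power_increasing[of 1 3 C0] power_increasing[of 2 3 C0] by auto
    have rR: "8 * C0 * r \<le> R" "8 * C0 ^ 2 * r \<le> R"
    proof -
      have "C0 * (8 * r) \<le> C0 ^ 3 * (8 * r)" "C0 ^ 2 * (8 * r) \<le> C0 ^ 3 * (8 * r)" using r by (intro mult_right_mono c03; simp)+
      moreover have "C0 ^ 3 * (8 * r) = 8 * C0 ^ 3 * r" "C0 * (8 * r) = 8 * C0 * r" "C0 ^ 2 * (8 * r) = 8 * C0 ^ 2 * r" by simp_all
      ultimately show "8 * C0 * r \<le> R" "8 * C0 ^ 2 * r \<le> R" using R by linarith+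
    qed    have C0r: "r < C0 * r" using c0 r by simp
    have Rpos: "R > 0" and rltR: "r < R" using rR(1) r C0r by linarith+
    define V where "V = measure lborel (dball \<kappa> z R)"
    define t where "t = sqrt 2 ^ j * R"
    have t: "t > 0" using Rpos by (simp add: t_def)
    define g where "g = (if 1 \<le> t then t powr (- a) else 1)"
    have g0: "g \<ge> 0" by (simp add: g_def)
    have Vpos: "V > 0"
    proof -
      obtain c1 c2 where "0 < c1" "\<And>x::('a, 'b) pt. \<And>r. r > 0 \<Longrightarrow> c1 * vol \<kappa> x r \<le> measure lborel (dball \<kappa> x r)"
        using dball_volume[OF \<kappa>, where 'a = 'a and 'b = 'b] by metis
      then show ?thesis unfolding V_def using vol_pos[OF Rpos, of \<kappa> z] Rpos by (meson less_le_trans mult_pos_pos)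
    qed
    \<comment> \<open>Points p met by the path lie within 2 \<open>C0\<close> r of z. The factor 8
      \<open>C0\<close>^3 makes this at most R/4, and R/4 again after one more use of the
      quasi-triangle inequality, so p stays at distance comparable to R from w.\<close>
    have near: "norm (fst z - fst p) \<le> 2 * R" "1 / (2 * C0) * R \<le> dist_k \<kappa> p w" "dist_k \<kappa> p w < 3 * C0 * R" if p: "dist_k \<kappa> z p < 2 * C0 * r" for p
    proof -
      have pR: "dist_k \<kappa> z p < R / 4" using p rR(1) by linarith
      then show "norm (fst z - fst p) \<le> 2 * R" using norm_fst_le_dist_k[of z p \<kappa>] Rpos by linarith
      have "dist_k \<kappa> p z + dist_k \<kappa> z w < 3 * R" using pR w(2) dist_k_commute[of \<kappa> p z] Rpos by linarith
      then have "C0 * (dist_k \<kappa> p z + dist_k \<kappa> z w) < C0 * (3 * R)" using c0 by (intro mult_strict_left_mono) auto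
      then show "dist_k \<kappa> p w < 3 * C0 * R" using tri[of p w z] by (simp add: mult_ac)
      have "C0 * dist_k \<kappa> z p \<le> C0 * (2 * C0 * r)" using p c0 by (intro mult_left_mono) auto
      also have "\<dots> \<le> R / 4" using rR(2) by (simp add: power2_eq_square mult_ac)
      finally have "R \<le> R / 4 + C0 * dist_k \<kappa> p w" using tri[of z w p] w(1) by (simp add: distrib_left)
      then have "R / 2 \<le> C0 * dist_k \<kappa> p w" using Rpos by linarith
      then show "1 / (2 * C0) * R \<le> dist_k \<kappa> p w" using c0 by (simp add: field_simps)
    qed
    have wz: "norm (fst z - fst w) \<le> 2 * R" using norm_fst_le_dist_k[of z w \<kappa>] w(2) by linarith
    have ball: "dist_k \<kappa> z p < 2 * C0 * r" if "p \<in> dball \<kappa> z r" for p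
      using that C0r r unfolding dball_def mem_Collect_eq by linarith
    have size: "norm (K j p w) * V \<le> C1 * \<bar>A3\<bar> * g" if p: "p \<in> dball \<kappa> z r" for p
      unfolding V_def g_def t_def
    proof (rule C1(2)[OF Rpos near(1)[OF ball[OF p]] wz near(2)[OF ball[OF p]] norm_ge_zero])
      show "Wj \<kappa> j r p w * norm (K j p w) \<le> \<bar>A3\<bar> * 2 powr (- real j * r / 2)" if "0 \<le> r" "r \<le> R0" for r
        by (rule order_trans[OF A3[OF that] mult_right_mono[OF abs_ge_self powr_ge_zero]])
    qed
    have A: "norm (K j y w - K j y2 w) * V \<le> C * g"
    proof -
      have "norm (K j y w - K j y2 w) * V \<le> norm (K j y w) * V + norm (K j y2 w) * V"
        using mult_right_mono[OF norm_triangle_ineq4[of "K j y w" "K j y2 w"] less_imp_le[OF Vpos]] by (simp add: distrib_right)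
      also have "\<dots> \<le> C1 * \<bar>A3\<bar> * g + C1 * \<bar>A3\<bar> * g" by (intro add_mono size y)
      also have "\<dots> = (2 * C1 * \<bar>A3\<bar>) * g" by simp
      also have "\<dots> \<le> C * g" unfolding C_def using g0 C1(1) Cm by (intro mult_right_mono) (auto simp: distrib_left)
      finally show ?thesis .
    qed
    show ?thesis
    proof (cases "R \<le> 1")
      case True
      \<comment> \<open>The gradient bound equals the size bound times 2^(j/2), because the gradient
        condition loses exactly that factor.\<close>
      define N where "N = C1 * (\<bar>A5\<bar> * sqrt 2 ^ j) * g / V"
      have s2: "sqrt 2 ^ j = 2 powr (real j / 2)"
        by (simp add: powr_half_sqrt[symmetric] powr_realpow[symmetric] powr_powr)
      have X: "Xlen \<kappa> (\<lambda>x. K j x w) p \<le> N" if p: "dist_k \<kappa> z p < 2 * C0 * r" for p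
      proof -
        have "3 * C0 * R \<le> 3 * C0 * 1" using True c0 by (intro mult_left_mono) auto
        then have pw: "dist_k \<kappa> p w < 3 * C0" using near(3)[OF p] by simp
        have "Xlen \<kappa> (\<lambda>x. K j x w) p * V \<le> C1 * (\<bar>A5\<bar> * sqrt 2 ^ j) * g"
          unfolding V_def g_def t_def
        proof (rule C1(2)[OF Rpos near(1)[OF p] wz near(2)[OF p] Xlen_nonneg])
          show "Wj \<kappa> j r p w * Xlen \<kappa> (\<lambda>x. K j x w) p \<le> \<bar>A5\<bar> * sqrt 2 ^ j * 2 powr (- real j * r / 2)" if "0 \<le> r" "r \<le> R0" for r
          proof (rule order_trans[OF A5[OF that pw]])
            have "A5 * (2 powr (- real j * r / 2) * 2 powr (real j / 2)) \<le> \<bar>A5\<bar> * (2 powr (- real j * r / 2) * 2 powr (real j / 2))"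
              by (intro mult_right_mono abs_ge_self) simp
            then show "A5 * 2 powr (- real j * r / 2) * 2 powr (real j / 2) \<le> \<bar>A5\<bar> * sqrt 2 ^ j * 2 powr (- real j * r / 2)"
              unfolding s2 by (simp only: mult_ac)
          qed
        qed
        then show ?thesis unfolding N_def using Vpos by (simp add: pos_le_divide_eq)
      qed
      have mv: "norm (K j p w - K j z w) \<le> Cm * r * N" if "p \<in> dball \<kappa> z r" for p
        unfolding Cm_def using that by (intro mean_value_bound[OF \<kappa> c0 tri dK _ X]) (auto simp: dball_def)
      have "norm (K j y w - K j y2 w) \<le> Cm * r * N + Cm * r * N"
      proof -
        have "norm (K j y w - K j y2 w) \<le> norm (K j y w - K j z w) + norm (K j y2 w - K j z w)"
          using norm_triangle_ineq4[of "K j y w - K j z w" "K j y2 w - K j z w"] by simp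
        then show ?thesis using mv[OF y(1)] mv[OF y(2)] by linarith
      qed
      then have "norm (K j y w - K j y2 w) * V \<le> (Cm * r * N + Cm * r * N) * V" using Vpos by (intro mult_right_mono) auto
      also have "\<dots> = (2 * C1 * Cm * \<bar>A5\<bar>) * g * (r * sqrt 2 ^ j)" using Vpos by (simp add: N_def)
      also have "\<dots> \<le> C * g * (r * sqrt 2 ^ j)"
        unfolding C_def using g0 r C1(1) Cm by (intro mult_right_mono) (auto simp: distrib_left)
      finally have B: "norm (K j y w - K j y2 w) * V \<le> C * g * (r * sqrt 2 ^ j)" .
      define x where "x = r * sqrt 2 ^ j"
      have x: "x > 0" using r by (simp add: x_def)
      have xt: "x = (r / R) * t" using Rpos by (simp add: x_def t_def)
      \<comment> \<open>Size gives the factor 1 and regularity the factor x = r 2^(j/2); the power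
        x^\<theta> then splits into a gain in r/R and a harmless power of t.\<close>
      have "norm (K j y w - K j y2 w) * V \<le> C * g * min 1 x"
        using A B by (auto simp: min_def x_def)
      also have "\<dots> \<le> C * g * x powr \<theta>"
        using C g0 min_one_le_powr[OF x \<theta>(1,2)] by (intro mult_left_mono) auto
      also have "x powr \<theta> = (r / R) powr \<theta> * t powr \<theta>"
        unfolding xt by (rule powr_mult)
      also have "C * g * ((r / R) powr \<theta> * t powr \<theta>) = C * (r / R) powr \<theta> * (g * t powr \<theta>)" by simp
      also have "\<dots> \<le> C * (r / R) powr \<theta> * tent \<theta> t"
      proof (intro mult_left_mono)
        show "g * t powr \<theta> \<le> tent \<theta> t"
        proof (cases "1 \<le> t")
          case True
          have "g * t powr \<theta> = t powr (\<theta> - a)" using True by (simp add: g_def powr_add[symmetric])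
          also have "\<dots> \<le> t powr (- \<theta>)" using True \<theta> by (intro powr_mono) auto
          finally show ?thesis using True by (simp add: tent_def)
        qed (simp add: g_def tent_def)
      qed (use C in auto)
      finally show ?thesis using True by (simp add: V_def t_def)
    next
      case False
      \<comment> \<open>For R > 1 every j has t \<ge> R, so the decay t^(-2 \<theta>) can be divided
        between R and t, without any regularity.\<close>
      have "1 \<le> sqrt 2 ^ j" by (simp add: one_le_power)
      then have "1 * R \<le> t" unfolding t_def using Rpos by (intro mult_right_mono) auto
      then have tR: "R \<le> t" "1 \<le> t" using False by auto
      have "g = t powr (- a)" using tR by (simp add: g_def)
      also have "\<dots> \<le> t powr (- \<theta> + - \<theta>)" using tR \<theta> by (intro powr_mono) auto
      also have "\<dots> = t powr (- \<theta>) * t powr (- \<theta>)" by (simp only: powr_add)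
      also have "\<dots> \<le> R powr (- \<theta>) * t powr (- \<theta>)"
        using tR Rpos \<theta> by (intro mult_right_mono powr_mono2') auto
      finally have "g \<le> R powr (- \<theta>) * tent \<theta> t" using tR by (simp add: tent_def)
      then have "C * g \<le> C * (R powr (- \<theta>) * tent \<theta> t)" using C by (intro mult_left_mono) auto
      then show ?thesis using A False by (simp add: V_def t_def mult.assoc)
    qed
  qed
  show ?thesis by (rule that[OF C \<theta>(1) main])
qed

section \<open>From kernel bounds to maximal functions\<close>

lemma HLmax_ge:
  assumes \<kappa>: "\<kappa> \<ge> 1" and R: "R > 0" and x: "x \<in> dball \<kappa> z R"
  shows "(\<integral>\<^sup>+ y\<in>dball \<kappa> z R. ennreal (norm (f y)) \<partial>lborel) \<le> emeasure lborel (dball \<kappa> z R) * HLmax \<kappa> f x"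
proof -
  let ?I = "\<integral>\<^sup>+ y\<in>dball \<kappa> z R. ennreal (norm (f y)) \<partial>lborel" and ?e = "emeasure lborel (dball \<kappa> z R)"
  obtain c1 c2 where c: "0 < c1" "?e = ennreal (measure lborel (dball \<kappa> z R))" "c1 * vol \<kappa> z R \<le> measure lborel (dball \<kappa> z R)"
    using dball_volume[OF \<kappa>] R by metis
  have "0 < measure lborel (dball \<kappa> z R)" using c(1,3) vol_pos[OF R, of \<kappa> z] by (meson less_le_trans mult_pos_pos)
  then have e: "?e \<noteq> 0" "?e \<noteq> top" using c(2) by auto
  have "?I / ?e \<le> HLmax \<kappa> f x"
    unfolding HLmax_def by (rule SUP_upper2[of "(z, R)"]) (use R x in auto)
  then have "?e * (?I / ?e) \<le> ?e * HLmax \<kappa> f x" by (intro mult_left_mono) auto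
  moreover have "?e * (?I / ?e) = ?I"
    using e by (simp add: ennreal_times_divide mult.commute[of ?e] mult_divide_eq_ennreal)
  ultimately show ?thesis by simp
qed

text \<open>The curve must start at the given point, which may lie anywhere in the ball of radius r
  but has to belong to the ball of radius C1 r. With C1 < 1 this fails already for the trivial pair
  x = y.\<close>

lemma mean_value_const_ge_1:
  assumes "mean_value_const \<kappa> (TYPE(('a::finite, 'b::finite) pt)) C1"
  shows "C1 \<ge> 1"
proof (rule ccontr)
  assume "\<not> C1 \<ge> 1"
  then have C1: "C1 < 1" by simp
  \<comment> \<open>A radius inside the unit ball but not inside that of radius C1; the maximum
    covers negative C1.\<close>
  define \<rho> where "\<rho> = max 0 C1"
  have \<rho>: "0 \<le> \<rho>" "\<rho> < 1" "C1 \<le> \<rho>" using C1 by (auto simp: \<rho>_def)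
  obtain v :: "real^'a" where v: "norm v = \<rho>" using vector_choose_size[OF \<rho>(1)] by auto
  have d: "dist_k \<kappa> (0 :: ('a, 'b) pt) (v, 0) = \<rho>" using v by (subst dist_k_same_snd) auto
  then have x: "(v, 0) \<in> dball \<kappa> (0 :: ('a, 'b) pt) 1" using \<rho> by (simp add: dball_def)
  obtain C2 where C2: "\<And>(x0 :: ('a, 'b) pt) r x y. 0 < r \<Longrightarrow> x \<in> dball \<kappa> x0 r \<Longrightarrow> y \<in> dball \<kappa> x0 r \<Longrightarrow>
     (\<exists>\<gamma> :: real \<Rightarrow> ('a, 'b) pt. continuous_on {0..1} \<gamma> \<and> \<gamma> ` {0..1} \<subseteq> dball \<kappa> x0 (C1 * r) \<and> \<gamma> 0 = x \<and> \<gamma> 1 = y \<and>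
        (\<forall>f. C1_fun f \<longrightarrow> \<bar>f x - f y\<bar> \<le> C2 * dist_k \<kappa> x y * integral {0..1} (\<lambda>t. Xlen \<kappa> f (\<gamma> t))))"
    using assms unfolding mean_value_const_def by blast
  obtain \<gamma> :: "real \<Rightarrow> ('a, 'b) pt" where "\<gamma> ` {0..1} \<subseteq> dball \<kappa> 0 (C1 * 1)" "\<gamma> 0 = (v, 0)"
    using C2[OF zero_less_one x x] by blast
  then have "(v, 0) \<in> dball \<kappa> (0 :: ('a, 'b) pt) C1" by force
  then show False using d \<rho>(3) by (simp add: dball_def)
qed

text \<open>\<open>osc_esssup\<close> is taken with respect to Lebesgue measure on pairs, where a
  null set in either coordinate gives a null product set.\<close>

lemma AE_pair_lborel:
  fixes P :: "'p::euclidean_space \<Rightarrow> bool"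
  assumes "AE x in lborel. P x"
  shows "AE p in lborel. P (fst p) \<and> P (snd p)"
proof -
  obtain N where N: "{x. \<not> P x} \<subseteq> N" "N \<in> sets borel" "emeasure lborel N = 0"
    using AE_E[OF assms] by auto
  have "N \<times> UNIV \<in> null_sets (lborel :: ('p \<times> 'p) measure)" "UNIV \<times> N \<in> null_sets (lborel :: ('p \<times> 'p) measure)"
    unfolding lborel_prod[symmetric] using N by (auto simp: null_sets_def lborel.emeasure_pair_measure_Times)
  from AE_not_in[OF this(1)] AE_not_in[OF this(2)] show ?thesis
    by eventually_elim (use N(1) in auto)
qed

text \<open>L2 convergence of the partial sums yields almost everywhere convergence only along a
  subsequence N, which does not depend on x.\<close>

lemma kernel_expansion:
  fixes T :: "(('a::finite, 'b::finite) pt \<Rightarrow> complex) \<Rightarrow> ('a, 'b) pt \<Rightarrow> complex"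
  assumes E: "spectral_resolution_G hom \<kappa> E" and T: "bounded_op T"
    and kernels: "\<And>j. is_kernel_of (\<lambda>f. T (E (Ij j) f)) (K j)" and f: "f \<in> L2"
  obtains N :: "nat \<Rightarrow> nat" where "AE x in lborel. (\<forall>j. integrable lborel (\<lambda>y. K j x y * f y)) \<and>
    (\<lambda>i. \<Sum>j<N i. \<integral>y. K j x y * f y \<partial>lborel) \<longlonglongrightarrow> T f x"
proof -
  interpret spectral E using E by unfold_locales (simp add: spectral_resolution_G_def)
  \<comment> \<open>Prepending the negative half line turns the sets \<open>Ij j\<close> into a
    partition of the whole line, to which countable additivity applies; the additional piece
    contributes nothing.\<close>
  define A where "A = (\<lambda>n. case n of 0 \<Rightarrow> {..<0::real} | Suc j \<Rightarrow> Ij j)"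
  have Ij: "Ij j \<in> sets borel" for j by (simp add: Ij_def)
  have A: "A n \<in> sets borel" for n by (cases n) (auto simp: A_def Ij)
  have Ij_mem: "t \<in> Ij j \<Longrightarrow> j = (if t < 1 then 0 else Suc (nat \<lfloor>log 2 t\<rfloor>)) \<and> 0 \<le> t" for t j
  proof -
    assume t: "t \<in> Ij j"
    show ?thesis
    proof (cases j)
      case 0
      then show ?thesis using t by (simp add: Ij_def)
    next
      case (Suc i)
      then have b: "2 ^ i \<le> t" "t < 2 ^ Suc i" using t by (auto simp: Ij_def)
      have "1 \<le> t" using b(1) one_le_power[of "2::real" i] by linarith
      moreover have "\<lfloor>log 2 t\<rfloor> = int i"
        using b \<open>1 \<le> t\<close> by (intro floor_unique) (auto simp: le_log_iff log_less_iff powr_realpow powr_add)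
      ultimately show ?thesis using Suc by simp
    qed
  qed
  have disj: "disjoint_family A"
    unfolding disjoint_family_on_def
  proof (intro ballI impI)
    fix m n :: nat assume "m \<noteq> n"
    then show "A m \<inter> A n = {}"
      using Ij_mem by (cases m; cases n) (fastforce simp: A_def)+
  qed
  have U: "(\<Union>n. A n) = UNIV"
  proof (intro equalityI subsetI UNIV_I)
    fix t :: real
    show "t \<in> (\<Union>n. A n)"
    proof (cases "t < 0")
      case True
      then have "t \<in> A 0" by (simp add: A_def)
      then show ?thesis by blast
    next
      case False
      have "\<exists>j. t \<in> Ij j"
      proof (cases "t < 1")
        case True
        then show ?thesis using False by (intro exI[of _ 0]) (simp add: Ij_def)
      next
        case t1: False
        define i where "i = nat \<lfloor>log 2 t\<rfloor>"
        have l: "0 \<le> log 2 t" using t1 by simp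
        then have "real i \<le> log 2 t" "log 2 t < real i + 1" unfolding i_def by linarith+
        then have "2 powr real i \<le> t" "t < 2 powr (real i + 1)" using t1 by (auto simp: le_log_iff log_less_iff)
        then show ?thesis by (intro exI[of _ "Suc i"]) (simp add: Ij_def powr_realpow powr_add)
      qed
      then obtain j where "t \<in> A (Suc j)" by (auto simp: A_def)
      then show ?thesis by blast
    qed
  qed
  have E0: "AE x in lborel. E {..<0} f x = 0"
    using spectral_negative_zero[OF E f] L2norm_eq_0_AE[OF E_L2[OF _ f], of "{..<0}"] by simp
  define g where "g = (\<lambda>N x. (\<Sum>j<N. E (Ij j) f x))"
  have gL: "g N \<in> L2" for N unfolding g_def by (intro L2_sum E_L2 Ij f)
  \<comment> \<open>The shift by one accounts for the prepended set: Suc N pieces of A are the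
    negative part and N spectral bands.\<close>
  have "(\<lambda>N. L2norm (\<lambda>x. E (\<Union>n. A n) f x - (\<Sum>n<Suc N. E (A n) f x))) \<longlonglongrightarrow> 0"
    by (rule LIMSEQ_Suc[OF E_UN[OF A disj f]])
  moreover have "L2norm (\<lambda>x. E (\<Union>n. A n) f x - (\<Sum>n<Suc N. E (A n) f x)) = L2norm (\<lambda>x. g N x - f x)" for N
  proof -
    have "L2norm (\<lambda>x. E (\<Union>n. A n) f x - (\<Sum>n<Suc N. E (A n) f x)) = L2norm (\<lambda>x. f x - g N x)"
    proof (rule L2norm_cong_AE)
      show "AE x in lborel. E (\<Union>n. A n) f x - (\<Sum>n<Suc N. E (A n) f x) = f x - g N x"
        using E0 E_UNIV[OF f] unfolding U
        by eventually_elim (simp add: sum.lessThan_Suc_shift A_def g_def del: sum.lessThan_Suc)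
      show "(\<lambda>x. E (\<Union>n. A n) f x - (\<Sum>n<Suc N. E (A n) f x)) \<in> L2"
        by (intro L2_diff L2_sum E_L2 A f) (simp add: U)
    qed (intro L2_diff f gL)
    then show ?thesis by (simp only: L2norm_minus_commute)
  qed
  ultimately have g_lim: "(\<lambda>N. L2norm (\<lambda>x. g N x - f x)) \<longlonglongrightarrow> 0" by simp
  obtain B where B: "\<And>h. h \<in> L2 \<Longrightarrow> L2norm (T h) \<le> B * L2norm h"
    using T unfolding bounded_op_def by blast
  define h where "h = (\<lambda>N x. (\<Sum>j<N. T (E (Ij j) f) x) - T f x)"
  have hL: "h N \<in> L2" for N
    unfolding h_def by (intro L2_diff L2_sum bounded_op_L2[OF T] E_L2 Ij f)
  have sum_T: "AE x in lborel. T (g N) x = (\<Sum>j<N. T (E (Ij j) f) x)" for N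
    unfolding g_def by (rule bounded_op_sum[OF T]) (auto intro: E_L2 Ij f)
  have hT: "L2norm (h N) = L2norm (T (\<lambda>x. g N x - f x))" for N
  proof (rule L2norm_cong_AE[OF hL bounded_op_L2[OF T L2_diff[OF gL f]]])
    show "AE x in lborel. h N x = T (\<lambda>x. g N x - f x) x"
      using bounded_op_diff[OF T gL f, of N] sum_T[of N]
      by eventually_elim (simp add: h_def)
  qed
  have h_lim: "(\<lambda>N. L2norm (h N)) \<longlonglongrightarrow> 0"
  proof (rule Lim_null_comparison)
    show "\<forall>\<^sub>F N in sequentially. norm (L2norm (h N)) \<le> B * L2norm (\<lambda>x. g N x - f x)"
      unfolding hT using B[OF L2_diff[OF gL f]] by simp
    show "(\<lambda>N. B * L2norm (\<lambda>x. g N x - f x)) \<longlonglongrightarrow> 0"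
      by (rule tendsto_mult_right_zero[OF g_lim])
  qed
  have "(\<lambda>N. (L2norm (h N))\<^sup>2) \<longlonglongrightarrow> 0\<^sup>2" by (intro tendsto_intros h_lim)
  then have "(\<lambda>N. \<integral>x. norm ((norm (h N x))\<^sup>2) \<partial>lborel) \<longlonglongrightarrow> 0"
    by (simp add: L2norm_sq)
  from tendsto_L1_AE_subseq[OF L2_integrable_sq[OF hL] this]
  obtain N where N: "AE x in lborel. (\<lambda>i. (norm (h (N i) x))\<^sup>2) \<longlonglongrightarrow> 0" by blast
  have ker: "AE x in lborel. \<forall>j. integrable lborel (\<lambda>y. K j x y * f y) \<and> T (E (Ij j) f) x = (\<integral>y. K j x y * f y \<partial>lborel)"
    unfolding AE_all_countable using kernels f unfolding is_kernel_of_def by blast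
  have "AE x in lborel. (\<forall>j. integrable lborel (\<lambda>y. K j x y * f y)) \<and>
    (\<lambda>i. \<Sum>j<N i. \<integral>y. K j x y * f y \<partial>lborel) \<longlonglongrightarrow> T f x"
    using ker N
  proof eventually_elim
    case (elim x)
    have "(\<lambda>i. sqrt ((norm (h (N i) x))\<^sup>2)) \<longlonglongrightarrow> sqrt 0" by (intro tendsto_intros elim)
    then have "(\<lambda>i. h (N i) x) \<longlonglongrightarrow> 0" by (simp add: tendsto_norm_zero_iff)
    then have "(\<lambda>i. \<Sum>j<N i. T (E (Ij j) f) x) \<longlonglongrightarrow> T f x" unfolding h_def by (simp add: LIM_zero_iff)
    then show ?case using elim by simp
  qed
  then show ?thesis using that by blast
qed

text \<open>Every finite partial sum is dominated by the full series of absolute values, so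
  convergence along a subsequence of partial sums is enough.\<close>

lemma kernel_difference_bound:
  fixes K :: "nat \<Rightarrow> 'p::euclidean_space \<Rightarrow> 'p \<Rightarrow> complex"
  assumes i1: "\<And>j. integrable lborel (\<lambda>w. K j y w * f w)" and i2: "\<And>j. integrable lborel (\<lambda>w. K j y' w * f w)"
    and l1: "(\<lambda>i. \<Sum>j<N i. \<integral>w. K j y w * f w \<partial>lborel) \<longlonglongrightarrow> T" and l2: "(\<lambda>i. \<Sum>j<N i. \<integral>w. K j y' w * f w \<partial>lborel) \<longlonglongrightarrow> T'"
  shows "ennreal (norm (T - T')) \<le> (\<integral>\<^sup>+w. (\<Sum>j. ennreal (norm ((K j y w - K j y' w) * f w))) \<partial>lborel)"
proof -
  have i: "integrable lborel (\<lambda>w. (K j y w - K j y' w) * f w)" for j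
    using Bochner_Integration.integrable_diff[OF i1[of j] i2[of j]] by (simp add: left_diff_distrib)
  have "(\<lambda>i. (\<Sum>j<N i. \<integral>w. K j y w * f w \<partial>lborel) - (\<Sum>j<N i. \<integral>w. K j y' w * f w \<partial>lborel)) \<longlonglongrightarrow> T - T'"
    by (intro tendsto_diff l1 l2)
  then have "(\<lambda>i. \<Sum>j<N i. \<integral>w. (K j y w - K j y' w) * f w \<partial>lborel) \<longlonglongrightarrow> T - T'"
    using i1 i2 by (simp add: sum_subtractf left_diff_distrib)
  then have lim: "(\<lambda>i. ennreal (norm (\<Sum>j<N i. \<integral>w. (K j y w - K j y' w) * f w \<partial>lborel))) \<longlonglongrightarrow> ennreal (norm (T - T'))"
    by (intro tendsto_ennrealI tendsto_norm)
  have "ennreal (norm (\<Sum>j<n. \<integral>w. (K j y w - K j y' w) * f w \<partial>lborel)) \<le> (\<Sum>j. \<integral>\<^sup>+w. ennreal (norm ((K j y w - K j y' w) * f w)) \<partial>lborel)" for n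
  proof -
    have "ennreal (norm (\<Sum>j<n. \<integral>w. (K j y w - K j y' w) * f w \<partial>lborel)) \<le> (\<Sum>j<n. ennreal (norm (\<integral>w. (K j y w - K j y' w) * f w \<partial>lborel)))"
      by (subst sum_ennreal) (auto intro!: ennreal_leI norm_sum)
    also have "\<dots> \<le> (\<Sum>j<n. \<integral>\<^sup>+w. ennreal (norm ((K j y w - K j y' w) * f w)) \<partial>lborel)"
      by (intro sum_mono integral_norm_bound_ennreal i)
    also have "\<dots> \<le> (\<Sum>j. \<integral>\<^sup>+w. ennreal (norm ((K j y w - K j y' w) * f w)) \<partial>lborel)"
      by (rule sum_le_suminf) auto
    finally show ?thesis .
  qed
  then have "ennreal (norm (T - T')) \<le> (\<Sum>j. \<integral>\<^sup>+w. ennreal (norm ((K j y w - K j y' w) * f w)) \<partial>lborel)"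
    using LIMSEQ_le_const2[OF lim] by blast
  also have "\<dots> = (\<integral>\<^sup>+w. (\<Sum>j. ennreal (norm ((K j y w - K j y' w) * f w))) \<partial>lborel)"
    by (rule nn_integral_suminf[symmetric]) (use borel_measurable_integrable[OF i] in measurable)
  finally show ?thesis .
qed

text \<open>Take the first power of two exceeding d/\<rho>; it is not the zeroth because \<rho>
  \<le> d, and its predecessor gives k.\<close>

lemma dyadic_annulus:
  fixes d \<rho> :: real
  assumes "0 < \<rho>" "\<rho> \<le> d"
  obtains k :: nat where "2 ^ k * \<rho> \<le> d" "d < 2 * (2 ^ k * \<rho>)"
proof -
  obtain n :: nat where n: "d / \<rho> < 2 ^ n" using real_arch_pow[of 2 "d / \<rho>"] by auto
  define m where "m = (LEAST n::nat. d / \<rho> < 2 ^ n)"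
  have m: "d / \<rho> < 2 ^ m" unfolding m_def by (rule LeastI[of _ n]) (rule n)
  have "1 \<le> d / \<rho>" using assms by simp
  then have "m \<noteq> 0" using m by (intro notI) simp
  then obtain k where k: "m = Suc k" using not0_implies_Suc by blast
  have "\<not> d / \<rho> < 2 ^ k" using not_less_Least[of k "\<lambda>n. d / \<rho> < 2 ^ n"] k m_def by simp
  then show ?thesis using that[of k] m assms k by (auto simp: divide_less_eq not_less le_divide_eq mult_ac)
qed

lemma bounded_compact_support_L2:
  fixes f :: "'p::euclidean_space \<Rightarrow> complex"
  assumes "f \<in> borel_measurable borel" "bounded (range f)" "compact (closure {x. f x \<noteq> 0})"
  shows "f \<in> L2"
proof -
  obtain B where B: "\<And>x. norm (f x) \<le> B" using assms(2) unfolding bounded_iff by auto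
  have "bounded {x. f x \<noteq> 0}"
    using assms(3) compact_imp_bounded bounded_subset closure_subset by metis
  then obtain M where M: "\<And>x. f x \<noteq> 0 \<Longrightarrow> norm x \<le> M" unfolding bounded_iff by auto
  show ?thesis
  proof (rule L2_bound[OF L2_indicator[of M] assms(1)])
    show "norm (f x) \<le> B * norm (indicator (cball 0 M) x :: complex)" for x
      using B[of x] M[of x] by (cases "f x = 0") (auto simp: indicator_def)
  qed
qed

theorem theorem3p4:
  fixes hom :: bool and \<kappa> :: nat and R0 C0 C1 \<delta>0 :: real
    and E :: "real set \<Rightarrow> (((real^'a::finite) \<times> (real^'b::finite)) \<Rightarrow> complex) \<Rightarrow> ((real^'a) \<times> (real^'b) \<Rightarrow> complex)"
    and T :: "((real^'a) \<times> (real^'b) \<Rightarrow> complex) \<Rightarrow> ((real^'a) \<times> (real^'b) \<Rightarrow> complex)"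
    and K :: "nat \<Rightarrow> (real^'a) \<times> (real^'b) \<Rightarrow> (real^'a) \<times> (real^'b) \<Rightarrow> complex"
  assumes kappa: "\<kappa> \<ge> 1"
    and E: "spectral_resolution_G hom \<kappa> E"
    and T: "bounded_op T"
    and kernels: "\<forall>j. is_kernel_of (\<lambda>f. T (E (Ij j) f)) (K j)"
    and R0: "R0 > real CARD('a) + (1 + real \<kappa>) * real CARD('b)"
    and K3: "cond_K3 \<kappa> R0 K"
    and K5: "cond_K5 \<kappa> R0 K"
    and C0: "quasi_tri_const \<kappa> (TYPE((real^'a) \<times> (real^'b))) C0"
    and C1: "mean_value_const \<kappa> (TYPE((real^'a) \<times> (real^'b))) C1"
    and \<delta>0: "christ_scale \<kappa> (TYPE((real^'a) \<times> (real^'b))) \<delta>0"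
  shows "\<exists>C>0. \<forall>f :: (real^'a) \<times> (real^'b) \<Rightarrow> complex.
           f \<in> borel_measurable lborel \<and> bounded (range f) \<and> compact (closure {x. f x \<noteq> 0}) \<longrightarrow>
           (AE x in lborel. sharp_max \<kappa> T (8 * C1 * C0 ^ 3 / \<delta>0) f x \<le> ennreal C * HLmax \<kappa> f x)"
proof -
  define s where "s = 8 * C1 * C0 ^ 3 / \<delta>0"
  have c0: "C0 > 1" using C0 by (simp add: quasi_tri_const_def)
  have \<delta>: "0 < \<delta>0" "\<delta>0 < 1" using \<delta>0 by (auto simp: christ_scale_def)
  \<comment> \<open>C1 \<ge> 1 and \<delta>0 < 1 bring the dilation factor above the separation
    required by the oscillation estimate.\<close>
  have s8: "8 * C0 ^ 3 \<le> s"
  proof -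
    have "8 * C0 ^ 3 * \<delta>0 \<le> 8 * C0 ^ 3 * C1"
      using mean_value_const_ge_1[OF C1] \<delta> c0 by (intro mult_left_mono) auto
    then show ?thesis using \<delta> by (simp add: s_def pos_le_divide_eq mult_ac)
  qed
  have s1: "1 \<le> s" using s8 one_le_power[of C0 3] c0 by linarith
  obtain C \<theta> where C: "C > 0" and \<theta>: "\<theta> > 0" and osc: "\<And>(z :: ('a, 'b) pt) y y2 w r R j.
    0 < r \<Longrightarrow> y \<in> dball \<kappa> z r \<Longrightarrow> y2 \<in> dball \<kappa> z r \<Longrightarrow> 8 * C0 ^ 3 * r \<le> R \<Longrightarrow> R \<le> dist_k \<kappa> z w \<Longrightarrow> dist_k \<kappa> z w < 2 * R \<Longrightarrow>
    norm (K j y w - K j y2 w) * measure lborel (dball \<kappa> z R)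
      \<le> C * (if R \<le> 1 then (r / R) powr \<theta> else R powr (- \<theta>)) * tent \<theta> (sqrt 2 ^ j * R)"
    using kernel_oscillation[OF kappa R0 K3 K5 C0] by metis
  obtain S1 where S1: "S1 > 0" "\<And>R. R > 0 \<Longrightarrow> (\<Sum>k. ennreal (tent \<theta> (sqrt 2 ^ k * R))) \<le> ennreal S1"
    using suminf_tent[of "sqrt 2" \<theta>] \<theta> by auto
  obtain S2 where S2: "S2 > 0" "\<And>R. R > 0 \<Longrightarrow> (\<Sum>k. ennreal (tent \<theta> (2 ^ k * R))) \<le> ennreal S2"
    using suminf_tent[of 2 \<theta>] \<theta> by auto
  obtain CD where CD: "CD > 0" "\<And>(z :: ('a, 'b) pt) R. R > 0 \<Longrightarrow> measure lborel (dball \<kappa> z (2 * R)) \<le> CD * measure lborel (dball \<kappa> z R)"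
  proof -
    obtain c where c: "c > 0" "\<And>(z::('a, 'b) pt) (y::('a, 'b) pt) R \<rho>. 0 < \<rho> \<Longrightarrow> 0 < R \<Longrightarrow> norm (fst z - fst y) \<le> 0 * R \<Longrightarrow>
      measure lborel (dball \<kappa> z R) \<le> c * (max 1 (R / \<rho>)) ^ (CARD('a) + (1 + \<kappa>) * CARD('b)) * measure lborel (dball \<kappa> y \<rho>)"
      using dball_volume_compare[OF kappa order_refl, where 'a = 'a and 'b = 'b] by metis
    show ?thesis
    proof (rule that)
      show "0 < c * (max 1 2) ^ (CARD('a) + (1 + \<kappa>) * CARD('b))" using c(1) by simp
      show "measure lborel (dball \<kappa> z (2 * R)) \<le> c * (max 1 2) ^ (CARD('a) + (1 + \<kappa>) * CARD('b)) * measure lborel (dball \<kappa> z R)"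
        if "R > 0" for z :: "('a, 'b) pt" and R
        using c(2)[of R "2 * R" z z] that by simp
    qed
  qed
  obtain c1 where c1: "0 < c1"
    and vol: "\<And>(z :: ('a, 'b) pt) r. r > 0 \<Longrightarrow> emeasure lborel (dball \<kappa> z r) = ennreal (measure lborel (dball \<kappa> z r))"
    and vol_ge: "\<And>(z :: ('a, 'b) pt) r. r > 0 \<Longrightarrow> c1 * vol \<kappa> z r \<le> measure lborel (dball \<kappa> z r)"
    using dball_volume[OF kappa, where 'a = 'a and 'b = 'b] by metis
  have vol_gt: "0 < measure lborel (dball \<kappa> z r)" if "r > 0" for z :: "('a, 'b) pt" and r
    by (rule less_le_trans[OF mult_pos_pos[OF c1 vol_pos[OF that]] vol_ge[OF that]])
  define Ct where "Ct = C * S1 * CD * (2 * S2)"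
  have Ct: "Ct > 0" using C S1 CD S2 by (simp add: Ct_def)
  \<comment> \<open>The constant is uniform in the ball and in f, and x is an arbitrary point of the
    ball. Taking the supremum over balls afterwards needs no further exceptional set.\<close>
  have ball: "osc_esssup (T (\<lambda>y. f y * indicator (UNIV - dball \<kappa> z (s * r)) y)) (dball \<kappa> z r) \<le> ennreal Ct * HLmax \<kappa> f x"
    if f: "f \<in> borel_measurable borel" "bounded (range f)" "compact (closure {x. f x \<noteq> 0})" and r: "0 < r" and x: "x \<in> dball \<kappa> z r"
    for f :: "('a, 'b) pt \<Rightarrow> complex" and x z :: "('a, 'b) pt" and r
  proof -
    note [measurable] = f(1)
    define f0 where "f0 = (\<lambda>y. f y * indicator (UNIV - dball \<kappa> z (s * r)) y)"
    have f0L: "f0 \<in> L2"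
    proof (rule L2_bound[OF bounded_compact_support_L2[OF f], of _ 1])
      show "f0 \<in> borel_measurable borel" unfolding f0_def by measurable
    qed (auto simp: f0_def indicator_def)
    \<comment> \<open>The truncated function vanishes inside radius s r, so the dyadic annuli start
      there.\<close>
    define R where "R = (\<lambda>k::nat. 2 ^ k * (s * r))"
    define V where "V = (\<lambda>k. measure lborel (dball \<kappa> z (R k)))"
    define D where "D = (\<lambda>k. if R k \<le> 1 then (r / R k) powr \<theta> else R k powr (- \<theta>))"
    have sr: "0 < s * r" using s1 r by simp
    have Rpos: "0 < R k" and Rge: "s * r \<le> R k" for k
      using sr mult_right_mono[OF one_le_power[of "2::real" k] less_imp_le[OF sr]] by (auto simp: R_def)
    have Vpos: "0 < V k" for k unfolding V_def by (rule vol_gt[OF Rpos])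
    have D0: "0 \<le> D k" for k by (simp add: D_def)
    \<comment> \<open>On small annuli r/R is 1/(2^k s) and does not see r; on large ones the decay
      is in R itself. Dominating both by tents makes the sum over k bounded uniformly in r.\<close>
    have D_le: "D k \<le> tent \<theta> (2 ^ k * s) + tent \<theta> (2 ^ k * (s * r))" for k
    proof (cases "R k \<le> 1")
      case True
      have "1 \<le> 2 ^ k * s" using mult_mono[of 1 "2 ^ k" 1 s] s1 by simp
      moreover have "r / R k = inverse (2 ^ k * s)" using r s1 by (simp add: R_def field_simps)
      moreover have "inverse u powr \<theta> = u powr (- \<theta>)" if "u > 0" for u :: real
        using that by (simp add: powr_minus inverse_powr)
      ultimately have "D k = tent \<theta> (2 ^ k * s)"
        using True s1 by (simp only: D_def tent_def if_True)
      then show ?thesis using tent_nonneg[of \<theta> "2 ^ k * (s * r)"] by simp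
    next
      case False
      then have "D k = tent \<theta> (2 ^ k * (s * r))" by (simp add: D_def tent_def R_def)
      then show ?thesis using tent_nonneg[of \<theta> "2 ^ k * s"] by simp
    qed
    have D_sum: "(\<Sum>k. ennreal (D k)) \<le> ennreal (2 * S2)"
    proof -
      have "(\<Sum>k. ennreal (D k)) \<le> (\<Sum>k. ennreal (tent \<theta> (2 ^ k * s)) + ennreal (tent \<theta> (2 ^ k * (s * r))))"
        by (intro suminf_le) (auto simp: tent_nonneg D_le simp flip: ennreal_plus intro!: ennreal_leI)
      also have "\<dots> = (\<Sum>k. ennreal (tent \<theta> (2 ^ k * s))) + (\<Sum>k. ennreal (tent \<theta> (2 ^ k * (s * r))))"
        by (rule suminf_add[symmetric]) auto
      also have "\<dots> \<le> ennreal S2 + ennreal S2" using s1 sr by (intro add_mono S2(2)) auto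
      finally show ?thesis using S2(1) by (simp flip: ennreal_plus)
    qed
    \<comment> \<open>A majorant free of j, y and y2. The sum over j has been spent in S1, and the
      annulus is enlarged to the full ball of radius 2 R k, over which \<open>HLmax\<close> can be
      applied.\<close>
    define \<Phi> where "\<Phi> = (\<lambda>k w. ennreal (C * D k * S1 / V k) * (ennreal (norm (f w)) * indicator (dball \<kappa> z (2 * R k)) w))"
    have pt: "(\<Sum>j. ennreal (norm ((K j y w - K j y2 w) * f0 w))) \<le> (\<Sum>k. \<Phi> k w)"
      if y: "y \<in> dball \<kappa> z r" "y2 \<in> dball \<kappa> z r" for y y2 w
    proof (cases "w \<in> dball \<kappa> z (s * r)")
      case True
      then show ?thesis by (simp add: f0_def)
    next
      case False
      then have "s * r \<le> dist_k \<kappa> z w" by (simp add: dball_def)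
      then obtain k where k: "R k \<le> dist_k \<kappa> z w" "dist_k \<kappa> z w < 2 * R k"
        unfolding R_def by (rule dyadic_annulus[OF sr])
      have "8 * C0 ^ 3 * r \<le> s * r" using s8 r by (intro mult_right_mono) auto
      then have big: "8 * C0 ^ 3 * r \<le> R k" using Rge[of k] by linarith
      have "ennreal (norm ((K j y w - K j y2 w) * f0 w)) \<le> ennreal (C * D k / V k * norm (f w)) * ennreal (tent \<theta> (sqrt 2 ^ j * R k))" for j
      proof -
        have "norm (K j y w - K j y2 w) * V k \<le> C * D k * tent \<theta> (sqrt 2 ^ j * R k)"
          using osc[OF r y big k, of j] by (simp only: V_def D_def)
        then have "norm (K j y w - K j y2 w) \<le> C * D k * tent \<theta> (sqrt 2 ^ j * R k) / V k"
          using Vpos[of k] by (simp add: pos_le_divide_eq)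
        then have "norm (K j y w - K j y2 w) * norm (f w) \<le> C * D k * tent \<theta> (sqrt 2 ^ j * R k) / V k * norm (f w)"
          by (rule mult_right_mono) simp
        moreover have "f0 w = f w" using False by (simp add: f0_def)
        ultimately have "norm ((K j y w - K j y2 w) * f0 w) \<le> (C * D k / V k * norm (f w)) * tent \<theta> (sqrt 2 ^ j * R k)"
          by (simp add: norm_mult mult_ac)
        then show ?thesis
          using C D0[of k] Vpos[of k] tent_nonneg by (subst ennreal_mult[symmetric]) (auto intro!: ennreal_leI)
      qed
      then have "(\<Sum>j. ennreal (norm ((K j y w - K j y2 w) * f0 w))) \<le> (\<Sum>j. ennreal (C * D k / V k * norm (f w)) * ennreal (tent \<theta> (sqrt 2 ^ j * R k)))"
        by (intro suminf_le) auto
      also have "\<dots> = ennreal (C * D k / V k * norm (f w)) * (\<Sum>j. ennreal (tent \<theta> (sqrt 2 ^ j * R k)))"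
        by (rule ennreal_suminf_cmult)
      also have "\<dots> \<le> ennreal (C * D k / V k * norm (f w)) * ennreal S1"
        by (intro mult_left_mono S1(2) Rpos) simp
      also have "\<dots> = \<Phi> k w"
      proof -
        have "w \<in> dball \<kappa> z (2 * R k)" using k(2) by (simp add: dball_def)
        then show ?thesis
          using C D0[of k] Vpos[of k] S1(1) unfolding \<Phi>_def by (simp add: ennreal_mult[symmetric] mult_ac)
      qed
      \<comment> \<open>The index k depends on w; bounding the single term by the whole series
        removes this dependence before integrating.\<close>
      also have "\<dots> \<le> (\<Sum>k. \<Phi> k w)"
        using sum_le_suminf[of "\<lambda>k. \<Phi> k w" "{k}"] by simp
      finally show ?thesis .
    qed
    have int: "(\<integral>\<^sup>+w. (\<Sum>k. \<Phi> k w) \<partial>lborel) \<le> ennreal Ct * HLmax \<kappa> f x"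
    proof -
      have "(\<integral>\<^sup>+w. (\<Sum>k. \<Phi> k w) \<partial>lborel) = (\<Sum>k. \<integral>\<^sup>+w. \<Phi> k w \<partial>lborel)"
        unfolding \<Phi>_def by (rule nn_integral_suminf) measurable
      also have "\<dots> \<le> (\<Sum>k. ennreal (C * S1 * CD) * (ennreal (D k) * HLmax \<kappa> f x))"
      proof (intro suminf_le summableI)
        fix k
        have xk: "x \<in> dball \<kappa> z (2 * R k)"
        proof -
          have "1 * r \<le> s * r" using s1 r by (intro mult_right_mono) auto
          then have "r \<le> 2 * R k" using Rge[of k] Rpos[of k] by linarith
          then show ?thesis using x dball_mono by blast
        qed
        have "(\<integral>\<^sup>+w. \<Phi> k w \<partial>lborel) = ennreal (C * D k * S1 / V k) * (\<integral>\<^sup>+w\<in>dball \<kappa> z (2 * R k). ennreal (norm (f w)) \<partial>lborel)"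
          unfolding \<Phi>_def by (rule nn_integral_cmult) measurable
        also have "\<dots> \<le> ennreal (C * D k * S1 / V k) * (emeasure lborel (dball \<kappa> z (2 * R k)) * HLmax \<kappa> f x)"
          using Rpos[of k] by (intro mult_left_mono HLmax_ge[OF kappa _ xk]) auto
        \<comment> \<open>Doubling trades the enlarged ball for V k, which cancels the denominator
          in \<Phi>.\<close>
        also have "emeasure lborel (dball \<kappa> z (2 * R k)) \<le> ennreal (CD * V k)"
          using Rpos[of k] CD(2)[OF Rpos[of k], of z] by (subst vol) (auto simp: V_def intro: ennreal_leI)
        also have "ennreal (C * D k * S1 / V k) * (ennreal (CD * V k) * HLmax \<kappa> f x) = ennreal ((C * D k * S1 / V k) * (CD * V k)) * HLmax \<kappa> f x"
          using C D0[of k] Vpos[of k] S1(1) CD(1) by (subst mult.assoc[symmetric], subst ennreal_mult[symmetric]) auto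
        also have "(C * D k * S1 / V k) * (CD * V k) = (C * S1 * CD) * D k" using Vpos[of k] by simp
        also have "ennreal ((C * S1 * CD) * D k) * HLmax \<kappa> f x = ennreal (C * S1 * CD) * (ennreal (D k) * HLmax \<kappa> f x)"
          using C D0[of k] S1(1) CD(1) by (subst ennreal_mult) (auto simp: mult.assoc)
        finally show "(\<integral>\<^sup>+w. \<Phi> k w \<partial>lborel) \<le> ennreal (C * S1 * CD) * (ennreal (D k) * HLmax \<kappa> f x)"
          by (simp add: mult_left_mono mult_right_mono)
      qed
      also have "\<dots> = ennreal (C * S1 * CD) * ((\<Sum>k. ennreal (D k)) * HLmax \<kappa> f x)" by simp
      also have "\<dots> \<le> ennreal (C * S1 * CD) * (ennreal (2 * S2) * HLmax \<kappa> f x)"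
        by (intro mult_left_mono mult_right_mono D_sum) auto
      also have "\<dots> = ennreal Ct * HLmax \<kappa> f x"
        unfolding Ct_def using C S1(1) CD(1) S2(1) by (subst ennreal_mult) (auto simp: mult.assoc)
      finally show ?thesis .
    qed
    obtain N :: "nat \<Rightarrow> nat" where N: "AE x in lborel. (\<forall>j. integrable lborel (\<lambda>y. K j x y * f0 y)) \<and>
      (\<lambda>i. \<Sum>j<N i. \<integral>y. K j x y * f0 y \<partial>lborel) \<longlonglongrightarrow> T f0 x"
      using kernel_expansion[OF E T kernels[rule_format] f0L] by blast
    \<comment> \<open>The expansion holds at almost every point, hence at both components of almost
      every pair; the subsequence is the same for both, as the difference estimate requires.\<close>
    have "AE p in lborel. p \<in> dball \<kappa> z r \<times> dball \<kappa> z r \<longrightarrow> ennreal (norm (T f0 (fst p) - T f0 (snd p))) \<le> ennreal Ct * HLmax \<kappa> f x"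
      using AE_pair_lborel[OF N]
    proof eventually_elim
      case (elim p)
      show ?case
      proof
        assume p: "p \<in> dball \<kappa> z r \<times> dball \<kappa> z r"
        have "ennreal (norm (T f0 (fst p) - T f0 (snd p))) \<le> (\<integral>\<^sup>+w. (\<Sum>j. ennreal (norm ((K j (fst p) w - K j (snd p) w) * f0 w))) \<partial>lborel)"
          using elim by (intro kernel_difference_bound[where N = N]) auto
        also have "\<dots> \<le> (\<integral>\<^sup>+w. (\<Sum>k. \<Phi> k w) \<partial>lborel)"
          using p by (intro nn_integral_mono pt) (auto simp: mem_Times_iff)
        also note int
        finally show "ennreal (norm (T f0 (fst p) - T f0 (snd p))) \<le> ennreal Ct * HLmax \<kappa> f x" .
      qed
    qed
    then show ?thesis
      unfolding osc_esssup_def f0_def by (intro Inf_lower) simp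
  qed
  have "AE x in lborel. sharp_max \<kappa> T s f x \<le> ennreal Ct * HLmax \<kappa> f x"
    if f: "f \<in> borel_measurable borel" "bounded (range f)" "compact (closure {x. f x \<noteq> 0})" for f :: "('a, 'b) pt \<Rightarrow> complex"
  proof (rule AE_I2)
    fix x
    show "sharp_max \<kappa> T s f x \<le> ennreal Ct * HLmax \<kappa> f x"
      unfolding sharp_max_def
    proof (rule SUP_least)
      fix zr :: "('a, 'b) pt \<times> real"
      assume "zr \<in> {(z, r). 0 < r \<and> x \<in> dball \<kappa> z r}"
      then show "osc_esssup (T (\<lambda>y. f y * indicator (UNIV - dball \<kappa> (fst zr) (s * snd zr)) y)) (dball \<kappa> (fst zr) (snd zr)) \<le> ennreal Ct * HLmax \<kappa> f x"
        by (intro ball[OF f]) auto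
    qed
  qed
  then show ?thesis
    unfolding s_def[symmetric] using Ct by (intro exI[of _ Ct]) auto
qed

end
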